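(* Let $p$ be a power of $2$ and let $S(x)=x^p+a_0x$ with $a_0\in\mathbb{F}_{p^2}$. Assume that $a_0\in\mathbb{F}_p$ and $\mathrm{Tr}_{\mathbb{F}_p/\mathbb{F}_2}(a_0)=1$. Then the smooth compactification $\overline{C}_S$ of the affine curve $C_S: y^p+y=xS(x)=x^{p+1}+a_0x^2$ is $\mathbb{F}_{p^4}$-maximal.
   Context: A smooth projective geometrically connected curve $C$ of genus $g$ over $\mathbb{F}_{p^4}$ is $\mathbb{F}_{p^4}$-maximal if $|C(\mathbb{F}_{p^4})|=p^4+1+2gp^2$. *)

theory Defs
  imports
    "HOL-Computational_Algebra.Computational_Algebra"
    "HOL-Algebra.Algebraic_Closure_Type"
    "HOL-Library.FuncSet"
    "HOL-Library.Cardinality"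
begin

text \<open>
  A plane curve over a field is given by a polynomial of type \<open>'k poly poly\<close>: the outer variable
  is Y, the coefficients are polynomials in X.

  The smooth compactification of a geometrically irreducible affine curve C over a perfect field k
  is the regular projective model of the function field F = k(C) (the complete abstract nonsingular
  curve of Hartshorne I.6): its closed points are the valuation rings of F/k, the residue field of
  a closed point is that of the valuation ring, and its divisors, Riemann-Roch spaces and genus are
  those of F/k (Stichtenoth, Algebraic Function Fields and Codes, Chapter 1).

  The function field is realised inside an arbitrary ambient field \<open>'l\<close>, with an
  embedding \<open>\<iota>\<close> of k.  It is generated by the coordinates of a generic point of C, i.e. a point
  (x,y) at which exactly the multiples of the equation f vanish; so k[x,y] is k[X,Y]/(f).
\<close>

subsection \<open>Plane curves and their function fields\<close>

definition field_embedding :: "('k::field \<Rightarrow> 'l::field) \<Rightarrow> bool" where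
  "field_embedding \<iota> \<longleftrightarrow>
     \<iota> 1 = 1 \<and> (\<forall>a b. \<iota> (a + b) = \<iota> a + \<iota> b) \<and> (\<forall>a b. \<iota> (a * b) = \<iota> a * \<iota> b)"

definition eval2 :: "('k::field \<Rightarrow> 'l::field) \<Rightarrow> 'k poly poly \<Rightarrow> 'l \<Rightarrow> 'l \<Rightarrow> 'l" where
  "eval2 \<iota> g x y = poly (map_poly (\<lambda>c. poly (map_poly \<iota> c) x) g) y"

definition generic_point :: "('k::field \<Rightarrow> 'l::field) \<Rightarrow> 'k poly poly \<Rightarrow> 'l \<Rightarrow> 'l \<Rightarrow> bool" where
  "generic_point \<iota> f x y \<longleftrightarrow> (\<forall>g. eval2 \<iota> g x y = 0 \<longleftrightarrow> f dvd g)"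

definition function_field :: "('k::field \<Rightarrow> 'l::field) \<Rightarrow> 'l \<Rightarrow> 'l \<Rightarrow> 'l set" where
  "function_field \<iota> x y = {eval2 \<iota> g x y / eval2 \<iota> h x y | g h. eval2 \<iota> h x y \<noteq> 0}"

definition geometrically_irreducible :: "'k::field poly poly \<Rightarrow> bool" where
  "geometrically_irreducible f \<longleftrightarrow>
     Factorial_Ring.irreducible (map_poly (map_poly to_ac) f :: 'k alg_closure poly poly)"

subsection \<open>Closed points of the smooth projective model\<close>

definition places :: "('k::field \<Rightarrow> 'l::field) \<Rightarrow> 'l set \<Rightarrow> 'l set set" where
  "places \<iota> F = {R. range \<iota> \<subset> R \<and> R \<subset> F
      \<and> (\<forall>a\<in>R. \<forall>b\<in>R. a - b \<in> R \<and> a * b \<in> R)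
      \<and> (\<forall>z\<in>F. z \<in> R \<or> inverse z \<in> R)}"

text \<open>The case distinction on 0 is needed because \<open>inverse 0 = 0\<close>.\<close>

definition max_ideal :: "'l::field set \<Rightarrow> 'l set" where
  "max_ideal R = {z \<in> R. z = 0 \<or> inverse z \<notin> R}"

definition uniformizer :: "'l::field set \<Rightarrow> 'l \<Rightarrow> bool" where
  "uniformizer R t \<longleftrightarrow> max_ideal R = {t * r | r. r \<in> R}"

text \<open>Valuation rings of a function field in one variable are discrete, so the valuation of a
  nonzero element is defined; the value at 0 (morally infinite) is never used.\<close>

definition valuation :: "'l::field set \<Rightarrow> 'l \<Rightarrow> int" where
  "valuation R z =
     (THE n. \<exists>t u. uniformizer R t \<and> u \<in> R - max_ideal R \<and> z = u * (t powi n))"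

text \<open>The degree of the residue field over k: \<open>B\<close> consists of representatives of a k-basis of
  the residue field.\<close>

definition place_degree :: "('k::field \<Rightarrow> 'l::field) \<Rightarrow> 'l set \<Rightarrow> nat" where
  "place_degree \<iota> R = (THE d. \<exists>B. finite B \<and> card B = d \<and> B \<subseteq> R \<and>
     (\<forall>z\<in>R. \<exists>!c. c \<in> B \<rightarrow>\<^sub>E (UNIV :: 'k set) \<and> z - (\<Sum>b\<in>B. \<iota> (c b) * b) \<in> max_ideal R))"

definition rational_points :: "('k::field \<Rightarrow> 'l::field) \<Rightarrow> 'l set \<Rightarrow> 'l set set" where
  "rational_points \<iota> F = {P \<in> places \<iota> F. place_degree \<iota> P = 1}"

subsection \<open>Divisors and genus\<close>

definition divisors :: "('k::field \<Rightarrow> 'l::field) \<Rightarrow> 'l set \<Rightarrow> ('l set \<Rightarrow> int) set" where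
  "divisors \<iota> F = {D. finite {P. D P \<noteq> 0} \<and> {P. D P \<noteq> 0} \<subseteq> places \<iota> F}"

definition divisor_degree :: "('k::field \<Rightarrow> 'l::field) \<Rightarrow> ('l set \<Rightarrow> int) \<Rightarrow> int" where
  "divisor_degree \<iota> D = (\<Sum>P | D P \<noteq> 0. D P * int (place_degree \<iota> P))"

definition riemann_roch_space ::
    "('k::field \<Rightarrow> 'l::field) \<Rightarrow> 'l set \<Rightarrow> ('l set \<Rightarrow> int) \<Rightarrow> 'l set" where
  "riemann_roch_space \<iota> F D =
     {z \<in> F. z = 0 \<or> (\<forall>P\<in>places \<iota> F. valuation P z \<ge> - D P)}"

definition ell :: "('k::field \<Rightarrow> 'l::field) \<Rightarrow> 'l set \<Rightarrow> ('l set \<Rightarrow> int) \<Rightarrow> nat" where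
  "ell \<iota> F D = vector_space.dim (\<lambda>c z. \<iota> c * z) (riemann_roch_space \<iota> F D)"

text \<open>The genus is the maximum of deg D - ell D + 1 over all divisors D.\<close>

definition has_genus :: "('k::field \<Rightarrow> 'l::field) \<Rightarrow> 'l set \<Rightarrow> nat \<Rightarrow> bool" where
  "has_genus \<iota> F g \<longleftrightarrow>
     (\<forall>D\<in>divisors \<iota> F. divisor_degree \<iota> D - int (ell \<iota> F D) + 1 \<le> int g) \<and>
     (\<exists>D\<in>divisors \<iota> F. divisor_degree \<iota> D - int (ell \<iota> F D) + 1 = int g)"

subsection \<open>Maximality\<close>

text \<open>For a smooth projective model over a perfect field k, geometric connectedness says that k is
  algebraically closed in the function field.\<close>

definition full_constant_field :: "('k::field \<Rightarrow> 'l::field) \<Rightarrow> 'l set \<Rightarrow> bool" where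
  "full_constant_field \<iota> F \<longleftrightarrow>
     (\<forall>z\<in>F. (\<exists>h::'k poly. h \<noteq> 0 \<and> poly (map_poly \<iota> h) z = 0) \<longrightarrow> z \<in> range \<iota>)"

definition maximal_model :: "nat \<Rightarrow> ('k::{field,finite} \<Rightarrow> 'l::field) \<Rightarrow> 'l set \<Rightarrow> bool" where
  "maximal_model p \<iota> F \<longleftrightarrow>
     CARD('k) = p ^ 4 \<and> full_constant_field \<iota> F \<and> finite (rational_points \<iota> F) \<and>
     (\<exists>g. has_genus \<iota> F g \<and> card (rational_points \<iota> F) = p ^ 4 + 1 + 2 * g * p ^ 2)"

text \<open>The function field is unique up to isomorphism over k, so all realisations in \<open>'l\<close> are
  considered.  For \<open>'l = 'k poly fract alg_closure\<close> a realisation exists as soon as \<open>f\<close> is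
  irreducible of positive degree in Y: take a root of \<open>f\<close> over k(X).\<close>

definition smooth_compactification_maximal ::
    "'l::field itself \<Rightarrow> nat \<Rightarrow> 'k::{field,finite} poly poly \<Rightarrow> bool" where
  "smooth_compactification_maximal _ p f \<longleftrightarrow>
     geometrically_irreducible f \<and>
     (\<forall>(\<iota> :: 'k \<Rightarrow> 'l) x y. field_embedding \<iota> \<and> generic_point \<iota> f x y \<longrightarrow>
        maximal_model p \<iota> (function_field \<iota> x y))"

subsection \<open>The curve\<close>

text \<open>The subfield with \<open>q\<close> elements of a finite field, provided that there is one.\<close>

definition subfield_of_card :: "nat \<Rightarrow> 'k::{field,finite} set" where
  "subfield_of_card q = {a. a ^ q = a}"

text \<open>The trace from the field with \<open>q ^ m\<close> elements to the field with \<open>q\<close> elements: the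
  Galois group is generated by the \<open>q\<close>-th power map.\<close>

definition finite_field_trace :: "nat \<Rightarrow> nat \<Rightarrow> 'k::{field,finite} \<Rightarrow> 'k" where
  "finite_field_trace q m a = (\<Sum>i<m. a ^ (q ^ i))"

definition S_poly :: "nat \<Rightarrow> 'k::field \<Rightarrow> 'k poly" where
  "S_poly p a0 = monom 1 p + monom a0 1"

text \<open>Y^p + Y - X S(X)\<close>

definition C_poly :: "nat \<Rightarrow> 'k::field poly \<Rightarrow> 'k poly poly" where
  "C_poly p S = monom 1 p + monom 1 1 - [:[:0, 1:] * S:]"

end

theory Submission
  imports Defs "HOL-Number_Theory.Residues"
begin

text \<open>
  Let \<open>A = k[x,y]\<close>, graded by the pole order at infinity: \<open>x\<close> has weight \<open>p\<close> and \<open>y\<close> has weight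
  \<open>p + 1\<close>.  The monomials \<open>x\<^sup>i y\<^sup>j\<close> with \<open>j < p\<close> are a basis of \<open>A\<close> with distinct weights, and the gaps
  of the semigroup of weights number \<open>p (p - 1) / 2\<close>; this is the genus.  The element
  \<open>h = x\<^sup>Q - x\<close>, \<open>Q = q\<^sup>N\<close>, satisfies \<open>a\<^bsup>Q\<^sup>2\<^esup> - a \<in> h A\<close> for all \<open>a \<in> A\<close>; hence \<open>A / h A\<close> is reduced, \<open>h\<close>
  is a uniformizer at each of its zeros, and every affine place is a zero of such an \<open>h\<close>.  So every
  divisor lies below some \<open>D = M (h)\<^sub>0 + m P\<^sub>\<infinity>\<close>, for which \<open>L(D) = h\<^bsup>-M\<^esup> L((m + M deg h) P\<^sub>\<infinity>)\<close> is explicit, and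
  Riemann's inequality follows from the monotonicity of \<open>deg D - ell D\<close>.  Since \<open>k\<close> is finite, dimensions
  are compared by counting elements.

  For the points: the trace from \<open>k\<close> to the field with \<open>p\<close> elements of \<open>x\<^bsup>p+1\<^esup> + a\<^sub>0 x\<^sup>2\<close> is
  \<open>w\<^bsup>p+1\<^esup> + a\<^sub>0 (w\<^sup>2 + w\<^bsup>2p\<^esup>)\<close> with \<open>w = x\<^bsup>p^2\<^esup> + x\<close>.  With \<open>u = w\<^bsup>p-1\<^esup>\<close> its nonzero zeros satisfy
  \<open>a\<^sub>0 u\<^sup>2 + u + a\<^sub>0 = 0\<close>, and the trace condition on \<open>a\<^sub>0\<close> says that this quadratic is irreducible
  over that field, so that its two roots are conjugate and have norm 1.
\<close>

subsection \<open>Finite fields of characteristic two\<close>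

text \<open>Places are arbitrary valuation rings and the genus is a maximum over all divisors, so
  places with large residue fields must be reached too. This is why \<open>N\<close> varies:
  \<open>h N\<close> vanishes at the affine places where the residue of \<open>x\<close> lies in the
  field with \<open>Q\<close> elements. Above such a residue, y^Q - y also lies in that field, so in
  characteristic 2 \<open>y\<close> is fixed by the square of the Q-th power map; hence the exponent
  Q^2. The congruence does the work of smoothness: the cover of the \<open>x\<close>-line is
  unramified over the affine part, so the separable polynomial \<open>h N\<close> keeps simple zeros
  upstairs.

  In the count, \<open>x\<close> carries points iff the trace of the right-hand side vanishes
  (additive Hilbert 90). The two roots of the quadratic give two lines over the field with
  \<open>p\<close> elements, hence 2p - 1 values \<open>w\<close>; each comes from p^2 values
  \<open>x\<close>, and each such \<open>x\<close> carries \<open>p\<close> values \<open>y\<close>.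
  With infinity this makes p^3 (2p - 1) + 1 = p^4 + 1 + p (p - 1) p^2, which is maximality for 2g =
  p (p - 1).\<close>

lemma finite_field_power_card:
  fixes a :: "'k::{field,finite}"
  shows "a ^ CARD('k) = a"
proof (cases "a = 0")
  case False
  let ?U = "UNIV - {0::'k}"
  have "bij_betw ((*) a) ?U ?U"
    by (rule bij_betwI[where g = "(*) (inverse a)"]) (use False in \<open>auto simp: field_simps\<close>)
  then have "(\<Prod>x\<in>?U. a * x) = \<Prod>?U"
    by (rule prod.reindex_bij_betw[where g = "\<lambda>x. x"])
  then have "a ^ card ?U * \<Prod>?U = \<Prod>?U" by (simp add: prod.distrib)
  moreover have "\<Prod>?U \<noteq> 0" by simp
  ultimately have "a ^ card ?U = 1" by simp
  moreover have "CARD('k) = Suc (card ?U)" using card_Suc_Diff1[of UNIV "0::'k"] by simp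
  ultimately show ?thesis by (simp only: power_Suc mult_1_right)
qed auto

lemma finite_field_power_card_power:
  fixes a :: "'k::{field,finite}"
  shows "a ^ (CARD('k) ^ m) = a" by (induction m) (simp_all add: power_mult finite_field_power_card)

lemma finite_field_two_eq_0:
  assumes "CARD('k::{field,finite}) = 2 ^ m"
  shows "(2::'k) = 0"
proof -
  have "of_nat CARD('k) = (0::'k)"
    using CHAR_dvd_CARD[where ?'a = 'k] by (simp only: of_nat_eq_0_iff_char_dvd)
  then show ?thesis using assms by simp
qed

lemma char2_add_self:
  assumes "(2::'a::comm_ring_1) = 0"
  shows "a + a = (0::'a)" using assms by (metis mult_2 mult_zero_left)

lemma char2_uminus:
  assumes "(2::'a::comm_ring_1) = 0"
  shows "- a = (a::'a)"
  using char2_add_self[OF assms, of a] by (simp add: eq_neg_iff_add_eq_0 minus_unique)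

lemma char2_diff:
  assumes "(2::'a::comm_ring_1) = 0"
  shows "a - b = a + (b::'a)" using char2_uminus[OF assms, of b] by (metis diff_conv_add_uminus)

lemma char2_add_eq_0_iff:
  assumes "(2::'a::comm_ring_1) = 0"
  shows "a + b = 0 \<longleftrightarrow> a = (b::'a)"
  by (metis assms char2_uminus eq_neg_iff_add_eq_0)

lemma char2_add_power:
  assumes "(2::'a::comm_ring_1) = 0"
  shows "(a + b) ^ (2 ^ m) = (a::'a) ^ (2 ^ m) + b ^ (2 ^ m)"
proof (induction m)
  case (Suc m)
  have "(u + v)\<^sup>2 = u\<^sup>2 + v\<^sup>2" for u v :: 'a by (simp add: power2_sum assms)
  with Suc show ?case
    by (simp add: power_mult power_even_eq mult.commute[of 2])
qed simp

lemma char2_sum_power: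
  assumes "(2::'a::comm_ring_1) = 0"
  shows "(\<Sum>i\<in>I. f i) ^ (2 ^ m) = (\<Sum>i\<in>I. (f i :: 'a) ^ (2 ^ m))"
  by (induction I rule: infinite_finite_induct) (simp_all add: char2_add_power[OF assms] zero_power)

text \<open>Each fibre over a point of the image is a coset of the kernel.\<close>

lemma card_vimage_additive:
  fixes f :: "'a::{ab_group_add,finite} \<Rightarrow> 'b::ab_group_add"
  assumes add: "\<And>a b. f (a + b) = f a + f b" and T: "T \<subseteq> range f"
  shows "card {x. f x \<in> T} = card {x. f x = 0} * card T"
proof -
  have fin: "finite T" using finite_subset[OF T] by simp
  have "card {x. f x = t} = card {x. f x = 0}" if "t \<in> T" for t
  proof -
    obtain s where s: "f s = t"
      using T \<open>t \<in> T\<close> by auto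
    have "bij_betw ((+) s) {x. f x = 0} {x. f x = t}"
    proof (rule bij_betwI[where g = "\<lambda>x. x - s"])
      show "(\<lambda>x. x - s) \<in> {x. f x = t} \<rightarrow> {x. f x = 0}"
      proof
        fix x assume "x \<in> {x. f x = t}"
        with add[of "x - s" s] s show "x - s \<in> {x. f x = 0}"
          by simp
      qed
    qed (use s add in auto)
    then show ?thesis by (rule bij_betw_same_card[symmetric])
  qed
  moreover have "card {x. f x \<in> T} = (\<Sum>t\<in>T. card {x. f x = t})"
  proof -
    have "{x. f x \<in> T} = (\<Union>t\<in>T. {x. f x = t})" by auto
    then show ?thesis by (simp only:) (rule card_UN_disjoint, use fin in auto)
  qed
  ultimately show ?thesis by simp
qed

text \<open>The image of \<open>f\<close> lies in the kernel of \<open>g\<close>, and |ker f| |im f|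
  = r s. With at most \<open>r\<close> and \<open>s\<close> elements in the two kernels, both bounds
  are attained. This turns bounds on numbers of roots into additive Hilbert 90.\<close>

lemma additive_exactness:
  fixes f g :: "'a::{ab_group_add,finite} \<Rightarrow> 'a"
  assumes "\<And>a b. f (a + b) = f a + f b" and "\<And>a. g (f a) = 0"
    and "card {x. f x = 0} \<le> r" and "card {x. g x = 0} \<le> s" and "CARD('a) = r * s"
  shows "card {x. f x = 0} = r" and "range f = {x. g x = 0}"
proof -
  have sub: "range f \<subseteq> {x. g x = 0}" using assms(2) by auto
  have card: "r * s = card {x. f x = 0} * card (range f)"
    using card_vimage_additive[OF assms(1) order_refl] assms(5) by simp
  have le: "card (range f) \<le> s" using card_mono[OF _ sub] assms(4) by auto
  have pos: "r * s > 0" using assms(5) by (metis finite_UNIV_card_ge_0 finite)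
  have "r * card (range f) \<ge> r * s" using card assms(3) by simp
  then have ran: "card (range f) = s" using le pos by simp
  with card pos show "card {x. f x = 0} = r"
    by simp
  show "range f = {x. g x = 0}"
    using sub assms(4) ran by (intro card_subset_eq) (auto simp: card_mono antisym)
qed

lemma card_roots_le:
  fixes f :: "'a::idom poly"
  assumes "\<And>x. poly f x = F x" and "degree f \<le> d" and "f \<noteq> 0"
  shows "card {x. F x = 0} \<le> d" using card_poly_roots_bound[OF assms(3)] assms(1,2) by simp

subsection \<open>The number of affine points\<close>

definition affine_points :: "nat \<Rightarrow> 'k::field \<Rightarrow> ('k \<times> 'k) set" where
  "affine_points p a = {(x, y). y ^ p + y = x ^ (p + 1) + a * x\<^sup>2}"

locale base_field =
  fixes n p :: nat and k_type :: "'k::{field,finite} itself"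
  assumes n: "n \<ge> 1" and p: "p = 2 ^ n" and card_k: "CARD('k) = p ^ 4"
begin

lemma p_ge_2: "p \<ge> 2"
  using n self_le_power[of 2 n] by (simp add: p)

lemma card_k_exp: "CARD('k) = 2 ^ (4 * n)"
  by (simp add: card_k p power_mult mult.commute)

lemma two_k: "(2::'k) = 0"
  by (rule finite_field_two_eq_0[OF card_k_exp])

lemma add_power_p: "(a + b) ^ (p ^ j) = (a::'k) ^ (p ^ j) + b ^ (p ^ j)"
  using char2_add_power[OF two_k, of a b "n * j"] by (simp add: p power_mult)

lemmas add_power_p1 = add_power_p[of _ _ 1, simplified]

lemma power_p4: "(a::'k) ^ (p ^ 4) = a"
  using finite_field_power_card[of a] card_k by simp

lemma p_powers: "1 < p" "p < p\<^sup>2" "p\<^sup>2 < p ^ 3" "p < p ^ 3" "1 < p\<^sup>2" "1 < p ^ 3"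
  using p_ge_2 power_strict_increasing[of 1 2 p] power_strict_increasing[of 2 3 p]
    power_strict_increasing[of 1 3 p] by simp_all

text \<open>Additive Hilbert 90 over the subfield with \<open>p\<close> elements: in characteristic
  2 the map is Frobenius minus identity, and the sum of the four conjugates is the trace.\<close>

lemma range_artin_schreier:
  "card {c::'k. c ^ p + c = 0} = p"
  "range (\<lambda>c::'k. c ^ p + c) = {c. c + c ^ p + c ^ p\<^sup>2 + c ^ p ^ 3 = 0}"
proof -
  note pp = p_powers
  have 1: "card {c::'k. c ^ p + c = 0} \<le> p"
  proof (rule card_roots_le[where f = "monom 1 p + monom 1 1"])
    show "monom 1 p + monom 1 1 \<noteq> (0::'k poly)"
      using pp by (simp add: poly_eq_iff exI[of _ p])
  qed (use pp in \<open>auto simp: poly_monom intro!: degree_add_le degree_monom_le[THEN order_trans]\<close>)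
  have 2: "card {c::'k. c + c ^ p + c ^ p\<^sup>2 + c ^ p ^ 3 = 0} \<le> p ^ 3"
  proof (rule card_roots_le[where f = "monom 1 1 + monom 1 p + monom 1 (p\<^sup>2) + monom 1 (p ^ 3)"])
    show "monom 1 1 + monom 1 p + monom 1 (p\<^sup>2) + monom 1 (p ^ 3) \<noteq> (0::'k poly)"
      using pp by (auto simp: poly_eq_iff intro!: exI[of _ "p ^ 3"])
  qed (use pp in \<open>auto simp: poly_monom intro!: degree_add_le degree_monom_le[THEN order_trans]\<close>)
  have add: "(a + b) ^ p + (a + b) = (a ^ p + a) + (b ^ p + b)" for a b :: 'k
    by (simp add: add_power_p1)
  have zero: "(c ^ p + c) + (c ^ p + c) ^ p + (c ^ p + c) ^ p\<^sup>2 + (c ^ p + c) ^ p ^ 3 = 0" for c :: 'k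
  proof -
    have "p * p = p\<^sup>2" "p * p\<^sup>2 = p ^ 3" "p * p ^ 3 = p ^ 4"
      by (simp_all add: power2_eq_square power3_eq_cube power4_eq_xxxx)
    then have "(c ^ p) ^ p = c ^ p\<^sup>2" "(c ^ p) ^ p\<^sup>2 = c ^ p ^ 3" "(c ^ p) ^ p ^ 3 = c"
      using power_p4[of c] by (simp_all only: power_mult[symmetric])
    then have "(c ^ p + c) + (c ^ p + c) ^ p + (c ^ p + c) ^ p\<^sup>2 + (c ^ p + c) ^ p ^ 3
      = 2 * (c + c ^ p + c ^ p\<^sup>2 + c ^ p ^ 3)"
      by (simp add: add_power_p add_power_p1)
    then show ?thesis by (simp add: two_k)
  qed
  have c: "CARD('k) = p * p ^ 3" by (simp add: card_k flip: power_Suc)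
  show "card {c::'k. c ^ p + c = 0} = p" by (rule additive_exactness(1)[OF add zero 1 2 c])
  show "range (\<lambda>c::'k. c ^ p + c) = {c. c + c ^ p + c ^ p\<^sup>2 + c ^ p ^ 3 = 0}"
    by (rule additive_exactness(2)[OF add zero 1 2 c])
qed

text \<open>The map is the trace to the subfield with p^2 elements; in characteristic 2 it is also
  Frobenius minus identity for that subfield, so kernel and image coincide.\<close>

lemma range_half_trace:
  "card {c::'k. c ^ p\<^sup>2 + c = 0} = p\<^sup>2"
  "range (\<lambda>c::'k. c ^ p\<^sup>2 + c) = {c. c ^ p\<^sup>2 + c = 0}"
proof -
  note pp = p_powers
  have 1: "card {c::'k. c ^ p\<^sup>2 + c = 0} \<le> p\<^sup>2"
  proof (rule card_roots_le[where f = "monom 1 (p\<^sup>2) + monom 1 1"])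
    show "monom 1 (p\<^sup>2) + monom 1 1 \<noteq> (0::'k poly)"
      using pp by (auto simp: poly_eq_iff intro!: exI[of _ "p\<^sup>2"])
  qed (use pp in \<open>auto simp: poly_monom intro!: degree_add_le degree_monom_le[THEN order_trans]\<close>)
  have add: "(a + b) ^ p\<^sup>2 + (a + b) = (a ^ p\<^sup>2 + a) + (b ^ p\<^sup>2 + b)" for a b :: 'k
    by (simp add: add_power_p)
  have zero: "(c ^ p\<^sup>2 + c) ^ p\<^sup>2 + (c ^ p\<^sup>2 + c) = 0" for c :: 'k
  proof -
    have "(c ^ p\<^sup>2) ^ p\<^sup>2 = c"
      using power_p4[of c] by (simp only: power_mult[symmetric] power_add[symmetric]) simp
    then have "(c ^ p\<^sup>2 + c) ^ p\<^sup>2 + (c ^ p\<^sup>2 + c) = 2 * (c + c ^ p\<^sup>2)"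
      by (simp add: add_power_p)
    then show ?thesis by (simp add: two_k)
  qed
  have c: "CARD('k) = p\<^sup>2 * p\<^sup>2" by (simp add: card_k flip: power_add)
  show "card {c::'k. c ^ p\<^sup>2 + c = 0} = p\<^sup>2"
    by (rule additive_exactness(1)[OF add zero 1 1 c])
  show "range (\<lambda>c::'k. c ^ p\<^sup>2 + c) = {c. c ^ p\<^sup>2 + c = 0}"
    by (rule additive_exactness(2)[OF add zero 1 1 c])
qed

text \<open>Hilbert 90 over the prime field; it serves to solve v^2 + v = a^2 in
  \<open>card_isotropic\<close>.\<close>

lemma range_square_plus:
  "range (\<lambda>c::'k. c\<^sup>2 + c) = {c. (\<Sum>i<4 * n. c ^ 2 ^ i) = 0}"
proof -
  define m where "m = 4 * n - 1"
  have m: "4 * n = Suc m" "m \<ge> 1" using n by (auto simp: m_def)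
  have 1: "card {c::'k. c\<^sup>2 + c = 0} \<le> 2"
  proof (rule card_roots_le[where f = "[:0, 1, 1:]"])
  qed (auto simp: power2_eq_square algebra_simps)
  have 2: "card {c::'k. (\<Sum>i<4 * n. c ^ 2 ^ i) = 0} \<le> 2 ^ m"
  proof (rule card_roots_le[where f = "\<Sum>i<4 * n. monom 1 (2 ^ i)"])
    have "coeff (\<Sum>i<4 * n. monom 1 (2 ^ i)) (2 ^ m) = (\<Sum>i<Suc m. if i = m then 1 else (0::'k))"
      unfolding m coeff_sum by (intro sum.cong) auto
    then show "(\<Sum>i<4 * n. monom 1 (2 ^ i)) \<noteq> (0::'k poly)" by auto
    show "degree (\<Sum>i<4 * n. monom 1 (2 ^ i) :: 'k poly) \<le> 2 ^ m"
      unfolding m by (intro degree_sum_le) (auto intro!: degree_monom_le[THEN order_trans])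
  qed (simp add: poly_sum poly_monom)
  have add: "(a + b)\<^sup>2 + (a + b) = (a\<^sup>2 + a) + (b\<^sup>2 + b)" for a b :: 'k
    using char2_add_power[OF two_k, of a b 1] by simp
  have zero: "(\<Sum>i<4 * n. (c\<^sup>2 + c) ^ 2 ^ i) = 0" for c :: 'k
  proof -
    have "(\<Sum>i<N. (c\<^sup>2 + c) ^ 2 ^ i) = c ^ 2 ^ N + c" for N
    proof (induction N)
      case 0
      then show ?case using char2_add_self[OF two_k, of c] by simp
    next
      case (Suc N)
      have "(c\<^sup>2 + c) ^ 2 ^ N = c ^ 2 ^ Suc N + c ^ 2 ^ N"
        by (simp add: char2_add_power[OF two_k] flip: power_mult)
      with Suc show ?case
        using char2_add_self[OF two_k, of "c ^ 2 ^ N"] by (simp add: algebra_simps)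
    qed
    then show ?thesis
      using finite_field_power_card[of c] char2_add_self[OF two_k, of c] by (simp add: card_k_exp)
  qed
  have c: "CARD('k) = 2 * 2 ^ m" by (simp add: card_k_exp m)
  show ?thesis by (rule additive_exactness(2)[OF add zero 1 2 c])
qed

text \<open>With the conjugates x, x1, x2, x3 the cross terms are x x1 + x1 x2 + x2 x3 + x3 x = (x +
  x2)(x1 + x3), and in characteristic 2 the squares combine likewise. So the trace depends on
  \<open>x\<close> only through w = x + x2, with w^p = x1 + x3.\<close>

lemma trace_form:
  fixes x :: 'k
  assumes a: "a ^ p = a" and w: "w = x ^ p\<^sup>2 + x" and c: "c = x ^ (p + 1) + a * x\<^sup>2"
  shows "c + c ^ p + c ^ p\<^sup>2 + c ^ p ^ 3 = w ^ (p + 1) + a * (w\<^sup>2 + (w ^ p)\<^sup>2)"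
proof -
  define x1 x2 x3 where "x1 = x ^ p" and "x2 = x ^ p\<^sup>2" and "x3 = x ^ p ^ 3"
  have pow: "x1 ^ p = x2" "x2 ^ p = x3" "x3 ^ p = x"
    using power_p4[of x] unfolding x1_def x2_def x3_def power_mult[symmetric]
    by (simp_all add: power2_eq_square power3_eq_cube power4_eq_xxxx)
  have frob: "(u * v + a * u\<^sup>2) ^ p = u ^ p * v ^ p + a * (u ^ p)\<^sup>2" for u v
    by (simp add: add_power_p1 power_mult_distrib a power_mult[symmetric] mult.commute[of 2])
  have cs: "c ^ p\<^sup>2 = (c ^ p) ^ p" "c ^ p ^ 3 = ((c ^ p) ^ p) ^ p"
    by (simp_all add: power_mult[symmetric] power2_eq_square power3_eq_cube mult.assoc)
  have c0: "c = x * x1 + a * x\<^sup>2" by (simp add: c x1_def)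
  have c1: "c ^ p = x1 * x2 + a * x1\<^sup>2" unfolding c0 frob pow by (simp add: x1_def)
  have c2: "(c ^ p) ^ p = x2 * x3 + a * x2\<^sup>2"
    unfolding c1 frob pow ..
  have c3: "((c ^ p) ^ p) ^ p = x3 * x + a * x3\<^sup>2"
    unfolding c2 frob pow ..
  have wp: "w ^ p = x3 + x1" unfolding w x2_def[symmetric] by (simp add: add_power_p1 pow x1_def)
  have "w ^ (p + 1) + a * (w\<^sup>2 + (w ^ p)\<^sup>2) =
      (x3 + x1) * (x2 + x) + a * ((x2 + x)\<^sup>2 + (x3 + x1)\<^sup>2)"
    by (simp only: power_add power_one_right wp) (simp add: w x2_def)
  also have "\<dots> = (x * x1 + a * x\<^sup>2) + (x1 * x2 + a * x1\<^sup>2) + (x2 * x3 + a * x2\<^sup>2)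
      + (x3 * x + a * x3\<^sup>2)"
    by (simp add: power2_sum two_k algebra_simps)
  finally show ?thesis
    unfolding cs unfolding c3 unfolding c2 unfolding c1 unfolding c0 by (simp only: ac_simps)
qed

text \<open>On the subfield with p^2 elements, a plane over the one with \<open>p\<close> elements,
  the expression is a quadratic form: the norm of \<open>w\<close> plus \<open>a\<close> times the
  square of its trace. It is hyperbolic, so its zeros form two lines meeting in 0.\<close>

lemma card_isotropic:
  fixes a :: 'k
  assumes a: "a ^ p = a" and tr: "(\<Sum>i<n. a ^ 2 ^ i) = 1"
  shows "card {w::'k. w ^ p\<^sup>2 + w = 0 \<and> w ^ (p + 1) + a * (w\<^sup>2 + (w ^ p)\<^sup>2) = 0} = 2 * p - 1"
proof -
  define T where "T m = (\<Sum>i<m. a ^ 2 ^ i)" for m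
  have T_add: "T (n + m) = T n + T m" for m
  proof (induction m)
    case (Suc m)
    have "a ^ 2 ^ (n + m) = a ^ 2 ^ m" by (simp add: power_add power_mult a flip: p)
    with Suc show ?case
      by (simp add: T_def)
  qed (simp add: T_def)
  \<comment> \<open>As \<open>a\<close> lies in the field with \<open>p\<close> elements, its
    absolute trace is four times \<open>T n\<close>, that is 0; this places \<open>a^2\<close> in
    the image of c^2 + c.\<close>
  have "T (4 * n) = 4 * T n"
  proof -
    have "4 * n = n + (n + (n + n))" by simp
    then show ?thesis by (simp only: T_add) simp
  qed
  also have "(4::'k) = 2 * 2" by simp
  finally have T4: "T (4 * n) = 0" by (simp add: two_k)
  have T_sq: "(\<Sum>i<m. (a\<^sup>2) ^ 2 ^ i) = (T m)\<^sup>2" for m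
    using char2_sum_power[OF two_k, of "\<lambda>i. a ^ 2 ^ i" "{..<m}" 1]
    by (simp add: T_def power_mult[symmetric] mult.commute)
  have "a\<^sup>2 \<in> range (\<lambda>c::'k. c\<^sup>2 + c)"
    unfolding range_square_plus by (simp add: T_sq T4)
  then obtain v where v: "v\<^sup>2 + v = a\<^sup>2" by auto
  have a0: "a \<noteq> 0" using tr by (auto simp: zero_power)
  have "v ^ 2 ^ m = v + (T m)\<^sup>2" for m
  proof (induction m)
    case 0
    then show ?case by (simp add: T_def)
  next
    case (Suc m)
    have "v ^ 2 ^ Suc m = (v ^ 2) ^ 2 ^ m" by (simp add: power_mult)
    also have "v\<^sup>2 = v + a\<^sup>2"
      using v char2_add_self[OF two_k, of v] by (metis add.assoc add.commute add.right_neutral)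
    also have "(v + a\<^sup>2) ^ 2 ^ m = v ^ 2 ^ m + (a\<^sup>2) ^ 2 ^ m"
      by (rule char2_add_power[OF two_k])
    finally show ?case using T_sq[of m] T_sq[of "Suc m"] Suc by (simp add: add.assoc)
  qed
  \<comment> \<open>Trace 1 enters here: Frobenius moves \<open>v\<close> to the other root v + 1,
    so \<open>v\<close>, and with it v / a, lies outside the field with \<open>p\<close>
    elements.\<close>
  then have vp: "v ^ p = v + 1" using tr by (simp add: p T_def)
  \<comment> \<open>The substitution v = a u turns v^2 + v = a^2 into a u^2 + u + a = 0.\<close>
  define u where "u = v / a"
  have u_eq: "a * u\<^sup>2 + u + a = 0"
  proof -
    have "a * u\<^sup>2 + u + a = (v\<^sup>2 + v + a\<^sup>2) / a"
      using a0 by (simp add: u_def power2_eq_square field_simps)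
    then show ?thesis using v char2_add_self[OF two_k, of "a\<^sup>2"] by simp
  qed
  have u0: "u \<noteq> 0" using u_eq a0 by auto
  have up: "u ^ p = inverse u"
  proof -
    have "u ^ p * u = (v\<^sup>2 + v) / a\<^sup>2"
      by (simp add: u_def power_divide vp a power2_eq_square field_simps)
    then have "u ^ p * u = 1" using v a0 by simp
    then show ?thesis using u0 by (simp add: field_simps)
  qed
  have u1: "u \<noteq> 1"
  proof
    assume "u = 1"
    then have "v = a" using a0 by (simp add: u_def)
    then show False using vp a by simp
  qed
  have inv_ne: "inverse u \<noteq> u"
  proof
    assume "inverse u = u"
    then have "u\<^sup>2 = 1" using u0 by (metis left_inverse power2_eq_square)
    then have "(u + 1)\<^sup>2 = 0" by (simp add: power2_sum two_k)
    then show False using u1 by (simp add: char2_add_eq_0_iff[OF two_k])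
  qed
  let ?Z = "{w::'k. w ^ p\<^sup>2 + w = 0 \<and> w ^ (p + 1) + a * (w\<^sup>2 + (w ^ p)\<^sup>2) = 0}"
  define L where "L u = {w::'k. w ^ p = u * w}" for u
  have card_L: "card (L t) = p" if t1: "t ^ p = inverse t" "t \<noteq> 0" "t \<noteq> 1" for t :: 'k
  proof -
    \<comment> \<open>Hilbert 90 for \<open>t\<close> of norm 1: w^p = 1 + t = t w, and
      \<open>L t\<close> is \<open>w\<close> times the field with \<open>p\<close> elements.\<close>
    define w where "w = 1 + inverse t"
    have t: "w ^ p = t * w" "w \<noteq> 0"
      using t1 by (auto simp: w_def add_power_p1 power_inverse char2_add_eq_0_iff[OF two_k] algebra_simps)
    have "bij_betw ((*) w) {c. c ^ p + c = 0} (L t)"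
    proof (rule bij_betwI[where g = "\<lambda>z. z / w"])
      show "(*) w \<in> {c. c ^ p + c = 0} \<rightarrow> L t"
        using t by (auto simp: L_def power_mult_distrib char2_add_eq_0_iff[OF two_k])
      show "(\<lambda>z. z / w) \<in> L t \<rightarrow> {c. c ^ p + c = 0}"
      proof
        fix z assume "z \<in> L t"
        then have "(z / w) ^ p = z / w" using t t1 by (simp add: L_def power_divide)
        then show "z / w \<in> {c. c ^ p + c = 0}" by (simp add: char2_add_eq_0_iff[OF two_k])
      qed
    qed (use t in auto)
    then show ?thesis using range_artin_schreier(1) by (simp add: bij_betw_same_card[symmetric])
  qed
  have "?Z = L u \<union> L (inverse u)"
  proof (intro equalityI subsetI)
    fix w assume "w \<in> ?Z"
    then have w: "w ^ p * w + a * (w\<^sup>2 + (w ^ p)\<^sup>2) = 0" by (simp add: mult.commute)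
    \<comment> \<open>Since u + 1/u = 1/a, this product is the form divided by
      \<open>a\<close>.\<close>
    have "(w ^ p + u * w) * (w ^ p + inverse u * w) = (w ^ p)\<^sup>2 + (u + inverse u) * (w ^ p * w) + w\<^sup>2"
      using u0 by (simp add: power2_eq_square algebra_simps)
    also have "u + inverse u = inverse a"
    proof -
      have "(a * u\<^sup>2 + a) + u = 0" using u_eq by (simp only: ac_simps)
      then have "a * u\<^sup>2 + a = u" by (simp only: char2_add_eq_0_iff[OF two_k])
      then have "(a * (u + inverse u)) * u = 1 * u"
        using u0 by (simp add: power2_eq_square algebra_simps)
      then have "a * (u + inverse u) = 1" by (rule iffD1[OF mult_right_cancel[OF u0]])
      then show ?thesis using a0 by (simp only: inverse_unique)
    qed
    also have "(w ^ p)\<^sup>2 + inverse a * (w ^ p * w) + w\<^sup>2 = inverse a * (w ^ p * w + a * (w\<^sup>2 + (w ^ p)\<^sup>2))"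
      using a0 by (simp add: field_simps)
    finally have "(w ^ p + u * w) * (w ^ p + inverse u * w) = 0" using w by simp
    then show "w \<in> L u \<union> L (inverse u)" by (simp add: L_def char2_add_eq_0_iff[OF two_k])
  next
    fix w assume "w \<in> L u \<union> L (inverse u)"
    then obtain t where t: "w ^ p = t * w" "t ^ p = inverse t" "a * t\<^sup>2 + t + a = 0" "t \<noteq> 0"
    proof
      assume "w \<in> L (inverse u)"
      moreover have "a * (inverse u)\<^sup>2 + inverse u + a = (a * u\<^sup>2 + u + a) / u\<^sup>2"
        using u0 by (simp add: field_simps power2_eq_square)
      ultimately show thesis
        using u_eq u0 up by (intro that[of "inverse u"]) (simp_all add: L_def power_inverse)
    qed (use u_eq u0 up in \<open>auto simp: L_def intro: that\<close>)
    have "w ^ p\<^sup>2 = (w ^ p) ^ p" by (simp add: power_mult[symmetric] power2_eq_square)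
    also have "\<dots> = w" using t by (simp add: power_mult_distrib)
    finally have 1: "w ^ p\<^sup>2 + w = 0" by (simp add: char2_add_self[OF two_k])
    have "w ^ (p + 1) + a * (w\<^sup>2 + (w ^ p)\<^sup>2) = w\<^sup>2 * (a * t\<^sup>2 + t + a)"
      by (simp add: t(1) power2_eq_square algebra_simps)
    with 1 show "w \<in> ?Z"
      by (simp only: t(3)) simp
  qed
  moreover have "L u \<inter> L (inverse u) = {0}"
    using inv_ne p_ge_2 by (auto simp: L_def zero_power)
  moreover have "card (L u) = p" "card (L (inverse u)) = p"
    using card_L[of u] card_L[of "inverse u"] up u0 u1 by (simp_all add: power_inverse)
  ultimately show ?thesis using card_Un_Int[of "L u" "L (inverse u)"] by simp
qed

lemma card_affine_points:
  fixes a :: 'k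
  assumes a: "a ^ p = a" and tr: "(\<Sum>i<n. a ^ 2 ^ i) = 1"
  shows "card (affine_points p a) = p ^ 3 * (2 * p - 1)"
proof -
  let ?g = "\<lambda>x::'k. x ^ (p + 1) + a * x\<^sup>2"
  let ?\<phi> = "\<lambda>y::'k. y ^ p + y" and ?\<psi> = "\<lambda>x::'k. x ^ p\<^sup>2 + x"
  let ?Z = "{w::'k. w ^ p\<^sup>2 + w = 0 \<and> w ^ (p + 1) + a * (w\<^sup>2 + (w ^ p)\<^sup>2) = 0}"
  let ?X = "{x. ?g x \<in> range ?\<phi>}"
  have "?X = {x. ?\<psi> x \<in> ?Z}"
    using range_half_trace(2) unfolding range_artin_schreier(2)
    by (auto simp only: trace_form[OF a refl refl])
  moreover have "card {x. ?\<psi> x \<in> ?Z} = p\<^sup>2 * (2 * p - 1)"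
  proof -
    have "?Z \<subseteq> range ?\<psi>" unfolding range_half_trace(2) by blast
    moreover have "?\<psi> (b + c) = ?\<psi> b + ?\<psi> c" for b c by (simp add: add_power_p)
    ultimately have "card {x. ?\<psi> x \<in> ?Z} = card {x. ?\<psi> x = 0} * card ?Z"
      by (intro card_vimage_additive)
    then show ?thesis
      unfolding range_half_trace(1) card_isotropic[OF a tr] .
  qed
  ultimately have X: "card ?X = p\<^sup>2 * (2 * p - 1)" by simp
  have fib: "card {y. ?\<phi> y = ?g x} = p" if "x \<in> ?X" for x
  proof -
    have "?\<phi> (b + c) = ?\<phi> b + ?\<phi> c" for b c by (simp add: add_power_p1)
    then have "card {y. ?\<phi> y \<in> {?g x}} = card {y. ?\<phi> y = 0} * card {?g x}"
      using that by (intro card_vimage_additive) auto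
    then show ?thesis unfolding range_artin_schreier(1) by simp
  qed
  have "affine_points p a = (SIGMA x:?X. {y. ?\<phi> y = ?g x})"
  proof (rule Set.set_eqI)
    fix z :: "'k \<times> 'k"
    obtain x y where z: "z = (x, y)"
      by (cases z)
    have "?g x \<in> range ?\<phi>" if "?\<phi> y = ?g x"
      by (rule range_eqI[where f = ?\<phi>, OF that[symmetric]])
    then show "z \<in> affine_points p a \<longleftrightarrow> z \<in> (SIGMA x:?X. {y. ?\<phi> y = ?g x})"
      unfolding z affine_points_def mem_Sigma_iff mem_Collect_eq case_prod_conv by blast
  qed
  then have "card (affine_points p a) = (\<Sum>x\<in>?X. card {y. ?\<phi> y = ?g x})" by simp
  also have "\<dots> = p * (p\<^sup>2 * (2 * p - 1))" using fib X by simp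
  finally show ?thesis by (simp add: power3_eq_cube power2_eq_square)
qed

end

subsection \<open>Geometric irreducibility\<close>

lemma coeff_C_poly:
  assumes "p \<ge> 2"
  shows "coeff (C_poly p (S_poly p a)) j =
    (if j = 0 then - (monom 1 (p + 1) + monom a 2) else if j = 1 \<or> j = p then 1 else 0)"
proof -
  have "[:0, 1:] * S_poly p a = monom 1 (p + 1) + monom a 2"
    by (simp add: S_poly_def monom_Suc numeral_2_eq_2)
  then show ?thesis using assms by (cases j) (auto simp: C_poly_def coeff_pCons)
qed

lemma degree_C_poly: "p \<ge> 2 \<Longrightarrow> degree (C_poly p (S_poly p a)) = p"
  by (intro antisym degree_le le_degree) (auto simp: coeff_C_poly)

lemma degree_const_C_poly:
  assumes "p \<ge> 2"
  shows "degree (monom 1 (p + 1) + monom (a::'a::field) 2) = p + 1"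
  using assms
  by (subst degree_add_eq_left) (auto simp: degree_monom_eq intro!: le_less_trans[OF degree_monom_le])

lemma map_poly_C_poly:
  fixes h :: "'a::field \<Rightarrow> 'b::field"
  assumes "\<And>a b. h (a + b) = h a + h b" and "h 1 = 1" and "p \<ge> 2"
  shows "map_poly (map_poly h) (C_poly p (S_poly p a)) = C_poly p (S_poly p (h a))"
proof -
  have h0: "h 0 = 0" using assms(1)[of 0 0] by (metis add.right_neutral add_left_cancel)
  have neg: "h (- c) = - h c" for c using assms(1)[of c "- c"] h0 by (simp add: minus_unique)
  show ?thesis by (intro poly_eqI)
      (use assms(2,3) in \<open>auto simp: coeff_map_poly coeff_C_poly h0 neg assms(1)\<close>)
qed

text \<open>The pole order of the leading part of the term with Y^j, for weight \<open>p\<close> of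
  X and p + 1 of Y. A zero coefficient gets the default (p + 1) j, so dominance is stated for
  nonzero coefficients.\<close>

definition coeff_weight :: "nat \<Rightarrow> 'a::zero poly poly \<Rightarrow> nat \<Rightarrow> nat" where
  "coeff_weight p G j = p * degree (coeff G j) + (p + 1) * j"

text \<open>Modulo \<open>p\<close> the weight of the \<open>j\<close>-th term is \<open>j\<close>;
  below Y-degree \<open>p\<close> the weights are therefore distinct and the maximum is
  unique.\<close>

lemma dominant_coeff:
  assumes "degree G < p" and "G \<noteq> 0"
  obtains j where "coeff G j \<noteq> 0"
    and "\<And>i. coeff G i \<noteq> 0 \<Longrightarrow> i \<noteq> j \<Longrightarrow> coeff_weight p G i < coeff_weight p G j"
proof -
  let ?J = "{j. coeff G j \<noteq> 0}"
  have le: "j \<le> degree G" if "j \<in> ?J" for j using that by (simp add: le_degree)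
  then have fin: "finite ?J" by (meson finite_atMost finite_subset atMost_iff subsetI)
  moreover have "degree G \<in> ?J" using assms by simp
  then have "?J \<noteq> {}" by blast
  ultimately have "Max (coeff_weight p G ` ?J) \<in> coeff_weight p G ` ?J" by (intro Max_in) auto
  then obtain j where j: "Max (coeff_weight p G ` ?J) = coeff_weight p G j" "j \<in> ?J"
    by (rule imageE)
  have inj: "coeff_weight p G i mod p = i" if "i \<in> ?J" for i
  proof -
    have "coeff_weight p G i = p * (degree (coeff G i) + i) + i"
      by (simp add: coeff_weight_def algebra_simps)
    then show ?thesis using le[OF that] assms(1) by simp
  qed
  show thesis
  proof (rule that)
    show "coeff G j \<noteq> 0" using j(2) by simp
  next
    fix i assume i: "coeff G i \<noteq> 0" "i \<noteq> j"
    then have "coeff_weight p G i \<le> coeff_weight p G j"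
      unfolding j(1)[symmetric] using fin by (intro Max_ge) auto
    moreover have "coeff_weight p G i \<noteq> coeff_weight p G j"
      using inj[of i] inj[of j] i j(2) by auto
    ultimately show "coeff_weight p G i < coeff_weight p G j" by simp
  qed
qed

text \<open>Any other pair of terms contributing to Y^(j+l) has smaller total weight, hence smaller
  X-degree because the Y-part is the same. So the product of the two leading coefficients
  survives.\<close>

lemma coeff_weight_mult:
  fixes G H :: "'a::idom poly poly"
  assumes "p > 0"
    and G: "coeff G j \<noteq> 0" "\<And>i. coeff G i \<noteq> 0 \<Longrightarrow> i \<noteq> j \<Longrightarrow> coeff_weight p G i < coeff_weight p G j"
    and H: "coeff H l \<noteq> 0" "\<And>i. coeff H i \<noteq> 0 \<Longrightarrow> i \<noteq> l \<Longrightarrow> coeff_weight p H i < coeff_weight p H l"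
  shows "coeff (G * H) (j + l) \<noteq> 0"
    and "coeff_weight p (G * H) (j + l) \<ge> coeff_weight p G j + coeff_weight p H l"
proof -
  let ?d = "degree (coeff G j) + degree (coeff H l)"
  have small: "coeff (coeff G i * coeff H (j + l - i)) ?d = 0" if "i \<le> j + l" "i \<noteq> j" for i
  proof (cases "coeff G i = 0 \<or> coeff H (j + l - i) = 0")
    case False
    then have "coeff_weight p G i < coeff_weight p G j"
      and "coeff_weight p H (j + l - i) < coeff_weight p H l"
      using G(2)[of i] H(2)[of "j + l - i"] that by auto
    then have "p * (degree (coeff G i) + degree (coeff H (j + l - i))) + (p + 1) * (j + l) < p * ?d + (p + 1) * (j + l)"
    proof -
      have "(p + 1) * (j + l) = (p + 1) * i + (p + 1) * (j + l - i)"
        using that(1) by (simp flip: distrib_left)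
      then show ?thesis
        using \<open>coeff_weight p G i < _\<close> \<open>coeff_weight p H (j + l - i) < _\<close>
        by (simp add: coeff_weight_def distrib_left)
    qed
    then have "degree (coeff G i) + degree (coeff H (j + l - i)) < ?d" by simp
    then show ?thesis using False by (intro coeff_eq_0) (simp add: degree_mult_eq)
  qed auto
  have "coeff (coeff (G * H) (j + l)) ?d = (\<Sum>i\<le>j + l. coeff (coeff G i * coeff H (j + l - i)) ?d)"
    by (simp add: coeff_mult coeff_sum)
  also have "\<dots> = (\<Sum>i\<le>j + l. if i = j then lead_coeff (coeff G j) * lead_coeff (coeff H l) else 0)"
    by (intro sum.cong) (use small in \<open>auto simp: coeff_mult_degree_sum\<close>)
  also have "\<dots> \<noteq> 0" using G(1) H(1) by simp
  finally have nz: "coeff (coeff (G * H) (j + l)) ?d \<noteq> 0" .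
  then show "coeff (G * H) (j + l) \<noteq> 0" by auto
  have "?d \<le> degree (coeff (G * H) (j + l))" using nz by (rule le_degree)
  then have "p * ?d \<le> p * degree (coeff (G * H) (j + l))" by simp
  then show "coeff_weight p (G * H) (j + l) \<ge> coeff_weight p G j + coeff_weight p H l"
    by (simp add: coeff_weight_def algebra_simps)
qed

text \<open>In a proper factorization \<open>f = G H\<close> the weight of every term of \<open>f\<close> is at most \<open>p (p + 1)\<close>, so the
  dominant terms of \<open>G\<close> and \<open>H\<close> are their leading terms in \<open>Y\<close>, and the constant term
  \<open>X\<^bsup>p+1\<^esup> + \<dots>\<close> of \<open>f\<close> would have too small a degree.\<close>

lemma irreducible_C_poly:
  fixes a :: "'a::field"
  assumes p: "p \<ge> 2"
  shows "Factorial_Ring.irreducible (C_poly p (S_poly p a))"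
proof (rule Factorial_Ring.irreducibleI)
  let ?f = "C_poly p (S_poly p a)"
  show nz: "?f \<noteq> 0" using degree_C_poly[OF p, of a] p by auto
  \<comment> \<open>As the curve equation is monic in Y, a factor of Y-degree 0 is a unit.\<close>
  have unit: "G dvd 1" if "?f = G * H" "degree G = 0" for G H
  proof -
    have "lead_coeff G * lead_coeff H = 1"
      using p that(1) degree_C_poly[OF p, of a] coeff_C_poly[OF p, of a p]
      by (metis lead_coeff_mult not_numeral_le_zero)
    moreover have "G = [:lead_coeff G:]"
      using that(2) by (metis degree_eq_zeroE lead_coeff_pCons(2) )
    ultimately show ?thesis by (metis is_unit_const_poly_iff dvd_triv_left)
  qed
  show "\<not> ?f dvd 1"
  proof
    assume "?f dvd 1"
    then have "degree ?f = 0" by (auto simp: is_unit_poly_iff)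
    then show False using degree_C_poly[OF p, of a] p by simp
  qed
  show "G dvd 1 \<or> H dvd 1" if f: "?f = G * H" for G H
  proof (rule ccontr)
    assume "\<not> (G dvd 1 \<or> H dvd 1)"
    then have deg: "degree G \<noteq> 0" "degree H \<noteq> 0"
      using unit[of G H] unit[of H G] f by (auto simp: mult.commute)
    have GH: "G \<noteq> 0" "H \<noteq> 0" using nz f by auto
    have sum: "degree G + degree H = p"
      using degree_mult_eq[OF GH] degree_C_poly[OF p, of a] f by simp
    obtain j where j: "coeff G j \<noteq> 0"
      "\<And>i. coeff G i \<noteq> 0 \<Longrightarrow> i \<noteq> j \<Longrightarrow> coeff_weight p G i < coeff_weight p G j"
      using dominant_coeff[of G p] GH deg sum by auto
    obtain l where l: "coeff H l \<noteq> 0"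
      "\<And>i. coeff H i \<noteq> 0 \<Longrightarrow> i \<noteq> l \<Longrightarrow> coeff_weight p H i < coeff_weight p H l"
      using dominant_coeff[of H p] GH deg sum by auto
    have "p > 0" using p by simp
    note mult = coeff_weight_mult[OF this j l, folded f]
    have le_f: "coeff_weight p ?f i \<le> (p + 1) * p" if "coeff ?f i \<noteq> 0" for i
    proof (cases "i = 0")
      case True
      then show ?thesis
        by (simp only: coeff_weight_def coeff_C_poly[OF p] refl if_True degree_minus degree_const_C_poly[OF p]) simp
    next
      case False
      then show ?thesis
        using that p by (auto simp: coeff_weight_def coeff_C_poly[OF p] split: if_splits)
    qed
    have up: "coeff_weight p G j + coeff_weight p H l \<le> (p + 1) * degree G + (p + 1) * degree H"
      using le_f[OF mult(1)] mult(2) unfolding distrib_left[symmetric] sum by simp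
    have lo: "(p + 1) * degree G \<le> coeff_weight p G (degree G)"
      "(p + 1) * degree H \<le> coeff_weight p H (degree H)"
      by (simp_all add: coeff_weight_def)
    have dom: "coeff_weight p G (degree G) \<le> coeff_weight p G j"
      "coeff_weight p H (degree H) \<le> coeff_weight p H l"
      using j(2)[of "degree G"] l(2)[of "degree H"] GH by fastforce+
    have "j = degree G" using j(2)[of "degree G"] GH up lo dom by fastforce
    have "l = degree H" using l(2)[of "degree H"] GH up lo dom by fastforce
    have c0: "coeff G 0 * coeff H 0 = - (monom 1 (p + 1) + monom a 2)"
      using arg_cong[OF f, of "\<lambda>f. coeff f 0"] by (simp add: coeff_C_poly[OF p] coeff_mult_0)
    then have "degree (coeff G 0 * coeff H 0) = p + 1"
      using degree_const_C_poly[OF p, of a] by (simp only: degree_minus)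
    moreover from this have nz0: "coeff G 0 \<noteq> 0" "coeff H 0 \<noteq> 0" by auto
    ultimately have "p * degree (coeff G 0) + p * degree (coeff H 0) = p * (p + 1)"
      by (simp add: degree_mult_eq flip: distrib_left)
    also have "p * (p + 1) = (p + 1) * degree G + (p + 1) * degree H"
      unfolding distrib_left[symmetric] sum by (rule mult.commute)
    finally have "p * degree (coeff G 0) + p * degree (coeff H 0) = \<dots>" .
    moreover have "coeff_weight p G 0 < coeff_weight p G j" "coeff_weight p H 0 < coeff_weight p H l"
      using j(2)[OF nz0(1)] l(2)[OF nz0(2)] deg \<open>j = _\<close> \<open>l = _\<close> by auto
    ultimately show False using up by (simp add: coeff_weight_def)
  qed
qed

text \<open>The irreducibility argument works over every field, and base change only replaces
  \<open>a\<close> by its image.\<close>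

lemma geometrically_irreducible_C_poly:
  assumes "p \<ge> 2"
  shows "geometrically_irreducible (C_poly p (S_poly p a))"
  unfolding geometrically_irreducible_def
  by (subst map_poly_C_poly) (use assms irreducible_C_poly in auto)

subsection \<open>Counting in vector spaces over a finite field\<close>

locale field_over =
  fixes \<iota> :: "'k::{field,finite} \<Rightarrow> 'l::field" and F :: "'l set"
  assumes emb: "field_embedding \<iota>"
    and F_const: "range \<iota> \<subseteq> F"
    and F_diff: "a \<in> F \<Longrightarrow> b \<in> F \<Longrightarrow> a - b \<in> F"
    and F_mult: "a \<in> F \<Longrightarrow> b \<in> F \<Longrightarrow> a * b \<in> F"
    and F_inverse: "a \<in> F \<Longrightarrow> inverse a \<in> F"
begin

lemma \<iota>_add: "\<iota> (a + b) = \<iota> a + \<iota> b"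
  and \<iota>_mult: "\<iota> (a * b) = \<iota> a * \<iota> b"
  and \<iota>_1: "\<iota> 1 = 1"
  using emb by (auto simp: field_embedding_def)

lemma \<iota>_0: "\<iota> 0 = 0"
  using \<iota>_add[of 0 0] by (metis add.right_neutral add_left_cancel)

lemma \<iota>_minus: "\<iota> (- a) = - \<iota> a"
  using \<iota>_add[of a "- a"] \<iota>_0 by (simp add: minus_unique)

lemma \<iota>_diff: "\<iota> (a - b) = \<iota> a - \<iota> b"
  using \<iota>_add[of a "- b"] by (simp add: \<iota>_minus)

lemma \<iota>_inverse: "\<iota> (inverse a) = inverse (\<iota> a)"
proof (cases "a = 0")
  case False
  then have "\<iota> a * \<iota> (inverse a) = 1" by (simp flip: \<iota>_mult add: \<iota>_1)
  then show ?thesis by (metis inverse_unique)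
qed (simp add: \<iota>_0)

lemma \<iota>_eq_0_iff: "\<iota> a = 0 \<longleftrightarrow> a = 0"
  by (metis \<iota>_0 \<iota>_1 \<iota>_inverse \<iota>_mult mult_zero_left right_inverse zero_neq_one)

lemma \<iota>_eq_iff: "\<iota> a = \<iota> b \<longleftrightarrow> a = b"
  by (metis \<iota>_diff \<iota>_eq_0_iff eq_iff_diff_eq_0)

lemma \<iota>_power: "\<iota> (a ^ m) = \<iota> a ^ m"
  by (induction m) (simp_all add: \<iota>_1 \<iota>_mult)

lemma F_\<iota>: "\<iota> c \<in> F"
  using F_const by auto

lemma F_add: "a \<in> F \<Longrightarrow> b \<in> F \<Longrightarrow> a + b \<in> F"
  using F_diff[of a "0 - b"] F_diff[of 0 b] F_const \<iota>_0 by (metis diff_0 diff_minus_eq_add rangeI subsetD)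

sublocale V: vector_space "\<lambda>c z. \<iota> c * z"
  by unfold_locales (simp_all add: \<iota>_add \<iota>_mult \<iota>_1 algebra_simps)

section \<open>Bases and representatives modulo a subspace\<close>

definition transversal :: "'l set \<Rightarrow> 'l set \<Rightarrow> 'l set \<Rightarrow> bool" where
  "transversal W V T \<longleftrightarrow> finite T \<and> T \<subseteq> V \<and> (\<forall>z\<in>V. \<exists>!t. t \<in> T \<and> z - t \<in> W)"

text \<open>The condition of \<open>place_degree\<close>, freed from the valuation ring so that W =
  {0} gives ordinary bases.\<close>

definition basis_mod :: "'l set \<Rightarrow> 'l set \<Rightarrow> 'l set \<Rightarrow> bool" where
  "basis_mod W V B \<longleftrightarrow> finite B \<and> B \<subseteq> V \<and>
     (\<forall>z\<in>V. \<exists>!c. c \<in> B \<rightarrow>\<^sub>E (UNIV :: 'k set) \<and> z - (\<Sum>b\<in>B. \<iota> (c b) * b) \<in> W)"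

text \<open>A transversal spans modulo \<open>W\<close>, and a spanning set of least cardinality is
  independent modulo \<open>W\<close>.\<close>

lemma ex_basis_mod:
  assumes W: "V.subspace W" and V: "V.subspace V" and T: "transversal W V T"
  shows "\<exists>B. basis_mod W V B"
proof -
  define spans where "spans B \<longleftrightarrow> finite B \<and> B \<subseteq> V \<and> (\<forall>z\<in>V. \<exists>c. z - (\<Sum>b\<in>B. \<iota> (c b) * b) \<in> W)" for B
  have "spans T"
    unfolding spans_def
  proof (intro conjI ballI)
    fix z assume "z \<in> V"
    then obtain t where t: "t \<in> T" "z - t \<in> W" using T by (auto simp: transversal_def)
    have "(\<Sum>b\<in>T. \<iota> (if b = t then 1 else 0) * b) = (\<Sum>b\<in>T. if b = t then b else 0)"
      by (intro sum.cong) (auto simp: \<iota>_1 \<iota>_0)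
    also have "\<dots> = t" using T t(1) by (simp add: transversal_def)
    finally show "\<exists>c. z - (\<Sum>b\<in>T. \<iota> (c b) * b) \<in> W"
      using t(2) by (intro exI[of _ "\<lambda>b. if b = t then 1 else 0"]) simp
  qed (use T in \<open>auto simp: transversal_def\<close>)
  then obtain B where B: "spans B" and min: "\<And>B'. spans B' \<Longrightarrow> card B \<le> card B'"
    using ex_has_least_nat[of spans T card] by blast
  have fin: "finite B" "B \<subseteq> V" using B by (auto simp: spans_def)
  have unique: "d b = 0" if d: "(\<Sum>b\<in>B. \<iota> (d b) * b) \<in> W" and b: "b \<in> B" for d b
  proof (rule ccontr)
    assume nz: "d b \<noteq> 0"
    have "spans (B - {b})"
      unfolding spans_def
    proof (intro conjI ballI)
      fix z assume "z \<in> V"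
      then obtain c where c: "z - (\<Sum>b\<in>B. \<iota> (c b) * b) \<in> W"
        using B by (auto simp: spans_def)
      \<comment> \<open>Chosen so that the coefficient of \<open>b\<close> cancels.\<close>
      define e where "e = c b / d b"
      have "z - (\<Sum>b\<in>B. \<iota> (c b) * b) + \<iota> e * (\<Sum>b\<in>B. \<iota> (d b) * b) \<in> W"
        by (intro V.subspace_add V.subspace_scale W c d)
      also have "z - (\<Sum>b\<in>B. \<iota> (c b) * b) + \<iota> e * (\<Sum>b\<in>B. \<iota> (d b) * b)
          = z - (\<Sum>b\<in>B. \<iota> (c b - e * d b) * b)"
        by (simp add: sum_distrib_left \<iota>_diff \<iota>_mult algebra_simps sum_subtractf)
      also have "(\<Sum>b\<in>B. \<iota> (c b - e * d b) * b) = (\<Sum>b\<in>B - {b}. \<iota> (c b - e * d b) * b)"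
        using fin b nz by (simp add: sum.remove[of B b] e_def \<iota>_0)
      finally show "\<exists>c. z - (\<Sum>b\<in>B - {b}. \<iota> (c b) * b) \<in> W"
        by (intro exI[of _ "\<lambda>b. c b - e * d b"]) simp
    qed (use fin in auto)
    then have "card B \<le> card (B - {b})" by (rule min)
    then show False using fin b by (metis card_Diff1_less leD)
  qed
  have "basis_mod W V B"
    unfolding basis_mod_def
  proof (intro conjI ballI ex_ex1I)
    fix z assume "z \<in> V"
    then obtain c where "z - (\<Sum>b\<in>B. \<iota> (c b) * b) \<in> W"
      using B by (auto simp: spans_def)
    then show "\<exists>c. c \<in> B \<rightarrow>\<^sub>E UNIV \<and> z - (\<Sum>b\<in>B. \<iota> (c b) * b) \<in> W"
      by (intro exI[of _ "restrict c B"]) (simp cong: sum.cong)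
  next
    fix z c c'
    assume *: "c \<in> B \<rightarrow>\<^sub>E UNIV \<and> z - (\<Sum>b\<in>B. \<iota> (c b) * b) \<in> W"
      "c' \<in> B \<rightarrow>\<^sub>E UNIV \<and> z - (\<Sum>b\<in>B. \<iota> (c' b) * b) \<in> W"
    then have "(z - (\<Sum>b\<in>B. \<iota> (c b) * b)) - (z - (\<Sum>b\<in>B. \<iota> (c' b) * b)) \<in> W"
      using V.subspace_diff[OF W] by blast
    then have "(\<Sum>b\<in>B. \<iota> (c' b - c b) * b) \<in> W"
      by (simp add: \<iota>_diff algebra_simps sum_subtractf)
    from unique[OF this] have "c b = c' b" if "b \<in> B" for b
      using that by (metis eq_iff_diff_eq_0)
    then show "c = c'" using * by (intro PiE_ext[of c B "\<lambda>_. UNIV"]) auto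
  qed (use fin in auto)
  then show ?thesis ..
qed

text \<open>Coefficient vectors on the basis correspond bijectively to classes modulo
  \<open>W\<close>; the cardinality thus fixes the size of every basis.\<close>

lemma card_transversal:
  assumes W: "V.subspace W" and V: "V.subspace V" and T: "transversal W V T"
    and B: "basis_mod W V B"
  shows "card T = CARD('k) ^ card B"
proof -
  define S where "S c = (\<Sum>b\<in>B. \<iota> (c b) * b)" for c
  define rep where "rep z = (THE t. t \<in> T \<and> z - t \<in> W)" for z
  have fin: "finite B" "B \<subseteq> V" using B by (auto simp: basis_mod_def)
  have S_in: "S c \<in> V" for c
    unfolding S_def using fin by (intro V.subspace_sum V.subspace_scale V) auto
  have rep: "rep z \<in> T \<and> z - rep z \<in> W" if "z \<in> V" for z
    unfolding rep_def by (rule theI') (use T that in \<open>auto simp: transversal_def\<close>)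
  have rep_eq: "rep z = t" if "z \<in> V" "t \<in> T" "z - t \<in> W" for z t
    using rep[OF that(1)] T that unfolding transversal_def by blast
  have "bij_betw (\<lambda>c. rep (S c)) (B \<rightarrow>\<^sub>E UNIV) T"
  proof (rule bij_betwI')
    fix c c' :: "'l \<Rightarrow> 'k" assume c: "c \<in> B \<rightarrow>\<^sub>E UNIV" "c' \<in> B \<rightarrow>\<^sub>E UNIV"
    have "c = c'" if "rep (S c) = rep (S c')"
    proof -
      have "(S c - rep (S c)) - (S c' - rep (S c')) \<in> W"
        using rep[OF S_in] by (auto intro!: V.subspace_diff[OF W, of "_ - _" "_ - _"])
      then have "S c - S c' \<in> W" using that by simp
      moreover have "S c - S c \<in> W" using V.subspace_0[OF W] by simp
      ultimately show ?thesis using B S_in[of c] c unfolding basis_mod_def S_def by blast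
    qed
    then show "rep (S c) = rep (S c') \<longleftrightarrow> c = c'" by auto
  next
    fix c :: "'l \<Rightarrow> 'k"
    show "rep (S c) \<in> T" using rep[OF S_in] by simp
  next
    fix t assume t: "t \<in> T"
    then have "t \<in> V" using T by (auto simp: transversal_def)
    then obtain c where c: "c \<in> B \<rightarrow>\<^sub>E UNIV" "t - S c \<in> W"
      using B unfolding basis_mod_def S_def by blast
    then have "S c - t \<in> W" using V.subspace_neg[OF W c(2)] by simp
    then show "\<exists>c\<in>B \<rightarrow>\<^sub>E UNIV. t = rep (S c)"
      using c(1) rep_eq[OF S_in t] by blast
  qed
  then have "card T = card (B \<rightarrow>\<^sub>E (UNIV :: 'k set))"
    by (rule bij_betw_same_card[symmetric])
  then show ?thesis using fin by (simp add: card_PiE)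
qed

lemma card_k_gt_1: "CARD('k) > 1"
proof -
  have "card {0, 1::'k} \<le> CARD('k)" by (intro card_mono) auto
  then show ?thesis by simp
qed

text \<open>Cardinality becomes a substitute for dimension, so injections that are not linear can
  also compare dimensions.\<close>

lemma card_subspace:
  assumes L: "V.subspace L" and fin: "finite L"
  shows "card L = CARD('k) ^ V.dim L"
proof -
  have T: "transversal {0} L L" using fin by (auto simp: transversal_def)
  then obtain B where B: "basis_mod {0} L B" using ex_basis_mod[OF V.subspace_single_0 L] by blast
  then have B': "finite B" "B \<subseteq> L" by (auto simp: basis_mod_def)
  have "V.independent B"
  proof
    assume "V.dependent B"
    then obtain u b where u: "b \<in> B" "u b \<noteq> 0" "(\<Sum>b\<in>B. \<iota> (u b) * b) = 0"
      using V.dependent_finite[OF B'(1)] by auto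
    have "restrict u B \<in> B \<rightarrow>\<^sub>E UNIV \<and> 0 - (\<Sum>b\<in>B. \<iota> (restrict u B b) * b) \<in> {0}"
      using u(3) by (simp cong: sum.cong)
    moreover have "restrict (\<lambda>_. 0) B \<in> B \<rightarrow>\<^sub>E UNIV \<and> 0 - (\<Sum>b\<in>B. \<iota> (restrict (\<lambda>_. 0) B b) * b) \<in> {0}"
      by (simp cong: sum.cong add: \<iota>_0)
    ultimately have "restrict u B = restrict (\<lambda>_. 0) B"
      using B V.subspace_0[OF L] unfolding basis_mod_def by blast
    then show False using u by (metis restrict_apply')
  qed
  moreover have "L \<subseteq> V.span B"
  proof
    fix z assume "z \<in> L"
    then obtain c where "z - (\<Sum>b\<in>B. \<iota> (c b) * b) \<in> {0}"
      using B unfolding basis_mod_def by blast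
    then have "z = (\<Sum>b\<in>B. \<iota> (c b) * b)" by simp
    then show "z \<in> V.span B" by (simp add: V.span_sum V.span_scale V.span_base)
  qed
  ultimately have "card B = V.dim L" using B' by (intro V.basis_card_eq_dim)
  then show ?thesis using card_transversal[OF V.subspace_single_0 L T B] by simp
qed

text \<open>The number of residue classes determines the size of a basis, so the definite
  description in \<open>place_degree\<close> denotes.\<close>

lemma place_degree_transversal:
  assumes "V.subspace (max_ideal R)" and "V.subspace R" and "transversal (max_ideal R) R T"
  shows "card T = CARD('k) ^ place_degree \<iota> R"
proof -
  obtain B where B: "basis_mod (max_ideal R) R B"
    using ex_basis_mod[OF assms] by blast
  have deg: "place_degree \<iota> R = (THE d. \<exists>B. card B = d \<and> basis_mod (max_ideal R) R B)"
    unfolding place_degree_def basis_mod_def by (rule arg_cong[of _ _ The]) blast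
  have "place_degree \<iota> R = card B"
    unfolding deg
  proof (rule the_equality)
    fix d assume "\<exists>B. card B = d \<and> basis_mod (max_ideal R) R B"
    then have "CARD('k) ^ card B = CARD('k) ^ d" using card_transversal[OF assms] B by metis
    then show "d = card B" using card_k_gt_1 by (simp add: power_inject_exp)
  qed (use B in blast)
  then show ?thesis using card_transversal[OF assms B] by simp
qed

end

subsection \<open>Places\<close>

text \<open>Interpreted for valuation rings, but also for \<open>A\<close> and for auxiliary
  subrings: by \<open>R_eval2\<close>, a subring containing \<open>x\<close> and \<open>y\<close>
  contains all of \<open>A\<close>.\<close>

locale subring_over = field_over \<iota> F for \<iota> :: "'k::{field,finite} \<Rightarrow> 'l::field" and F +
  fixes R :: "'l set"
  assumes R_const: "range \<iota> \<subseteq> R" and R_sub: "R \<subseteq> F"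
    and R_diff: "a \<in> R \<Longrightarrow> b \<in> R \<Longrightarrow> a - b \<in> R"
    and R_mult: "a \<in> R \<Longrightarrow> b \<in> R \<Longrightarrow> a * b \<in> R"
begin

lemma R_\<iota>: "\<iota> c \<in> R"
  using R_const by auto

lemma R_0: "0 \<in> R" and R_1: "1 \<in> R"
  using R_\<iota>[of 0] R_\<iota>[of 1] by (simp_all add: \<iota>_0 \<iota>_1)

lemma R_minus: "a \<in> R \<Longrightarrow> - a \<in> R"
  using R_diff[OF R_0] by simp

lemma R_add: "a \<in> R \<Longrightarrow> b \<in> R \<Longrightarrow> a + b \<in> R"
  using R_diff[OF _ R_minus] by simp

lemma R_power: "a \<in> R \<Longrightarrow> a ^ m \<in> R"
  by (induction m) (auto intro: R_1 R_mult)

lemma R_sum: "(\<And>i. i \<in> I \<Longrightarrow> f i \<in> R) \<Longrightarrow> sum f I \<in> R"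
  by (induction I rule: infinite_finite_induct) (auto intro: R_0 R_add)

lemma R_prod: "(\<And>i. i \<in> I \<Longrightarrow> f i \<in> R) \<Longrightarrow> prod f I \<in> R"
  by (induction I rule: infinite_finite_induct) (auto intro: R_1 R_mult)

lemma R_poly: "(\<And>i. coeff h i \<in> R) \<Longrightarrow> z \<in> R \<Longrightarrow> poly h z \<in> R"
  by (simp add: poly_altdef R_sum R_mult R_power)

lemma R_eval2:
  assumes "x \<in> R" and "y \<in> R"
  shows "eval2 \<iota> g x y \<in> R"
proof -
  have "poly (map_poly \<iota> c) x \<in> R" for c
    by (intro R_poly assms) (simp add: coeff_map_poly \<iota>_0 R_\<iota>)
  then show ?thesis unfolding eval2_def by (intro R_poly assms) (simp add: coeff_map_poly)
qed

lemma subspace_R: "V.subspace R"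
  unfolding V.subspace_def by (auto intro: R_0 R_add R_mult R_\<iota>)

definition units :: "'l set" where
  "units = {u \<in> R. u \<noteq> 0 \<and> inverse u \<in> R}"

lemma units_R: "u \<in> units \<Longrightarrow> u \<in> R"
  and units_nonzero: "u \<in> units \<Longrightarrow> u \<noteq> 0"
  by (auto simp: units_def)

lemma units_mult: "u \<in> units \<Longrightarrow> v \<in> units \<Longrightarrow> u * v \<in> units"
  by (auto simp: units_def R_mult)

lemma units_inverse: "u \<in> units \<Longrightarrow> inverse u \<in> units"
  by (auto simp: units_def)

lemma units_power_int: "u \<in> units \<Longrightarrow> u powi m \<in> units"
  by (auto simp: units_def power_int_def R_power simp flip: power_inverse)

lemma \<iota>_units: "c \<noteq> 0 \<Longrightarrow> \<iota> c \<in> units"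
  by (auto simp: units_def R_\<iota> \<iota>_eq_0_iff simp flip: \<iota>_inverse)

lemma units_eq: "units = R - max_ideal R"
  by (auto simp: units_def max_ideal_def)

end

locale place_over = subring_over \<iota> F R for \<iota> :: "'k::{field,finite} \<Rightarrow> 'l::field" and F R +
  assumes R_or_inverse: "z \<in> F \<Longrightarrow> z \<in> R \<or> inverse z \<in> R"
begin

lemma max_ideal_R: "a \<in> max_ideal R \<Longrightarrow> a \<in> R"
  by (simp add: max_ideal_def)

lemma zero_max_ideal: "0 \<in> max_ideal R"
  by (simp add: max_ideal_def R_0)

lemma one_notin_max_ideal: "1 \<notin> max_ideal R"
  by (simp add: max_ideal_def R_1)

lemma inverse_max_ideal: "z \<in> F \<Longrightarrow> z \<notin> R \<Longrightarrow> inverse z \<in> max_ideal R"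
  using R_or_inverse[of z] by (auto simp: max_ideal_def)

lemma max_ideal_mult:
  assumes "a \<in> max_ideal R" and "r \<in> R"
  shows "a * r \<in> max_ideal R"
proof -
  have "inverse a \<in> R" if "inverse (a * r) \<in> R" "a * r \<noteq> 0"
  proof -
    have "inverse (a * r) * r \<in> R" using that assms by (intro R_mult)
    also have "inverse (a * r) * r = inverse a" using that by (simp add: field_simps)
    finally show ?thesis .
  qed
  then show ?thesis using assms R_mult by (auto simp: max_ideal_def)
qed

text \<open>One of the quotients a/b and b/a lies in \<open>R\<close>, so one summand can be
  factored out.\<close>

lemma max_ideal_add:
  assumes "a \<in> max_ideal R" and "b \<in> max_ideal R"
  shows "a + b \<in> max_ideal R"
proof (cases "a = 0 \<or> b = 0")
  case False
  have "a / b \<in> F"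
    unfolding divide_inverse using assms R_sub by (intro F_mult F_inverse) (auto dest: max_ideal_R)
  then have "a / b \<in> R \<or> b / a \<in> R" using R_or_inverse[of "a / b"] by simp
  then show ?thesis
  proof
    assume "a / b \<in> R"
    then have "b * (1 + a / b) \<in> max_ideal R" by (intro max_ideal_mult assms R_add R_1)
    then show ?thesis using False by (simp add: distrib_left add.commute)
  next
    assume "b / a \<in> R"
    then have "a * (1 + b / a) \<in> max_ideal R" by (intro max_ideal_mult assms R_add R_1)
    then show ?thesis using False by (simp add: distrib_left)
  qed
qed (use assms in auto)

lemma max_ideal_minus: "a \<in> max_ideal R \<Longrightarrow> - a \<in> max_ideal R"
  using max_ideal_mult[of a "- 1"] R_minus[OF R_1] by simp

lemma max_ideal_diff: "a \<in> max_ideal R \<Longrightarrow> b \<in> max_ideal R \<Longrightarrow> a - b \<in> max_ideal R"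
  using max_ideal_add[of a "- b"] max_ideal_minus[of b] by simp

lemma max_ideal_power: "a \<in> max_ideal R \<Longrightarrow> m > 0 \<Longrightarrow> a ^ m \<in> max_ideal R"
  using max_ideal_mult[OF _ R_power[OF max_ideal_R], of a a "m - 1"] by (cases m) auto

lemma max_ideal_prime:
  assumes "a \<in> R" and "b \<in> R" and "a * b \<in> max_ideal R"
  shows "a \<in> max_ideal R \<or> b \<in> max_ideal R"
proof (rule ccontr)
  assume "\<not> ?thesis"
  then have "a \<in> units" "b \<in> units" using assms by (auto simp: units_eq)
  then have "a * b \<in> units" by (rule units_mult)
  then show False using assms(3) by (simp add: units_eq)
qed

lemma units_add_max_ideal:
  assumes "u \<in> units" and "a \<in> max_ideal R"
  shows "u + a \<in> units"
proof -
  have "u \<in> max_ideal R" if "u + a \<in> max_ideal R"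
    using max_ideal_diff[OF that assms(2)] by simp
  then show ?thesis using assms max_ideal_R R_add by (auto simp: units_eq)
qed

lemma units_1: "1 \<in> units"
  using R_1 by (simp add: units_def)

text \<open>Were \<open>z\<close> outside the maximal ideal, 1/z would lie in \<open>R\<close>, even
  if \<open>z\<close> does not, and multiplying by its \<open>m\<close>-th power would put 1 into
  the ideal.\<close>

lemma power_max_ideal_imp:
  assumes "z \<in> F" and "z ^ m \<in> max_ideal R"
  shows "z \<in> max_ideal R"
proof (rule ccontr)
  assume z: "z \<notin> max_ideal R"
  then have "z \<noteq> 0" "inverse z \<in> R"
    using R_or_inverse[OF assms(1)] zero_max_ideal by (auto simp: max_ideal_def)
  then have "z ^ m * inverse z ^ m \<in> max_ideal R" by (intro max_ideal_mult assms R_power)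
  then show False
    using \<open>z \<noteq> 0\<close> one_notin_max_ideal by (simp flip: power_mult_distrib)
qed

text \<open>Valuation rings are integrally closed. If \<open>z\<close> is not in \<open>R\<close>,
  then w = 1/z is, and the reversed polynomial at \<open>w\<close> expresses \<open>z\<close> as
  -f(w) over the leading coefficient.\<close>

lemma integral_in_R:
  assumes z: "z \<in> F" and g: "g \<noteq> 0" "\<And>i. coeff g i \<in> R" "inverse (lead_coeff g) \<in> R" and root: "poly g z = 0"
  shows "z \<in> R"
proof (rule ccontr)
  assume "z \<notin> R"
  define w where "w = inverse z"
  have w: "w \<in> R" "w \<noteq> 0"
    using R_or_inverse[OF z] \<open>z \<notin> R\<close> R_0 by (auto simp: w_def)
  obtain c f where cf: "reflect_poly g = pCons c f"
    by (cases "reflect_poly g")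
  have c: "c = lead_coeff g"
    using arg_cong[OF cf, of "\<lambda>f. coeff f 0"] by (simp add: coeff_0_reflect_poly)
  have f: "coeff f i \<in> R" for i
    using arg_cong[OF cf, of "\<lambda>f. coeff f (Suc i)"] g(2) R_0 by (metis coeff_pCons_Suc coeff_reflect_poly)
  have "poly (reflect_poly g) w = 0" using w root by (simp add: poly_reflect_poly_nz w_def)
  then have "c + w * poly f w = 0" by (simp add: cf)
  then have "z = - (inverse c * poly f w)"
    using w g(1) by (simp add: c w_def field_simps eq_neg_iff_add_eq_0)
  moreover have "- (inverse c * poly f w) \<in> R"
    using g(3) f w by (intro R_minus R_mult R_poly) (auto simp: c)
  ultimately show False using \<open>z \<notin> R\<close> by simp
qed

lemma subspace_max_ideal: "V.subspace (max_ideal R)"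
  unfolding V.subspace_def
  using zero_max_ideal max_ideal_add max_ideal_mult[OF _ R_\<iota>] by (simp add: mult.commute)

lemma residue_mult:
  assumes "z - \<iota> c \<in> max_ideal R" and "w - \<iota> d \<in> max_ideal R"
  shows "z * w - \<iota> (c * d) \<in> max_ideal R"
proof -
  have "w = (w - \<iota> d) + \<iota> d" by simp
  then have "w \<in> R" using max_ideal_R[OF assms(2)] R_\<iota> R_add by metis
  then have "(z - \<iota> c) * w + (w - \<iota> d) * \<iota> c \<in> max_ideal R"
    using assms by (intro max_ideal_add max_ideal_mult R_\<iota>)
  then show ?thesis by (simp add: \<iota>_mult algebra_simps)
qed

lemma residue_add:
  assumes "z - \<iota> c \<in> max_ideal R" and "w - \<iota> d \<in> max_ideal R"
  shows "(z + w) - \<iota> (c + d) \<in> max_ideal R"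
  using max_ideal_add[OF assms] by (simp add: \<iota>_add algebra_simps)

lemma residue_\<iota>: "\<iota> c - \<iota> c \<in> max_ideal R"
  by (simp add: zero_max_ideal)

lemma residue_unique:
  assumes "z - \<iota> c \<in> max_ideal R" and "z - \<iota> d \<in> max_ideal R"
  shows "c = d"
proof (rule ccontr)
  assume "c \<noteq> d"
  then have "\<iota> (d - c) \<in> units" by (intro \<iota>_units) simp
  moreover have "\<iota> (d - c) \<in> max_ideal R"
    using max_ideal_diff[OF assms] by (simp add: \<iota>_diff)
  ultimately show False by (simp add: units_eq)
qed

lemma residue_eval2:
  assumes "x - \<iota> \<alpha> \<in> max_ideal R" and "y - \<iota> \<beta> \<in> max_ideal R"
  shows "eval2 \<iota> g x y - \<iota> (eval2 (\<lambda>c. c) g \<alpha> \<beta>) \<in> max_ideal R"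
proof -
  have inner: "poly (map_poly \<iota> c) x - \<iota> (poly c \<alpha>) \<in> max_ideal R" for c
  proof (induction c)
    case 0
    show ?case by (simp add: zero_max_ideal \<iota>_0)
  next
    case (pCons a c)
    show ?case
      using residue_add[OF residue_\<iota>[of a] residue_mult[OF assms(1) pCons.IH]]
      by (simp add: map_poly_pCons \<iota>_0)
  qed
  show ?thesis
    unfolding eval2_def
  proof (induction g)
    case 0
    show ?case by (simp add: zero_max_ideal \<iota>_0)
  next
    case (pCons a g)
    show ?case
      using residue_add[OF inner[of a] residue_mult[OF assms(2) pCons.IH]]
      by (simp add: map_poly_pCons)
  qed
qed

lemma transversal_\<iota>:
  assumes "\<And>z. z \<in> R \<Longrightarrow> \<exists>c. z - \<iota> c \<in> max_ideal R"
  shows "transversal (max_ideal R) R (range \<iota>)"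
  unfolding transversal_def
proof (intro conjI ballI ex_ex1I)
  show "\<exists>t. t \<in> range \<iota> \<and> z - t \<in> max_ideal R" if "z \<in> R" for z
    using assms[OF that] by blast
  show "t = t'" if "t \<in> range \<iota> \<and> z - t \<in> max_ideal R" "t' \<in> range \<iota> \<and> z - t' \<in> max_ideal R" for z t t'
    using that residue_unique by auto
qed (use R_const in auto)

lemma place_degree_1:
  assumes "\<And>z. z \<in> R \<Longrightarrow> \<exists>c. z - \<iota> c \<in> max_ideal R"
  shows "place_degree \<iota> R = 1"
proof -
  have "card (range \<iota>) = CARD('k) ^ place_degree \<iota> R"
    by (rule place_degree_transversal[OF subspace_max_ideal subspace_R transversal_\<iota>[OF assms]])
  moreover have "card (range \<iota>) = CARD('k)"
    by (simp add: card_image inj_on_def \<iota>_eq_iff)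
  ultimately have "CARD('k) ^ 1 = CARD('k) ^ place_degree \<iota> R" by simp
  then show ?thesis using card_k_gt_1 by (metis power_inject_exp)
qed

end

lemma (in field_over) place_over:
  assumes "R \<in> places \<iota> F"
  shows "place_over \<iota> F R" using assms by unfold_locales (auto simp: places_def)

text \<open>The common target for infinity and the affine places: a subring with a candidate
  uniformizer. The valuation property and membership in \<open>places\<close> follow from the
  decomposition.\<close>

locale discrete_place = subring_over \<iota> F R for \<iota> :: "'k::{field,finite} \<Rightarrow> 'l::field" and F R +
  fixes t :: 'l
  assumes t_R: "t \<in> R" and t_nonzero: "t \<noteq> 0" and inverse_t: "inverse t \<notin> R"
    and decomp: "z \<in> F \<Longrightarrow> z \<noteq> 0 \<Longrightarrow> \<exists>m::int. \<exists>u\<in>units. z = u * t powi m"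
begin

lemma unit_power_in_R:
  assumes u: "u \<in> units"
  shows "u * t powi m \<in> R \<longleftrightarrow> m \<ge> 0"
proof
  assume "m \<ge> 0"
  then show "u * t powi m \<in> R"
    using units_R[OF u] t_R by (simp add: power_int_def R_mult R_power)
next
  assume *: "u * t powi m \<in> R"
  show "m \<ge> 0"
  proof (rule ccontr)
    assume neg: "\<not> m \<ge> 0"
    have "inverse u * (u * t powi m) * t ^ nat (- m - 1) \<in> R"
      by (rule R_mult[OF R_mult[OF units_R[OF units_inverse[OF u]] *] R_power[OF t_R]])
    also have "inverse u * (u * t powi m) * t ^ nat (- m - 1) = t powi m * t powi (- m - 1)"
      using neg units_nonzero[OF u] by (simp add: power_int_def)
    also have "\<dots> = t powi (- 1)" using t_nonzero by (subst power_int_add[symmetric]) auto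
    finally show False using inverse_t by simp
  qed
qed

lemma t_F: "t \<in> F"
  using t_R R_sub by blast

sublocale place_over
proof
  fix z assume z: "z \<in> F"
  show "z \<in> R \<or> inverse z \<in> R"
  proof (cases "z = 0")
    case False
    then obtain m u where u: "u \<in> units" "z = u * t powi m" using decomp z by blast
    then have "inverse z = inverse u * t powi (- m)" by (simp add: power_int_minus)
    then have "z \<in> R \<longleftrightarrow> m \<ge> 0" "inverse z \<in> R \<longleftrightarrow> - m \<ge> 0"
      using u unit_power_in_R units_inverse by metis+
    then show ?thesis by linarith
  qed (auto intro: R_0)
qed

lemma is_place: "R \<in> places \<iota> F"
proof -
  have "t \<notin> range \<iota>" using inverse_t by (metis R_\<iota> \<iota>_inverse rangeE)
  moreover have "inverse t \<in> F" by (rule F_inverse[OF t_F])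
  ultimately show ?thesis
    unfolding places_def using R_const R_sub t_R inverse_t R_or_inverse by (auto intro: R_diff R_mult)
qed

lemma max_ideal_eq: "max_ideal R = {t * r | r. r \<in> R}"
proof (intro equalityI subsetI)
  fix z assume z: "z \<in> max_ideal R"
  show "z \<in> {t * r | r. r \<in> R}"
  proof (cases "z = 0")
    case True
    then show ?thesis using R_0 by (auto intro!: exI[of _ 0])
  next
    case False
    then obtain m u where u: "u \<in> units" "z = u * t powi m"
      using decomp[of z] z R_sub unfolding max_ideal_def by blast
    have "m \<ge> 0" using z u unit_power_in_R by (auto simp: max_ideal_def)
    moreover have "m \<noteq> 0"
    proof
      assume "m = 0"
      then show False using u z by (simp add: units_eq)
    qed
    ultimately have "u * t powi (m - 1) \<in> R" using u by (simp add: unit_power_in_R)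
    moreover have "z = t * (u * t powi (m - 1))" using u t_nonzero by (simp add: power_int_diff)
    ultimately show ?thesis by blast
  qed
next
  fix z assume "z \<in> {t * r | r. r \<in> R}"
  then obtain r where r: "r \<in> R" "z = t * r" by blast
  have "inverse z \<notin> R" if "z \<noteq> 0"
  proof
    assume "inverse z \<in> R"
    then have "inverse z * r \<in> R" using r by (intro R_mult)
    also have "inverse z * r = inverse t" using r that by (simp add: field_simps)
    finally show False using inverse_t by simp
  qed
  then show "z \<in> max_ideal R" using r R_mult[OF t_R] by (auto simp: max_ideal_def)
qed

lemma uniformizer_t: "uniformizer R t"
  by (simp add: uniformizer_def max_ideal_eq)

text \<open>The description in \<open>valuation\<close> ranges over all uniformizers; another one is
  a unit multiple of \<open>t\<close>, and the power of that unit is absorbed into the unit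
  factor.\<close>

lemma valuation_eq:
  assumes u: "u \<in> units"
  shows "valuation R (u * t powi m) = m"
  unfolding valuation_def
proof (rule the_equality)
  show "\<exists>t' u'. uniformizer R t' \<and> u' \<in> R - max_ideal R \<and> u * t powi m = u' * t' powi m"
    using u uniformizer_t by (auto simp: units_eq)
next
  fix m' assume "\<exists>t' u'. uniformizer R t' \<and> u' \<in> R - max_ideal R \<and> u * t powi m = u' * t' powi m'"
  then obtain t' u' where t': "{t' * r | r. r \<in> R} = {t * r | r. r \<in> R}" "u' \<in> units"
    "u * t powi m = u' * t' powi m'"
    by (auto simp: units_eq uniformizer_def max_ideal_eq)
  have "t * 1 \<in> {t * r | r. r \<in> R}" using R_1 by blast
  then obtain r where r: "r \<in> R" "t = t' * r" unfolding t'(1)[symmetric] by auto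
  have "t' * 1 \<in> {t' * r | r. r \<in> R}" using R_1 by blast
  then obtain s where s: "s \<in> R" "t' = t * s" unfolding t'(1) by auto
  note rs = r s
  then have "t * (r * s) = t * 1" by (metis mult.assoc mult.commute mult_1_right)
  then have "r * s = 1" using t_nonzero by simp
  then have "inverse s = r" by (metis inverse_unique mult.commute)
  then have s: "s \<in> units" using rs \<open>r * s = 1\<close> by (auto simp: units_def)
  define w where "w = u' * s powi m'"
  have w: "w \<in> units" unfolding w_def by (intro units_mult units_power_int t'(2) s)
  have eq: "u * t powi m = w * t powi m'"
    using t'(3) rs(4) by (simp add: power_int_mult_distrib w_def)
  then have "1 * t powi (m - m') = w * inverse u" "1 * t powi (m' - m) = u * inverse w"
    using t_nonzero units_nonzero[OF u] units_nonzero[OF w]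
    by (simp_all add: power_int_diff field_simps)
  moreover have "w * inverse u \<in> R" "u * inverse w \<in> R"
    using u w by (auto intro!: units_R units_mult units_inverse)
  moreover have "1 \<in> units" using R_1 by (simp add: units_def)
  ultimately have "m - m' \<ge> 0" "m' - m \<ge> 0" using unit_power_in_R by metis+
  then show "m' = m" by simp
qed

lemma valuation_ge_iff:
  assumes "z \<in> F" and "z \<noteq> 0"
  shows "valuation R z \<ge> m \<longleftrightarrow> z * t powi (- m) \<in> R"
proof -
  obtain m' u where u: "u \<in> units" "z = u * t powi m'"
    using decomp assms by blast
  have "z * t powi (- m) = u * t powi (m' - m)"
    using u t_nonzero by (simp add: power_int_diff power_int_minus field_simps)
  then show ?thesis using u by (simp only: unit_power_in_R valuation_eq) simp
qed

text \<open>An element of negative value gives 1/t, hence every power of \<open>t\<close> and all of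
  \<open>F\<close>. One inclusion therefore suffices to identify a place.\<close>

lemma maximal:
  assumes R': "R' \<in> places \<iota> F" and sub: "R \<subseteq> R'"
  shows "R' = R"
proof (rule ccontr)
  assume "R' \<noteq> R"
  have R'_mult: "a \<in> R' \<Longrightarrow> b \<in> R' \<Longrightarrow> a * b \<in> R'" for a b
    using R' by (auto simp: places_def)
  have R'_F: "R' \<subseteq> F" "R' \<noteq> F" using R' by (auto simp: places_def)
  obtain z where z: "z \<in> R'" "z \<notin> R"
    using \<open>R' \<noteq> R\<close> sub by blast
  then have "z \<noteq> 0" using R_0 by auto
  then obtain m u where u: "u \<in> units" "z = u * t powi m" using decomp z R'_F by blast
  then have m: "m < 0" using z unit_power_in_R by force
  have "inverse u * t ^ nat (- m - 1) \<in> R'"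
    using units_R[OF units_inverse[OF u(1)]] t_R sub by (intro subsetD[OF sub] R_mult R_power) auto
  then have "z * (inverse u * t ^ nat (- m - 1)) \<in> R'" by (rule R'_mult[OF z(1)])
  also have "z * (inverse u * t ^ nat (- m - 1)) = t powi m * t powi (- m - 1)"
    using u(2) m units_nonzero[OF u(1)] by (simp add: power_int_def)
  also have "\<dots> = t powi (- 1)" using t_nonzero by (subst power_int_add[symmetric]) auto
  finally have inv: "inverse t \<in> R'" by simp
  have inv_pow: "inverse t ^ j \<in> R'" for j
    using sub R_1 inv by (induction j) (auto intro: R'_mult)
  have "F \<subseteq> R'"
  proof
    fix w assume "w \<in> F"
    show "w \<in> R'"
    proof (cases "w = 0")
      case False
      then obtain j v where v: "v \<in> units" "w = v * t powi j"
        using decomp \<open>w \<in> F\<close> by blast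
      have "t powi j \<in> R'" using inv_pow R_power[OF t_R] sub by (auto simp: power_int_def)
      then show ?thesis using v units_R sub by (auto intro: R'_mult)
    qed (use R_0 sub in auto)
  qed
  then show False using R'_F by blast
qed

end

subsection \<open>Riemann-Roch spaces\<close>

text \<open>Discreteness gives the local conditions of a Riemann-Roch space; the finite
  transversals, that is finite residue fields, bound its growth when a point is added.\<close>

locale discrete_places = field_over \<iota> F for \<iota> :: "'k::{field,finite} \<Rightarrow> 'l::field" and F +
  assumes ex_discrete: "P \<in> places \<iota> F \<Longrightarrow> \<exists>t. discrete_place \<iota> F P t"
    and ex_transversal: "P \<in> places \<iota> F \<Longrightarrow> \<exists>T. transversal (max_ideal P) P T"
begin

definition unif :: "'l set \<Rightarrow> 'l" where
  "unif P = (SOME t. discrete_place \<iota> F P t)"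

lemma discrete: "P \<in> places \<iota> F \<Longrightarrow> discrete_place \<iota> F P (unif P)"
  unfolding unif_def by (rule someI_ex[OF ex_discrete])

abbreviation "L \<equiv> riemann_roch_space \<iota> F"

text \<open>Membership in \<open>P\<close> treats z = 0 uniformly, although \<open>valuation\<close>
  has no meaning there.\<close>

lemma L_iff: "z \<in> L D \<longleftrightarrow> z \<in> F \<and> (\<forall>P\<in>places \<iota> F. z * unif P powi (D P) \<in> P)"
proof (cases "z = 0")
  case True
  have "0 \<in> P" if "P \<in> places \<iota> F" for P
  proof -
    interpret discrete_place \<iota> F P "unif P"
      by (rule discrete[OF that])
    show ?thesis by (rule R_0)
  qed
  moreover have "0 \<in> F" using F_const \<iota>_0 by (metis rangeI subsetD)
  ultimately show ?thesis using True by (simp add: riemann_roch_space_def)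
next
  case False
  have "valuation P z \<ge> - D P \<longleftrightarrow> z * unif P powi (D P) \<in> P" if "P \<in> places \<iota> F" "z \<in> F" for P
    using discrete_place.valuation_ge_iff[OF discrete[OF that(1)] that(2) False, of "- D P"] by simp
  then show ?thesis using False by (auto simp: riemann_roch_space_def)
qed

lemma place_subring: "P \<in> places \<iota> F \<Longrightarrow> subring_over \<iota> F P"
  by (rule place_over.axioms(1)[OF place_over])


lemma subspace_L: "V.subspace (L D)"
  unfolding V.subspace_def
proof (intro conjI ballI allI)
  show "0 \<in> L D" by (simp add: riemann_roch_space_def) (metis F_const \<iota>_0 rangeI subsetD)
next
  fix z w assume *: "z \<in> L D" "w \<in> L D"
  have "(z + w) * unif P powi D P \<in> P" if P: "P \<in> places \<iota> F" for P
  proof -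
    interpret subring_over \<iota> F P
      by (rule place_subring[OF P])
    show ?thesis using * P by (simp add: L_iff distrib_right R_add)
  qed
  moreover have "z + w \<in> F" using * F_add by (simp add: L_iff)
  ultimately show "z + w \<in> L D" by (simp add: L_iff)
next
  fix c z assume *: "z \<in> L D"
  have "\<iota> c * z * unif P powi D P \<in> P" if P: "P \<in> places \<iota> F" for P
  proof -
    interpret subring_over \<iota> F P
      by (rule place_subring[OF P])
    show ?thesis using * P by (simp add: L_iff mult.assoc R_mult R_\<iota>)
  qed
  moreover have "\<iota> c * z \<in> F" using * F_mult[OF F_\<iota>] by (simp add: L_iff)
  ultimately show "\<iota> c * z \<in> L D" by (simp add: L_iff)
qed

lemma L_mono:
  assumes "\<And>P. D P \<le> D' P"
  shows "L D \<subseteq> L D'"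
proof
  fix z assume z: "z \<in> L D"
  have "- D' P \<le> valuation P z" if "- D P \<le> valuation P z" for P
    using assms[of P] that by linarith
  then show "z \<in> L D'" using z unfolding riemann_roch_space_def by blast
qed

lemma place_degree:
  assumes "P \<in> places \<iota> F" and "transversal (max_ideal P) P T"
  shows "card T = CARD('k) ^ place_degree \<iota> P"
  using place_over.subspace_max_ideal[OF place_over] subring_over.subspace_R[OF place_subring] assms
  by (intro place_degree_transversal) blast+

text \<open>Multiplying by t^(D P + 1) and reducing modulo the maximal ideal sends the larger space
  to the residue field with kernel L(D). Differences within a fibre lie in L(D), so each residue
  class accounts for at most |L(D)| elements.\<close>

lemma card_L_step:
  assumes P: "P \<in> places \<iota> F" and fin: "finite (L (D(P := D P + 1)))"
  shows "card (L (D(P := D P + 1))) \<le> card (L D) * CARD('k) ^ place_degree \<iota> P"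
proof -
  interpret discrete_place \<iota> F P "unif P"
    by (rule discrete[OF P])
  let ?L = "L (D(P := D P + 1))" and ?t = "unif P"
  have sub: "L D \<subseteq> ?L" by (rule L_mono) simp
  then have finD: "finite (L D)" using fin finite_subset by blast
  have L_D: "z \<in> L D" if "z \<in> ?L" "z * ?t powi (D P + 1) \<in> max_ideal P" for z
  proof -
    have "z * ?t powi (D P + 1) = ?t * (z * ?t powi D P)"
      using t_nonzero by (simp add: power_int_add)
    then have "z * ?t powi D P \<in> P" using that(2) t_nonzero unfolding max_ideal_eq by auto
    then show ?thesis using that(1) by (auto simp: L_iff split: if_splits)
  qed
  obtain T where T: "transversal (max_ideal P) P T"
    using ex_transversal[OF P] by blast
  define fib where "fib \<tau> = {z \<in> ?L. z * ?t powi (D P + 1) - \<tau> \<in> max_ideal P}" for \<tau>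
  have cover: "?L \<subseteq> (\<Union>\<tau>\<in>T. fib \<tau>)"
  proof
    fix z assume z: "z \<in> ?L"
    then have "z * ?t powi ((D(P := D P + 1)) P) \<in> P" using P unfolding L_iff by blast
    then have "\<exists>\<tau>\<in>T. z * ?t powi (D P + 1) - \<tau> \<in> max_ideal P"
      using T unfolding transversal_def by auto
    then show "z \<in> (\<Union>\<tau>\<in>T. fib \<tau>)" using z by (auto simp: fib_def)
  qed
  have card_fib: "card (fib \<tau>) \<le> card (L D)" for \<tau>
  proof (cases "fib \<tau> = {}")
    case False
    then obtain z0 where z0: "z0 \<in> fib \<tau>" by blast
    have "z - z0 \<in> L D" if z: "z \<in> fib \<tau>" for z
    proof (rule L_D)
      show "z - z0 \<in> ?L"
        using z z0 by (intro V.subspace_diff[OF subspace_L]) (auto simp: fib_def)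
      have "(z * ?t powi (D P + 1) - \<tau>) - (z0 * ?t powi (D P + 1) - \<tau>) \<in> max_ideal P"
        using V.subspace_diff[OF subspace_max_ideal] z z0 unfolding fib_def by blast
      then show "(z - z0) * ?t powi (D P + 1) \<in> max_ideal P" by (simp add: algebra_simps)
    qed
    then have "(\<lambda>z. z - z0) ` fib \<tau> \<subseteq> L D" by blast
    then show ?thesis
      using finD by (intro card_inj_on_le[of "\<lambda>z. z - z0"]) (auto simp: inj_on_def)
  qed simp
  have finT: "finite T" using T by (simp add: transversal_def)
  have "card ?L \<le> card (\<Union>\<tau>\<in>T. fib \<tau>)"
    using fin finT by (intro card_mono cover finite_UN_I) (auto simp: fib_def)
  also have "\<dots> \<le> (\<Sum>\<tau>\<in>T. card (fib \<tau>))" using finT by (rule card_UN_le)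
  also have "\<dots> \<le> card T * card (L D)"
    using sum_bounded_above[of T "\<lambda>\<tau>. card (fib \<tau>)" "card (L D)"] card_fib by simp
  finally show ?thesis using place_degree[OF P T] by (simp add: mult.commute)
qed

lemma card_L_le:
  assumes "finite S" and "S \<subseteq> places \<iota> F"
    and "\<And>P. D P \<le> D' P" and "\<And>P. P \<notin> S \<Longrightarrow> D' P = D P" and "finite (L D')"
  shows "card (L D') \<le> card (L D) * CARD('k) ^ (\<Sum>P\<in>S. nat (D' P - D P) * place_degree \<iota> P)"
  using assms(3-)
proof (induction "\<Sum>P\<in>S. nat (D' P - D P)" arbitrary: D')
  case 0
  then have "D' P = D P" for P using assms(1) by (cases "P \<in> S") (auto simp: antisym)
  then have "D' = D" by blast
  then show ?case by simp
next
  case (Suc N)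
  then obtain P where P: "P \<in> S" "D P < D' P"
    by (metis (no_types, lifting) diff_ge_0_iff_ge eq_iff_diff_eq_0 nat_0 nat_0_iff not_less
        old.nat.distinct(1) sum.neutral zero_less_nat_eq diff_gt_0_iff_gt)
  define D1 where "D1 = D'(P := D' P - 1)"
  have D': "D' = D1(P := D1 P + 1)" by (auto simp: D1_def)
  have step: "nat (D' P - D P) = Suc (nat (D1 P - D P))" using P by (simp add: D1_def)
  have rest: "(\<Sum>Q\<in>S - {P}. f (nat (D' Q - D Q)) Q) = (\<Sum>Q\<in>S - {P}. f (nat (D1 Q - D Q)) Q)"
    for f :: "nat \<Rightarrow> 'l set \<Rightarrow> nat"
    by (intro sum.cong) (auto simp: D1_def)
  have "L D1 \<subseteq> L D'" by (rule L_mono) (simp add: D1_def)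
  then have fin: "finite (L D1)" using Suc.prems(3) finite_subset by blast
  have "N = (\<Sum>P\<in>S. nat (D1 P - D P))"
    using Suc.hyps(2) step rest[of "\<lambda>i _. i"] assms(1) P(1) by (simp add: sum.remove[of S P])
  moreover have "D Q \<le> D1 Q" for Q using P Suc.prems(1)[of Q] by (auto simp: D1_def)
  moreover have "Q \<notin> S \<Longrightarrow> D1 Q = D Q" for Q
    using P Suc.prems(2)[of Q] by (auto simp: D1_def)
  ultimately have IH: "card (L D1) \<le> card (L D) * CARD('k) ^ (\<Sum>P\<in>S. nat (D1 P - D P) * place_degree \<iota> P)"
    using fin by (intro Suc.hyps(1))
  have "card (L D') \<le> card (L D1) * CARD('k) ^ place_degree \<iota> P"
    unfolding D' using P(1) assms(2) Suc.prems(3) D' by (intro card_L_step) auto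
  also have "\<dots> \<le> card (L D) * CARD('k) ^ (\<Sum>P\<in>S. nat (D1 P - D P) * place_degree \<iota> P)
      * CARD('k) ^ place_degree \<iota> P"
    using IH by (rule mult_right_mono) simp
  also have "\<dots> = card (L D) * CARD('k) ^ ((\<Sum>P\<in>S. nat (D1 P - D P) * place_degree \<iota> P) + place_degree \<iota> P)"
    by (simp add: power_add)
  also have "(\<Sum>P\<in>S. nat (D1 P - D P) * place_degree \<iota> P) + place_degree \<iota> P
      = (\<Sum>P\<in>S. nat (D' P - D P) * place_degree \<iota> P)"
    using step rest[of "\<lambda>i Q. i * place_degree \<iota> Q"] assms(1) P(1) by (simp add: sum.remove[of S P])
  finally show ?case .
qed

lemma divisor_degree_eq:
  assumes "finite S" and "{P. D P \<noteq> 0} \<subseteq> S"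
  shows "divisor_degree \<iota> D = (\<Sum>P\<in>S. D P * int (place_degree \<iota> P))"
  unfolding divisor_degree_def using assms by (intro sum.mono_neutral_left) auto

text \<open>Each added point raises the degree by its own degree and \<open>ell\<close> by at most
  as much. So a bound for deg - ell at one divisor above \<open>D\<close> holds at \<open>D\<close>;
  finiteness of the larger space lets cardinalities stand for dimensions.\<close>

lemma degree_minus_ell_mono:
  assumes D: "D \<in> divisors \<iota> F" and D': "D' \<in> divisors \<iota> F"
    and le: "\<And>P. D P \<le> D' P" and fin: "finite (L D')"
  shows "divisor_degree \<iota> D - int (ell \<iota> F D) \<le> divisor_degree \<iota> D' - int (ell \<iota> F D')"
proof -
  define S where "S = {P. D P \<noteq> 0} \<union> {P. D' P \<noteq> 0}"
  define N where "N = (\<Sum>P\<in>S. nat (D' P - D P) * place_degree \<iota> P)"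
  have S: "finite S" "S \<subseteq> places \<iota> F" using D D' by (auto simp: S_def divisors_def)
  have "L D \<subseteq> L D'" by (rule L_mono[OF le])
  then have finD: "finite (L D)" using fin finite_subset by blast
  have "CARD('k) ^ ell \<iota> F D' \<le> CARD('k) ^ ell \<iota> F D * CARD('k) ^ N"
    unfolding ell_def N_def card_subspace[OF subspace_L fin, symmetric]
      card_subspace[OF subspace_L finD, symmetric]
    by (rule card_L_le[OF S le _ fin]) (auto simp: S_def)
  then have "ell \<iota> F D' \<le> ell \<iota> F D + N" using card_k_gt_1 by (simp flip: power_add)
  moreover have "int N = divisor_degree \<iota> D' - divisor_degree \<iota> D"
  proof -
    have "divisor_degree \<iota> D' - divisor_degree \<iota> D = (\<Sum>P\<in>S. (D' P - D P) * int (place_degree \<iota> P))"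
      using divisor_degree_eq[OF S(1), of D] divisor_degree_eq[OF S(1), of D']
      by (simp add: S_def left_diff_distrib sum_subtractf)
    then show ?thesis using le by (simp add: N_def)
  qed
  ultimately show ?thesis by linarith
qed

end

subsection \<open>The coordinate ring and its pole order\<close>

lemma map_poly_add_hom:
  assumes "\<And>a b. h (a + b) = h a + h b" and "h 0 = 0"
  shows "map_poly h (f + g) = map_poly h f + map_poly h g"
  by (intro poly_eqI) (simp add: coeff_map_poly assms)

lemma poly_map_poly_mult_hom:
  fixes h :: "'a::comm_ring_1 \<Rightarrow> 'b::comm_ring_1"
  assumes "\<And>a b. h (a + b) = h a + h b" and "\<And>a b. h (a * b) = h a * h b" and "h 0 = 0"
  shows "poly (map_poly h (f * g)) z = poly (map_poly h f) z * poly (map_poly h g) z"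
proof (induction f)
  case (pCons c f)
  have "map_poly h (smult c g) = smult (h c) (map_poly h g)"
    by (intro poly_eqI) (simp add: coeff_map_poly assms)
  with pCons show ?case
    by (simp add: map_poly_add_hom map_poly_pCons assms distrib_right algebra_simps)
qed simp

lemma eval2_add:
  fixes \<iota> :: "'k::{field,finite} \<Rightarrow> 'l::field"
  assumes "field_embedding \<iota>"
  shows "eval2 \<iota> (f + g) x y = eval2 \<iota> f x y + eval2 \<iota> g x y"
proof -
  interpret field_over \<iota> UNIV
    using assms by unfold_locales auto
  show ?thesis
    unfolding eval2_def by (subst map_poly_add_hom) (auto simp: map_poly_add_hom \<iota>_add \<iota>_0)
qed

lemma eval2_mult:
  fixes \<iota> :: "'k::{field,finite} \<Rightarrow> 'l::field"
  assumes "field_embedding \<iota>"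
  shows "eval2 \<iota> (f * g) x y = eval2 \<iota> f x y * eval2 \<iota> g x y"
proof -
  interpret field_over \<iota> UNIV
    using assms by unfold_locales auto
  show ?thesis
    unfolding eval2_def
    by (subst poly_map_poly_mult_hom) (auto simp: map_poly_add_hom poly_map_poly_mult_hom \<iota>_add \<iota>_mult \<iota>_0)
qed

lemma eval2_monom:
  fixes \<iota> :: "'k::{field,finite} \<Rightarrow> 'l::field"
  assumes "field_embedding \<iota>"
  shows "eval2 \<iota> (monom (monom c i) j) x y = \<iota> c * x ^ i * y ^ j"
proof -
  interpret field_over \<iota> UNIV
    using assms by unfold_locales auto
  show ?thesis by (simp add: eval2_def map_poly_monom \<iota>_0 poly_monom)
qed

locale curve = base_field n p k_type for n p and k_type :: "'k::{field,finite} itself" +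
  fixes \<iota> :: "'k \<Rightarrow> 'l::field" and x y :: 'l and a0 :: 'k
  assumes embedding: "field_embedding \<iota>"
    and generic: "generic_point \<iota> (C_poly p (S_poly p a0)) x y"
begin

definition ev :: "'k poly poly \<Rightarrow> 'l" where
  "ev g = eval2 \<iota> g x y"

definition A :: "'l set" where
  "A = range ev"

lemma ev_add: "ev (f + g) = ev f + ev g"
  and ev_mult: "ev (f * g) = ev f * ev g"
  and ev_monom: "ev (monom (monom c i) j) = \<iota> c * x ^ i * y ^ j"
  by (simp_all add: ev_def eval2_add eval2_mult eval2_monom embedding)

lemma ev_0: "ev 0 = 0"
  using ev_add[of 0 0] by (metis add.right_neutral add_left_cancel)

lemma ev_minus: "ev (- f) = - ev f"
  using ev_add[of f "- f"] by (simp add: ev_0 minus_unique)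

lemma ev_diff: "ev (f - g) = ev f - ev g"
  using ev_add[of f "- g"] by (simp add: ev_minus)

lemma ev_const: "ev [:[:c:]:] = \<iota> c"
  using ev_monom[of c 0 0] by (simp add: monom_0)

lemma ev_eq_0_iff: "ev g = 0 \<longleftrightarrow> C_poly p (S_poly p a0) dvd g"
  using generic by (simp add: generic_point_def ev_def)

abbreviation F :: "'l set" where
  "F \<equiv> function_field \<iota> x y"

lemma F_eq: "F = {a / b | a b. a \<in> A \<and> b \<in> A \<and> b \<noteq> 0}"
  unfolding function_field_def A_def ev_def[abs_def] by blast

lemma A_diff: "a \<in> A \<Longrightarrow> b \<in> A \<Longrightarrow> a - b \<in> A"
  and A_mult: "a \<in> A \<Longrightarrow> b \<in> A \<Longrightarrow> a * b \<in> A"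
  by (auto simp: A_def simp flip: ev_diff ev_mult)

lemma A_\<iota>: "\<iota> c \<in> A"
  unfolding A_def using ev_const[of c] by (metis rangeI)

lemma one: "\<iota> 1 = 1"
  using embedding by (simp add: field_embedding_def)

lemma A_0: "0 \<in> A" and A_1: "1 \<in> A"
  using A_\<iota>[of 1] ev_0 one unfolding A_def by (metis rangeI)+

lemma A_F: "a \<in> A \<Longrightarrow> a \<in> F"
  unfolding F_eq using A_1 by force

sublocale field_over \<iota> F
proof
  show "range \<iota> \<subseteq> F" using A_F A_\<iota> by blast
next
  fix z w assume "z \<in> F" "w \<in> F"
  then obtain a b c d where ab: "z = a / b" "a \<in> A" "b \<in> A" "b \<noteq> 0"
    and cd: "w = c / d" "c \<in> A" "d \<in> A" "d \<noteq> 0"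
    unfolding F_eq by blast
  have "z - w = (a * d - c * b) / (b * d)" using ab cd by (simp add: field_simps)
  moreover have "z * w = (a * c) / (b * d)" using ab(1) cd(1) by simp
  moreover have "a * d - c * b \<in> A" "b * d \<in> A" "a * c \<in> A" "b * d \<noteq> 0"
    using ab cd by (auto intro: A_diff A_mult)
  ultimately show "z - w \<in> F" "z * w \<in> F" unfolding F_eq by blast+
next
  fix z assume "z \<in> F"
  then obtain a b where ab: "z = a / b" "a \<in> A" "b \<in> A" "b \<noteq> 0"
    unfolding F_eq by blast
  then have "inverse z = b / a" by simp
  then show "inverse z \<in> F" using ab A_F A_0 unfolding F_eq by (cases "a = 0") auto
qed (rule embedding)

sublocale coord: subring_over \<iota> F A
  by unfold_locales (use A_F A_\<iota> A_diff A_mult in auto)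

lemma two: "(2::'l) = 0"
  using \<iota>_add[of 1 1] two_k by (simp add: \<iota>_0 \<iota>_1)

lemma x_A: "x \<in> A" and y_A: "y \<in> A"
  using ev_monom[of 1 1 0] ev_monom[of 1 0 1] unfolding A_def by (simp_all add: \<iota>_1) (metis rangeI)+

lemma C_poly_monom:
  "C_poly p (S_poly p a0) = monom (monom 1 0) p + monom (monom 1 0) 1
    - (monom (monom 1 (p + 1)) 0 + monom (monom a0 2) 0)"
  using p_ge_2 by (intro poly_eqI) (auto simp: coeff_C_poly coeff_monom)

lemma curve_eq: "y ^ p + y = x ^ (p + 1) + \<iota> a0 * x\<^sup>2"
proof -
  have "ev (C_poly p (S_poly p a0)) = 0" by (simp add: ev_eq_0_iff)
  then show ?thesis unfolding C_poly_monom ev_add ev_diff ev_monom by (simp add: \<iota>_1)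
qed

subsubsection \<open>Normal monomials\<close>

text \<open>The weights p i + (p + 1) j with j < p: the residue modulo \<open>p\<close> is
  \<open>j\<close>, and the inequality says that \<open>i\<close> is nonnegative.\<close>

definition H :: "nat set" where
  "H = {s. (p + 1) * (s mod p) \<le> s}"

text \<open>Recovers the exponent \<open>i\<close>; the truncated subtraction makes it meaningful on
  \<open>H\<close> only.\<close>

definition xexp :: "nat \<Rightarrow> nat" where
  "xexp s = (s - (p + 1) * (s mod p)) div p"

definition e :: "nat \<Rightarrow> 'l" where
  "e s = x ^ xexp s * y ^ (s mod p)"

text \<open>The bound is strict: \<open>B (Suc m)\<close> is the space of pole order at most
  \<open>m\<close>, and \<open>B 0\<close> is zero, so that a remainder below weight 0 can be
  expressed.\<close>

definition B :: "nat \<Rightarrow> 'l set" where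
  "B m = V.span (e ` {s \<in> H. s < m})"

lemma wt_mod: "j < p \<Longrightarrow> (p * i + (p + 1) * j) mod p = j"
proof -
  assume "j < p"
  have "p * i + (p + 1) * j = j + p * (i + j)" by (simp add: algebra_simps)
  then show ?thesis using \<open>j < p\<close> by simp
qed

lemma wt_H:
  assumes "j < p"
  shows "p * i + (p + 1) * j \<in> H" and "xexp (p * i + (p + 1) * j) = i"
    and "e (p * i + (p + 1) * j) = x ^ i * y ^ j"
proof -
  have "p * i div p = i" using p_ge_2 by simp
  then show *: "p * i + (p + 1) * j \<in> H" "xexp (p * i + (p + 1) * j) = i"
    unfolding H_def xexp_def mem_Collect_eq wt_mod[OF assms] by simp_all
  show "e (p * i + (p + 1) * j) = x ^ i * y ^ j" by (simp only: e_def * wt_mod[OF assms])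
qed

lemma H_wt:
  assumes "s \<in> H"
  shows "s = p * xexp s + (p + 1) * (s mod p)"
proof -
  have "(s - s mod p) mod p = 0" by (metis minus_mod_eq_mult_div mod_mult_self1_is_0)
  then have "p dvd s - s mod p" by (rule mod_0_imp_dvd)
  then have "p dvd s - s mod p - p * (s mod p)" by (rule dvd_diff_nat) simp
  moreover have "s - s mod p - p * (s mod p) = s - (p + 1) * (s mod p)" by simp
  ultimately have "p * xexp s = s - (p + 1) * (s mod p)"
    unfolding xexp_def by (metis dvd_mult_div_cancel)
  then show ?thesis using assms by (simp add: H_def)
qed

lemma subspace_B: "V.subspace (B m)"
  by (simp add: B_def V.subspace_span)

lemmas B_zero = V.subspace_0[OF subspace_B]
  and B_add = V.subspace_add[OF subspace_B]
  and B_diff = V.subspace_diff[OF subspace_B]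
  and B_scale = V.subspace_scale[OF subspace_B]
  and B_neg = V.subspace_neg[OF subspace_B]

lemma B_mono: "m \<le> m' \<Longrightarrow> B m \<subseteq> B m'"
  unfolding B_def by (intro V.span_mono) auto

lemma B_mono': "z \<in> B m \<Longrightarrow> m \<le> m' \<Longrightarrow> z \<in> B m'"
  using B_mono by blast

lemma B_0: "B 0 = {0}"
  by (simp add: B_def)

lemma e_B: "s \<in> H \<Longrightarrow> s < m \<Longrightarrow> e s \<in> B m"
  unfolding B_def by (intro V.span_base) auto

text \<open>Replacing y^p by x^(p+1) + a0 x^2 - y preserves the weight in the first term and lowers
  it in the others, as 2p and p + 1 are less than p (p + 1). Allowing all exponents \<open>j\<close>
  also yields that \<open>H\<close> is closed under addition.\<close>

lemma monomial_reduce: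
  "p * i + (p + 1) * j \<in> H \<and> x ^ i * y ^ j - e (p * i + (p + 1) * j) \<in> B (p * i + (p + 1) * j)"
proof (induction j arbitrary: i rule: less_induct)
  case (less j)
  let ?w = "\<lambda>i j. p * i + (p + 1) * j"
  show ?case
  proof (cases "j < p")
    case True
    then show ?thesis using wt_H B_zero by simp
  next
    case False
    define k where "k = j - p"
    have j: "j = k + p" using False by (simp add: k_def)
    have pp: "p > 0" "k < j" "k + 1 < j" "p \<ge> 2" using p_ge_2 by (simp_all add: j)
    have w1: "?w (i + (p + 1)) k = ?w i j" by (simp add: j algebra_simps)
    have w2: "?w (i + 2) k < ?w i j"
    proof -
      have "p * 2 < (p + 1) * p" using pp by (simp add: algebra_simps)
      then show ?thesis by (simp add: j algebra_simps)
    qed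
    have w3: "?w i (k + 1) < ?w i j"
    proof -
      have "(p + 1) * (k + 1) < (p + 1) * j" using pp by (intro mult_strict_left_mono) auto
      then show ?thesis by simp
    qed
    have low: "x ^ i' * y ^ j' \<in> B (?w i j)" if "j' < j" "?w i' j' < ?w i j" for i' j'
    proof -
      have "(x ^ i' * y ^ j' - e (?w i' j')) + e (?w i' j') \<in> B (?w i j)"
        using less.IH[OF that(1), of i'] that(2)
        by (intro B_add) (auto intro: B_mono' e_B)
      then show ?thesis by simp
    qed
    have yp: "y ^ p = x ^ (p + 1) + \<iota> a0 * x\<^sup>2 - y"
      using curve_eq by (simp add: eq_diff_eq)
    have "x ^ i * y ^ j = x ^ i * y ^ k * y ^ p" by (simp add: j power_add)
    also have "\<dots> = x ^ (i + (p + 1)) * y ^ k + \<iota> a0 * (x ^ (i + 2) * y ^ k) - x ^ i * y ^ (k + 1)"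
      unfolding yp by (simp add: power_add power2_eq_square algebra_simps)
    finally have eq: "x ^ i * y ^ j - e (?w i j) =
        (x ^ (i + (p + 1)) * y ^ k - e (?w i j)) + \<iota> a0 * (x ^ (i + 2) * y ^ k) - x ^ i * y ^ (k + 1)"
      by simp
    have "x ^ i * y ^ j - e (?w i j) \<in> B (?w i j)"
    proof -
      have "x ^ (i + (p + 1)) * y ^ k - e (?w i j) \<in> B (?w i j)"
        using less.IH[OF pp(2), of "i + (p + 1)"] unfolding w1 by blast
      then show ?thesis
        unfolding eq
        by (rule B_diff[OF B_add[OF _
              B_scale[OF low[OF pp(2) w2]]] low[OF pp(3) w3]])
    qed
    moreover have "?w i j \<in> H" using less.IH[OF pp(2), of "i + (p + 1)"] unfolding w1 by blast
    ultimately show ?thesis by blast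
  qed
qed

lemma e_mult:
  assumes "s \<in> H" and "s' \<in> H"
  shows "s + s' \<in> H" and "e s * e s' - e (s + s') \<in> B (s + s')"
proof -
  have "p * (xexp s + xexp s') + (p + 1) * (s mod p + s' mod p) = s + s'"
    using H_wt[OF assms(1)] H_wt[OF assms(2)] by (simp add: algebra_simps)
  moreover have "x ^ (xexp s + xexp s') * y ^ (s mod p + s' mod p) = e s * e s'"
    by (simp add: e_def power_add)
  ultimately show "s + s' \<in> H" "e s * e s' - e (s + s') \<in> B (s + s')"
    using monomial_reduce[of "xexp s + xexp s'" "s mod p + s' mod p"] by simp_all
qed

text \<open>A relation is a polynomial of Y-degree less than \<open>p\<close> vanishing at the
  generic point, hence divisible by the curve equation of Y-degree \<open>p\<close>, hence
  zero.\<close>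

lemma e_linear_independent:
  assumes S: "finite S" "S \<subseteq> H" and sum: "(\<Sum>s\<in>S. \<iota> (c s) * e s) = 0" and s: "s \<in> S"
  shows "c s = 0"
proof -
  define G where "G = (\<Sum>s\<in>S. monom (monom (c s) (xexp s)) (s mod p))"
  have "ev G = (\<Sum>s\<in>S. \<iota> (c s) * e s)"
    unfolding G_def using S(1) by (induction S rule: finite_induct) (simp_all add: ev_0 ev_add ev_monom e_def mult.assoc)
  then have dvd: "C_poly p (S_poly p a0) dvd G" using sum by (simp add: ev_eq_0_iff)
  have "degree G \<le> p - 1"
    unfolding G_def
  proof (rule degree_sum_le[OF S(1)])
    fix s
    have "s mod p \<le> p - 1" using p_ge_2 by (simp add: Suc_leI flip: less_Suc_eq_le)
    then show "degree (monom (monom (c s) (xexp s)) (s mod p)) \<le> p - 1"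
      using degree_monom_le order_trans by blast
  qed
  then have "degree G < degree (C_poly p (S_poly p a0))"
    using degree_C_poly[OF p_ge_2, of a0] p_ge_2 by linarith
  then have "G = 0" using dvd dvd_imp_degree_le leD by blast
  then have "0 = coeff (coeff G (s mod p)) (xexp s)" by simp
  also have "\<dots> = (\<Sum>s'\<in>S. coeff (coeff (monom (monom (c s') (xexp s')) (s' mod p)) (s mod p)) (xexp s))"
    by (simp add: G_def coeff_sum)
  also have "\<dots> = (\<Sum>s'\<in>S. if s' = s then c s else 0)"
  proof (intro sum.cong refl)
    fix s' assume "s' \<in> S"
    then have "s' = s" if "s' mod p = s mod p" "xexp s' = xexp s"
      using that H_wt[of s] H_wt[of s'] S(2) s by (metis subsetD)
    then show "coeff (coeff (monom (monom (c s') (xexp s')) (s' mod p)) (s mod p)) (xexp s)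
        = (if s' = s then c s else 0)"
      by auto
  qed
  also have "\<dots> = c s" using S(1) s by simp
  finally show ?thesis by simp
qed

lemma inj_e: "inj_on e H"
proof (rule inj_onI, rule ccontr)
  fix s s' assume s: "s \<in> H" "s' \<in> H" "e s = e s'" "s \<noteq> s'"
  define c :: "nat \<Rightarrow> 'k" where "c r = (if r = s then 1 else - 1)" for r
  have "(\<Sum>r\<in>{s, s'}. \<iota> (c r) * e r) = 0"
    using s(3,4) by (simp add: c_def \<iota>_1 \<iota>_minus)
  then have "c s = 0" by (rule e_linear_independent[rotated 2]) (use s(1,2) in auto)
  then show False by (simp add: c_def)
qed

lemma independent_e: "V.independent (e ` H)"
proof
  assume "V.dependent (e ` H)"
  then obtain T u v where T: "finite T" "T \<subseteq> e ` H" "v \<in> T" "u v \<noteq> 0" "(\<Sum>v\<in>T. \<iota> (u v) * v) = 0"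
    unfolding V.dependent_explicit by (elim exE conjE bexE) (rule that; assumption)
  then obtain S where S: "finite S" "S \<subseteq> H" "T = e ` S"
    using finite_subset_image[OF T(1,2)] by blast
  have inj: "inj_on e S" using inj_e S(2) by (rule inj_on_subset)
  have "(\<Sum>s\<in>S. \<iota> (u (e s)) * e s) = 0"
    using T(5) unfolding S(3) by (simp add: sum.reindex[OF inj])
  moreover obtain s where "s \<in> S" "v = e s" using T(3) S(3) by blast
  ultimately show False
    using e_linear_independent[OF S(1,2), of "\<lambda>s. u (e s)"] T(4) by blast
qed

lemma e_notin_B:
  assumes "s \<in> H"
  shows "e s \<notin> B s"
proof
  assume "e s \<in> B s"
  moreover have "e ` {s' \<in> H. s' < s} \<subseteq> e ` H - {e s}"
    using inj_e assms by (auto simp: inj_on_def)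
  ultimately have "e s \<in> V.span (e ` H - {e s})" unfolding B_def using V.span_mono by blast
  then show False using independent_e assms unfolding V.dependent_def by blast
qed

lemma B_Suc:
  assumes "z \<in> B (Suc m)"
  shows "\<exists>c. z - \<iota> c * e m \<in> B m \<and> (m \<notin> H \<longrightarrow> z \<in> B m)"
proof (cases "m \<in> H")
  case True
  then have "e ` {s \<in> H. s < Suc m} = insert (e m) (e ` {s \<in> H. s < m})"
    by (auto simp: less_Suc_eq)
  then show ?thesis using assms True by (simp add: B_def V.span_breakdown_eq)
next
  case False
  then have "{s \<in> H. s < Suc m} = {s \<in> H. s < m}" by (auto simp: less_Suc_eq)
  then show ?thesis using assms by (intro exI[of _ 0]) (simp add: B_def \<iota>_0)
qed

lemma B_mult_Suc:
  assumes "z \<in> B (Suc m)" and "w \<in> B (Suc m')"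
  shows "z * w \<in> B (Suc (m + m'))"
proof -
  have ee: "e s * e s' \<in> B (Suc (m + m'))" if "s \<in> H" "s < Suc m" "s' \<in> H" "s' < Suc m'" for s s'
  proof -
    have "(e s * e s' - e (s + s')) + e (s + s') \<in> B (Suc (m + m'))"
      using e_mult[OF that(1,3)] that(2,4)
      by (intro B_add) (auto intro: B_mono' e_B)
    then show ?thesis by simp
  qed
  have ew: "e s * w \<in> B (Suc (m + m'))" if s: "s \<in> H" "s < Suc m" for s
  proof -
    have "V.subspace {w. e s * w \<in> B (Suc (m + m'))}"
      unfolding V.subspace_def
      using B_zero B_add B_scale
      by (auto simp: distrib_left mult.left_commute[of "e s"])
    then have "B (Suc m') \<subseteq> {w. e s * w \<in> B (Suc (m + m'))}"
      unfolding B_def[of "Suc m'"] by (rule V.span_minimal[rotated]) (use ee s in auto)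
    then show ?thesis using assms(2) by blast
  qed
  have "V.subspace {z. z * w \<in> B (Suc (m + m'))}"
    unfolding V.subspace_def
    using B_zero B_add B_scale
    by (auto simp: distrib_right mult.assoc)
  then have "B (Suc m) \<subseteq> {z. z * w \<in> B (Suc (m + m'))}"
    unfolding B_def[of "Suc m"] by (rule V.span_minimal[rotated]) (use ew in auto)
  then show ?thesis using assms(1) by blast
qed

lemma B_mult:
  assumes "z \<in> B m" and "w \<in> B (Suc m')"
  shows "z * w \<in> B (m + m')"
proof (cases m)
  case 0
  then show ?thesis using assms B_zero by (simp add: B_0)
next
  case (Suc i)
  then show ?thesis using B_mult_Suc[of z i w m'] assms by simp
qed

lemma e_0: "e 0 = 1" and e_p: "e p = x" and e_Suc_p: "e (p + 1) = y"
  using wt_H(3)[of 0 0] wt_H(3)[of 0 1] wt_H(3)[of 1 0] p_ge_2 by simp_all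

lemma H_0: "0 \<in> H" and H_p: "p \<in> H" and H_Suc_p: "p + 1 \<in> H"
  using wt_H(1)[of 0 0] wt_H(1)[of 0 1] wt_H(1)[of 1 0] p_ge_2 by simp_all

lemma B_\<iota>: "\<iota> c \<in> B (Suc m)"
  using B_scale[OF e_B[OF H_0], of "Suc m" c] by (simp add: e_0)

lemma B_1: "z \<in> B 1 \<Longrightarrow> z \<in> range \<iota>"
  using B_Suc[of z 0] by (auto simp: B_0 e_0)

text \<open>The union is a subring containing the constants, \<open>x\<close> and \<open>y\<close>.
  In \<open>C\<close> the index \<open>Suc m\<close> makes orders add under multiplication.\<close>

lemma A_B: "A = (\<Union>m. B m)"
proof (intro equalityI subsetI)
  fix z assume "z \<in> (\<Union>m. B m)"
  then obtain m where "z \<in> B m" by blast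
  moreover have "e s \<in> A" for s unfolding e_def by (intro A_mult coord.R_power x_A y_A)
  then have "B m \<subseteq> A" unfolding B_def by (intro V.span_minimal coord.subspace_R) blast
  ultimately show "z \<in> A" by blast
next
  define C where "C = (\<Union>m. B (Suc m))"
  have C_iff: "z \<in> C \<longleftrightarrow> (\<exists>m. z \<in> B (Suc m))" for z
    by (auto simp: C_def)
  interpret C: subring_over \<iota> UNIV C
  proof
    fix a b assume "a \<in> C" "b \<in> C"
    then obtain m m' where m: "a \<in> B (Suc m)" "b \<in> B (Suc m')" unfolding C_iff by blast
    then show "a * b \<in> C" unfolding C_iff using B_mult_Suc by blast
    have "a \<in> B (Suc (m + m'))" "b \<in> B (Suc (m + m'))" using m by (auto intro: B_mono')
    then show "a - b \<in> C" unfolding C_iff using B_diff by blast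
  qed (use embedding B_\<iota> C_iff in auto)
  have x: "x \<in> C" using e_B[OF H_p, of "Suc p"] unfolding C_iff e_p by auto
  have y: "y \<in> C" using e_B[OF H_Suc_p, of "Suc (p + 1)"] unfolding C_iff e_Suc_p by auto
  fix z assume "z \<in> A"
  then have "z \<in> C" using C.R_eval2[OF x y] by (auto simp: A_def ev_def)
  then show "z \<in> (\<Union>m. B m)" using C_iff by blast
qed

section \<open>Pole order of regular functions\<close>

lemma B_A: "B m \<subseteq> A"
  by (auto simp: A_B)

text \<open>The successor undoes the strict bound in \<open>B\<close>. At 0 the value is 0 by
  default, so the rules for orders ask for nonzero arguments.\<close>

definition ord :: "'l \<Rightarrow> nat" where
  "ord z = (LEAST m. z \<in> B (Suc m))"

lemma ord_B:
  assumes "z \<in> A"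
  shows "z \<in> B (Suc (ord z))"
proof -
  obtain m where "z \<in> B m"
    using assms by (auto simp: A_B)
  then have "z \<in> B (Suc m)" by (rule B_mono') simp
  then show ?thesis unfolding ord_def by (rule LeastI)
qed

lemma B_iff:
  assumes "z \<in> A" and "z \<noteq> 0"
  shows "z \<in> B m \<longleftrightarrow> ord z < m"
proof
  assume "ord z < m"
  then show "z \<in> B m" using B_mono'[OF ord_B[OF assms(1)], of m] by simp
next
  assume z: "z \<in> B m"
  then have "m \<noteq> 0" using assms(2) B_0 by (metis singletonD)
  then obtain i where i: "m = Suc i" using not0_implies_Suc by blast
  then show "ord z < m" using z unfolding ord_def by (metis Least_le less_Suc_eq_le)
qed

lemma ord_lead:
  assumes "z \<in> A" and "z \<noteq> 0"
  obtains c where "c \<noteq> 0" and "z - \<iota> c * e (ord z) \<in> B (ord z)" and "ord z \<in> H"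
proof -
  obtain c where c: "z - \<iota> c * e (ord z) \<in> B (ord z)" "ord z \<notin> H \<longrightarrow> z \<in> B (ord z)"
    using B_Suc[OF ord_B[OF assms(1)]] by blast
  have "z \<notin> B (ord z)" by (simp add: B_iff[OF assms])
  then have "c \<noteq> 0" "ord z \<in> H" using c by (auto simp: \<iota>_0)
  then show thesis using c(1) that by blast
qed

lemma ord_eqI:
  assumes "c \<noteq> 0" and "z - \<iota> c * e m \<in> B m" and "m \<in> H"
  shows "z \<in> A" and "z \<noteq> 0" and "ord z = m"
proof -
  have e: "\<iota> c * e m \<in> B (Suc m)"
    using e_B[OF assms(3)] by (intro B_scale) auto
  have nB: "\<iota> c * e m \<notin> B m"
  proof
    assume "\<iota> c * e m \<in> B m"
    then have "\<iota> (inverse c) * (\<iota> c * e m) \<in> B m"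
      by (rule B_scale)
    also have "\<iota> (inverse c) * (\<iota> c * e m) = e m"
      using assms(1) by (simp flip: mult.assoc \<iota>_mult add: \<iota>_1)
    finally show False using e_notin_B[OF assms(3)] by simp
  qed
  have "(z - \<iota> c * e m) + \<iota> c * e m \<in> B (Suc m)"
    using assms(2) e by (intro B_add) (auto intro: B_mono')
  then have z: "z \<in> B (Suc m)" by simp
  then show A: "z \<in> A" using B_A by blast
  have n: "z \<notin> B m"
  proof
    assume "z \<in> B m"
    from B_diff[OF this assms(2)] show False
      using nB by simp
  qed
  then show nz: "z \<noteq> 0" using B_zero by blast
  show "ord z = m" using z n by (simp add: B_iff[OF A nz])
qed

text \<open>Replacing both factors by their leading terms changes the product only below the
  expected weight, and the product of the leading coefficients is nonzero.\<close>

lemma ord_mult: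
  assumes z: "z \<in> A" "z \<noteq> 0" and w: "w \<in> A" "w \<noteq> 0"
  shows "ord (z * w) = ord z + ord w"
proof -
  obtain c where c: "c \<noteq> 0" "z - \<iota> c * e (ord z) \<in> B (ord z)" "ord z \<in> H"
    using ord_lead[OF z] by blast
  obtain d where d: "d \<noteq> 0" "w - \<iota> d * e (ord w) \<in> B (ord w)" "ord w \<in> H"
    using ord_lead[OF w] by blast
  have ez: "\<iota> c * e (ord z) \<in> B (Suc (ord z))"
    using e_B[OF c(3)] by (intro B_scale) auto
  have 1: "(z - \<iota> c * e (ord z)) * w \<in> B (ord z + ord w)"
    by (rule B_mult[OF c(2) ord_B[OF w(1)]])
  have 2: "\<iota> c * e (ord z) * (w - \<iota> d * e (ord w)) \<in> B (ord z + ord w)"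
    using B_mult[OF d(2) ez] by (simp only: mult.commute add.commute)
  have 3: "\<iota> (c * d) * (e (ord z) * e (ord w) - e (ord z + ord w)) \<in> B (ord z + ord w)"
    by (rule B_scale[OF e_mult(2)[OF c(3) d(3)]])
  have "(z - \<iota> c * e (ord z)) * w + \<iota> c * e (ord z) * (w - \<iota> d * e (ord w))
      + \<iota> (c * d) * (e (ord z) * e (ord w) - e (ord z + ord w)) \<in> B (ord z + ord w)"
    by (rule B_add[OF B_add[OF 1 2] 3])
  moreover have "(z - u) * w + u * (w - v) + k * (f - g) = z * w - k * g" if "k * f = u * v" for u v k f g :: 'l
    using that by (simp add: algebra_simps)
  moreover have "\<iota> (c * d) * (e (ord z) * e (ord w)) = \<iota> c * e (ord z) * (\<iota> d * e (ord w))"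
    by (simp add: \<iota>_mult)
  ultimately have "z * w - \<iota> (c * d) * e (ord z + ord w) \<in> B (ord z + ord w)" by metis
  then show ?thesis using c(1) d(1) e_mult(1)[OF c(3) d(3)] by (intro ord_eqI(3)[of "c * d"]) auto
qed

lemma ord_e: "s \<in> H \<Longrightarrow> e s \<noteq> 0" "s \<in> H \<Longrightarrow> ord (e s) = s"
  using ord_eqI(2,3)[of 1 "e s" s] B_zero by (simp_all add: \<iota>_1)

lemma ord_x: "ord x = p" and ord_y: "ord y = p + 1" and x_nonzero: "x \<noteq> 0" and y_nonzero: "y \<noteq> 0"
  using ord_e[OF H_p] ord_e[OF H_Suc_p] by (simp_all add: e_p e_Suc_p[simplified])

lemma ord_1: "ord 1 = 0"
  using ord_e(2)[OF H_0] by (simp add: e_0)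

lemma ord_power:
  assumes "z \<in> A" and "z \<noteq> 0"
  shows "ord (z ^ i) = i * ord z"
  by (induction i) (simp_all add: ord_1 ord_mult assms coord.R_power)

subsubsection \<open>Dimensions\<close>

lemma finite_B: "finite (B m)"
proof -
  let ?S = "e ` {s \<in> H. s < m}"
  have fin: "finite ?S" by auto
  have "B m \<subseteq> (\<lambda>u. \<Sum>v\<in>?S. \<iota> (u v) * v) ` (?S \<rightarrow>\<^sub>E UNIV)"
  proof
    fix z assume "z \<in> B m"
    then obtain u where "z = (\<Sum>v\<in>?S. \<iota> (u v) * v)"
      unfolding B_def V.span_finite[OF fin] by blast
    then show "z \<in> (\<lambda>u. \<Sum>v\<in>?S. \<iota> (u v) * v) ` (?S \<rightarrow>\<^sub>E UNIV)"
      by (intro image_eqI[of _ _ "restrict u ?S"]) (auto cong: sum.cong)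
  qed
  moreover have "finite (?S \<rightarrow>\<^sub>E (UNIV :: 'k set))"
    using fin by (intro finite_PiE) auto
  ultimately show ?thesis using finite_surj by blast
qed

lemma dim_B: "V.dim (B m) = card {s \<in> H. s < m}"
proof -
  have "V.independent (e ` {s \<in> H. s < m})"
    using independent_e by (rule V.independent_mono) auto
  then have "V.dim (B m) = card (e ` {s \<in> H. s < m})"
    unfolding B_def by (rule V.dim_span_eq_card_independent)
  also have "\<dots> = card {s \<in> H. s < m}"
    using inj_e by (intro card_image) (auto simp: inj_on_def)
  finally show ?thesis .
qed

text \<open>The largest residue is p - 1, and (p + 1)(p - 1) = p^2 - 1 lies below p^2.\<close>

lemma H_large: "s \<ge> p\<^sup>2 \<Longrightarrow> s \<in> H"
proof -
  assume "s \<ge> p\<^sup>2"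
  have "s mod p \<le> p - 1" using p_ge_2 by (simp add: Suc_leI flip: less_Suc_eq_le)
  then have "(p + 1) * (s mod p) \<le> (p + 1) * (p - 1)" by (rule mult_le_mono2)
  also have "\<dots> \<le> p\<^sup>2" by (simp add: power2_eq_square algebra_simps)
  finally show ?thesis using \<open>s \<ge> p\<^sup>2\<close> by (simp add: H_def)
qed

definition genus :: nat where
  "genus = (\<Sum>j<p. j)"

lemma two_genus: "2 * genus = p * (p - 1)"
proof -
  have "2 * (\<Sum>j<Suc m. j) = Suc m * m" for m :: nat by (induction m) auto
  from this[of "p - 1"] show ?thesis
    using p_ge_2 by (simp add: genus_def)
qed

text \<open>In the residue class of \<open>j\<close> modulo \<open>p\<close> the smallest weight is
  (p + 1) j; below it lie the \<open>j\<close> gaps i p + j with i < j.\<close>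

lemma card_gaps: "card (- H) = genus"
proof -
  let ?g = "\<lambda>(j, i). i * p + j"
  have "bij_betw ?g (SIGMA j:{..<p}. {..<j}) (- H)"
  proof (rule bij_betwI[where g = "\<lambda>s. (s mod p, s div p)"])
    have *: "i * p + j \<notin> H \<longleftrightarrow> i < j" if "j < p" for i j
    proof -
      have "(i * p + j) mod p = j" using that by simp
      then have "i * p + j \<notin> H \<longleftrightarrow> i * p + j < j * p + j"
        by (simp add: H_def not_le mult.commute)
      then show ?thesis using p_ge_2 by simp
    qed
    show "?g \<in> (SIGMA j:{..<p}. {..<j}) \<rightarrow> - H" using * by auto
    show "(\<lambda>s. (s mod p, s div p)) \<in> - H \<rightarrow> (SIGMA j:{..<p}. {..<j})"
    proof
      fix s assume "s \<in> - H"
      then show "(s mod p, s div p) \<in> (SIGMA j:{..<p}. {..<j})"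
        using *[of "s mod p" "s div p"] p_ge_2 by simp
    qed
  qed (use p_ge_2 in auto)
  then have "card (- H) = card (SIGMA j:{..<p}. {..<j})" by (rule bij_betw_same_card[symmetric])
  then show ?thesis by (simp add: genus_def)
qed

lemma dim_B_large:
  assumes "m \<ge> p\<^sup>2"
  shows "V.dim (B m) + genus = m"
proof -
  have "- H \<subseteq> {..<m}"
    using H_large assms by (metis ComplD lessThan_iff not_le order_trans subsetI)
  then have "{..<m} = {s \<in> H. s < m} \<union> - H" "finite (- H)" by (auto intro: finite_subset)
  then have "card {..<m} = card {s \<in> H. s < m} + card (- H)"
    by (simp only:) (rule card_Un_disjoint, auto)
  then show ?thesis by (simp add: dim_B card_gaps)
qed

end

subsection \<open>The place at infinity\<close>

context curve
begin

text \<open>Stated through the subspaces \<open>B\<close> rather than by comparing orders, so that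
  closure under subtraction is immediate.\<close>

definition Pinf :: "'l set" where
  "Pinf = {a / b | a b. b \<in> A \<and> b \<noteq> 0 \<and> a \<in> B (Suc (ord b))}"

lemma Pinf_iff:
  assumes "a \<in> A" and "b \<in> A" and "b \<noteq> 0"
  shows "a / b \<in> Pinf \<longleftrightarrow> a \<in> B (Suc (ord b))"
proof
  assume "a / b \<in> Pinf"
  then obtain c d where cd: "a / b = c / d" "d \<in> A" "d \<noteq> 0" "c \<in> B (Suc (ord d))"
    unfolding Pinf_def by blast
  show "a \<in> B (Suc (ord b))"
  proof (cases "a = 0")
    case False
    have "a * d = c * b" using cd assms by (simp add: field_simps)
    moreover have "c \<noteq> 0" using False cd assms by auto
    moreover have "c \<in> A" using cd B_A by blast
    ultimately have "ord a + ord d = ord c + ord b"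
      using ord_mult[OF assms(1) False cd(2,3)] ord_mult[of c b] assms by simp
    moreover have "ord c \<le> ord d"
      using B_iff[OF \<open>c \<in> A\<close> \<open>c \<noteq> 0\<close>] cd(4) by simp
    ultimately show ?thesis using B_iff[OF assms(1) False] by simp
  qed (simp add: B_zero)
qed (use assms in \<open>auto simp: Pinf_def\<close>)

lemma nonzero_decomp:
  assumes "z \<in> F" and "z \<noteq> 0"
  obtains a b where "z = a / b" "a \<in> A" "b \<in> A" "a \<noteq> 0" "b \<noteq> 0"
  using assms unfolding F_eq by auto

text \<open>The element x / y has pole order p - (p + 1) = -1. Fractions of nonzero elements of
  equal order are units, and powers of \<open>x\<close> and \<open>y\<close> equalize the orders in
  any nonzero fraction.\<close>

sublocale infty: discrete_place \<iota> F Pinf "x / y"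
proof -
  have xy: "(x ^ i * y ^ j) * z \<in> A" "z \<noteq> 0 \<Longrightarrow> (x ^ i * y ^ j) * z \<noteq> 0"
    "z \<noteq> 0 \<Longrightarrow> ord ((x ^ i * y ^ j) * z) = p * i + (p + 1) * j + ord z"
    if "z \<in> A" for z i j
    using that x_A y_A x_nonzero y_nonzero
    by (simp_all add: A_mult coord.R_power ord_mult ord_power ord_x ord_y)
  interpret subring_over \<iota> F Pinf
  proof
    have "\<iota> c / 1 \<in> Pinf" for c
      unfolding Pinf_def using A_1 B_\<iota> by (intro CollectI exI[of _ "\<iota> c"] exI[of _ 1]) simp
    then show "range \<iota> \<subseteq> Pinf" by auto
    show "Pinf \<subseteq> F" unfolding Pinf_def F_eq using B_A by blast
    fix z w assume "z \<in> Pinf" "w \<in> Pinf"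
    then obtain a b c d where ab: "z = a / b" "b \<in> A" "b \<noteq> 0" "a \<in> B (Suc (ord b))"
      and cd: "w = c / d" "d \<in> A" "d \<noteq> 0" "c \<in> B (Suc (ord d))"
      unfolding Pinf_def by blast
    have bd: "b * d \<in> A" "b * d \<noteq> 0" "ord (b * d) = ord b + ord d"
      using ab cd by (simp_all add: A_mult ord_mult)
    have "a * c \<in> B (Suc (ord (b * d)))"
      unfolding bd using B_mult_Suc[OF ab(4) cd(4)] .
    moreover have "a * d - c * b \<in> B (Suc (ord (b * d)))"
      unfolding bd
      using B_mult_Suc[OF ab(4) ord_B[OF cd(2)]] B_mult_Suc[OF cd(4) ord_B[OF ab(2)]]
      by (intro B_diff) (simp_all add: add.commute)
    moreover have "z - w = (a * d - c * b) / (b * d)" using ab cd by (simp add: field_simps)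
    moreover have "z * w = (a * c) / (b * d)" using ab(1) cd(1) by simp
    ultimately show "z - w \<in> Pinf" "z * w \<in> Pinf" unfolding Pinf_def using bd by blast+
  qed
  show "discrete_place \<iota> F Pinf (x / y)"
  proof
    show "x / y \<in> Pinf" by (simp add: Pinf_iff x_A y_A x_nonzero y_nonzero B_iff ord_x ord_y)
    show "x / y \<noteq> 0" by (simp add: x_nonzero y_nonzero)
    have "y / x \<notin> Pinf" by (simp add: Pinf_iff x_A y_A x_nonzero y_nonzero B_iff ord_x ord_y)
    then show "inverse (x / y) \<notin> Pinf" by simp
    fix z assume z: "z \<in> F" "z \<noteq> 0"
    then obtain a b where ab: "z = a / b" "a \<in> A" "b \<in> A" "a \<noteq> 0" "b \<noteq> 0"
      by (rule nonzero_decomp)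
    have unit: "a' / b' \<in> units" if "a' \<in> A" "b' \<in> A" "a' \<noteq> 0" "b' \<noteq> 0" "ord a' = ord b'" for a' b'
      using that by (simp add: units_def Pinf_iff B_iff)
    show "\<exists>m::int. \<exists>u\<in>units. z = u * (x / y) powi m"
    proof (cases "ord a \<le> ord b")
      case True
      define d where "d = ord b - ord a"
      have "(y ^ d * a) / (x ^ d * b) \<in> units"
        using xy(1-3)[OF ab(2), of 0 d] xy(1-3)[OF ab(3), of d 0] ab True by (intro unit) (simp_all add: d_def)
      moreover have "z = (y ^ d * a) / (x ^ d * b) * (x / y) powi (int d)"
        using ab x_nonzero y_nonzero by (simp add: power_divide)
      ultimately show ?thesis by blast
    next
      case False
      define d where "d = ord a - ord b"
      have "(x ^ d * a) / (y ^ d * b) \<in> units"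
        using xy(1-3)[OF ab(2), of d 0] xy(1-3)[OF ab(3), of 0 d] ab False by (intro unit) (simp_all add: d_def)
      moreover have "z = (x ^ d * a) / (y ^ d * b) * (x / y) powi (- int d)"
        using ab x_nonzero y_nonzero by (simp add: power_divide power_int_minus)
      ultimately show ?thesis by blast
    qed
  qed
qed

lemma Pinf_max_ideal:
  assumes "a \<in> A" and "b \<in> A" and "b \<noteq> 0"
  shows "a / b \<in> max_ideal Pinf \<longleftrightarrow> a \<in> B (ord b)"
proof (cases "a = 0")
  case True
  then show ?thesis using infty.R_0 B_zero by (simp add: max_ideal_def)
next
  case False
  then have "a / b \<in> max_ideal Pinf \<longleftrightarrow> a / b \<in> Pinf \<and> b / a \<notin> Pinf"
    using assms by (simp add: max_ideal_def)
  then show ?thesis using False assms by (auto simp: Pinf_iff B_iff)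
qed

text \<open>The residue is the quotient of the coefficients of numerator and denominator at weight
  \<open>ord b\<close>.\<close>

lemma Pinf_residue:
  assumes "z \<in> Pinf"
  shows "\<exists>c. z - \<iota> c \<in> max_ideal Pinf"
proof -
  obtain a b where ab: "z = a / b" "b \<in> A" "b \<noteq> 0" "a \<in> B (Suc (ord b))"
    using assms unfolding Pinf_def by blast
  obtain c where c: "a - \<iota> c * e (ord b) \<in> B (ord b)"
    using B_Suc[OF ab(4)] by blast
  obtain d where d: "d \<noteq> 0" "b - \<iota> d * e (ord b) \<in> B (ord b)"
    using ord_lead[OF ab(2,3)] by blast
  have "(a - \<iota> c * e (ord b)) - \<iota> (c / d) * (b - \<iota> d * e (ord b)) \<in> B (ord b)"
    by (intro B_diff B_scale c d)
  also have "(a - \<iota> c * e (ord b)) - \<iota> (c / d) * (b - \<iota> d * e (ord b)) = a - \<iota> (c / d) * b"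
  proof -
    have "\<iota> (c / d) * \<iota> d = \<iota> c" using d(1) by (simp flip: \<iota>_mult)
    then show ?thesis by (simp add: right_diff_distrib flip: mult.assoc)
  qed
  finally have "(a - \<iota> (c / d) * b) / b \<in> max_ideal Pinf"
    using ab B_A by (subst Pinf_max_ideal) (auto intro: A_diff A_mult A_\<iota>)
  moreover have "(a - \<iota> (c / d) * b) / b = z - \<iota> (c / d)"
    using ab by (simp add: diff_divide_distrib)
  ultimately show ?thesis by auto
qed

lemma Pinf_degree: "place_degree \<iota> Pinf = 1"
  by (rule infty.place_degree_1[OF Pinf_residue])

lemma A_pole_order:
  assumes "z \<in> A"
  shows "z * (x / y) powi (int m) \<in> Pinf \<longleftrightarrow> z \<in> B (Suc m)"
proof (cases "z = 0")
  case True
  then show ?thesis using infty.R_0 B_zero by simp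
next
  case False
  have "z * (x / y) powi (int m) = (z * x ^ m) / y ^ m" by (simp add: power_divide)
  moreover have "z * x ^ m \<in> A" "y ^ m \<in> A" "y ^ m \<noteq> 0" "z * x ^ m \<noteq> 0"
    using assms False x_A y_A x_nonzero y_nonzero by (auto intro: A_mult coord.R_power)
  moreover have "ord (z * x ^ m) = ord z + m * p" "ord (y ^ m) = m * (p + 1)"
    using assms False x_A y_A x_nonzero y_nonzero
    by (simp_all add: ord_mult ord_power ord_x ord_y coord.R_power)
  ultimately show ?thesis using assms False by (simp add: Pinf_iff B_iff)
qed

lemma e_F: "e s \<in> F"
  unfolding e_def by (intro A_F A_mult coord.R_power x_A y_A)

text \<open>At a place that is not finite on \<open>x\<close> the element \<open>y\<^sup>p / x\<^bsup>p+1\<^esup>\<close> is a unit, so the \<open>p\<close>-th power of a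
  normal monomial of weight \<open>s\<close> is \<open>x\<^sup>s\<close> up to a unit.\<close>

lemma infinite_place_unique:
  assumes R: "R \<in> places \<iota> F" and x: "x \<notin> R"
  shows "R = Pinf"
proof -
  interpret place_over \<iota> F R
    by (rule place_over[OF R])
  have pp: "p > 0" "p - 1 > 0" using p_ge_2 by simp_all
  have ix: "inverse x \<in> max_ideal R" using x inverse_max_ideal A_F[OF x_A] by blast
  \<comment> \<open>The curve equation becomes y^p v = x^(p+1) w, with \<open>v\<close> and
    \<open>w\<close> equal to 1 plus an element that turns out to lie in the maximal ideal.\<close>
  define v w where "v = 1 + inverse y ^ (p - 1)" and "w = 1 + \<iota> a0 * inverse x ^ (p - 1)"
  have w: "w \<in> units"
    unfolding w_def using max_ideal_mult[OF max_ideal_power[OF ix pp(2)] R_\<iota>, of a0]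
    by (intro units_add_max_ideal units_1) (simp add: mult.commute)
  have "y ^ p * v = y ^ p + y"
    using y_nonzero pp(1) by (simp add: v_def distrib_left power_diff field_simps)
  moreover have xw: "x ^ (p + 1) * w = x ^ (p + 1) + \<iota> a0 * x\<^sup>2"
    using x_nonzero pp(1) by (simp add: w_def power_diff field_simps power2_eq_square)
  ultimately have eq: "y ^ p * v = x ^ (p + 1) * w" using curve_eq by simp
  \<comment> \<open>For \<open>y\<close> in \<open>R\<close> the equation divided by x^(p+1) w would
    exhibit 1 as an element of the maximal ideal.\<close>
  have "y \<notin> R"
  proof
    assume "y \<in> R"
    then have "(y ^ p + y) * inverse w \<in> R"
      by (intro R_mult[OF _ units_R[OF units_inverse[OF w]]] R_add R_power)
    then have "inverse x ^ (p + 1) * ((y ^ p + y) * inverse w) \<in> max_ideal R"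
      by (intro max_ideal_mult max_ideal_power ix) auto
    moreover have "inverse x ^ (p + 1) * ((y ^ p + y) * inverse w) = 1"
      unfolding curve_eq xw[symmetric] using x_nonzero units_nonzero[OF w] by (simp add: field_simps)
    ultimately show False using one_notin_max_ideal by simp
  qed
  then have "inverse y \<in> max_ideal R" using inverse_max_ideal A_F[OF y_A] by blast
  then have v: "v \<in> units"
    unfolding v_def by (intro units_add_max_ideal units_1 max_ideal_power pp)
  define u where "u = w * inverse v"
  have u: "u \<in> units" unfolding u_def by (intro units_mult units_inverse v w)
  have yp: "y ^ p = x ^ (p + 1) * u" using eq units_nonzero[OF v] by (simp add: u_def field_simps)
  have e_pow: "\<exists>u\<in>units. e s ^ p = x ^ s * u" if "s \<in> H" for s
  proof
    have "e s ^ p = x ^ (p * xexp s) * (y ^ p) ^ (s mod p)"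
      by (simp add: e_def power_mult_distrib mult.commute flip: power_mult)
    also have "\<dots> = x ^ (p * xexp s + (p + 1) * (s mod p)) * u ^ (s mod p)"
      by (simp only: yp power_mult_distrib power_add power_mult mult.assoc)
    finally show "e s ^ p = x ^ s * u ^ (s mod p)" using H_wt[OF that] by simp
    show "u ^ (s mod p) \<in> units" using units_power_int[OF u, of "int (s mod p)"] by simp
  qed
  \<comment> \<open>Passing to \<open>p\<close>-th powers avoids a root of \<open>u\<close>;
    \<open>power_max_ideal_imp\<close> returns to the quotient itself.\<close>
  have quot: "e s / e s' \<in> max_ideal R" if s: "s \<in> H" "s' \<in> H" "s < s'" for s s'
  proof (rule power_max_ideal_imp)
    show "e s / e s' \<in> F" unfolding divide_inverse by (intro F_mult F_inverse e_F)
    obtain u1 u2 where u12: "u1 \<in> units" "e s ^ p = x ^ s * u1" "u2 \<in> units" "e s' ^ p = x ^ s' * u2"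
      using e_pow s by blast
    have "(e s / e s') ^ p = inverse x ^ (s' - s) * (u1 * inverse u2)"
      using s(3) x_nonzero by (simp add: power_divide u12 power_diff field_simps)
    also have "\<dots> \<in> max_ideal R"
      using s(3) u12 by (intro max_ideal_mult max_ideal_power ix units_R units_mult units_inverse) auto
    finally show "(e s / e s') ^ p \<in> max_ideal R" .
  qed
  have low: "b / e s \<in> max_ideal R" if s: "s \<in> H" and b: "b \<in> B s" for s b
  proof -
    have "V.subspace {b. b / e s \<in> max_ideal R}"
      unfolding V.subspace_def
      using zero_max_ideal max_ideal_add max_ideal_mult[OF _ R_\<iota>]
      by (auto simp: add_divide_distrib) (metis mult.commute times_divide_eq_left)
    then have "B s \<subseteq> {b. b / e s \<in> max_ideal R}"
      unfolding B_def by (rule V.span_minimal[rotated]) (use quot s in auto)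
    then show ?thesis using b by blast
  qed
  have lead: "b / e (ord b) \<in> units \<and> ord b \<in> H" if b: "b \<in> A" "b \<noteq> 0" for b
  proof -
    obtain c where c: "c \<noteq> 0" "b - \<iota> c * e (ord b) \<in> B (ord b)" "ord b \<in> H"
      by (rule ord_lead[OF b])
    have "\<iota> c + (b - \<iota> c * e (ord b)) / e (ord b) \<in> units"
      by (rule units_add_max_ideal[OF \<iota>_units[OF c(1)] low[OF c(3,2)]])
    moreover have "\<iota> c + (b - \<iota> c * e (ord b)) / e (ord b) = b / e (ord b)"
      using ord_e(1)[OF c(3)] by (simp add: field_simps)
    ultimately show ?thesis using c by simp
  qed
  have "Pinf \<subseteq> R"
  proof
    fix z assume "z \<in> Pinf"
    then obtain a b where ab: "z = a / b" "b \<in> A" "b \<noteq> 0" "a \<in> B (Suc (ord b))"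
      unfolding Pinf_def by blast
    show "z \<in> R"
    proof (cases "a = 0")
      case True
      then show ?thesis using ab R_0 by simp
    next
      case False
      have a: "a \<in> A" using ab B_A by blast
      have la: "a / e (ord a) \<in> units" "ord a \<in> H" and lb: "b / e (ord b) \<in> units" "ord b \<in> H"
        using lead a False ab(2,3) by blast+
      have "ord a \<le> ord b" using B_iff[OF a False] ab(4) by simp
      then have "e (ord a) / e (ord b) \<in> R"
        using quot[OF la(2) lb(2)] max_ideal_R R_1 ord_e(1)[OF lb(2)] by (cases "ord a = ord b") auto
      then have "(a / e (ord a)) * (e (ord a) / e (ord b)) * inverse (b / e (ord b)) \<in> R"
        using units_R[OF la(1)] units_R[OF units_inverse[OF lb(1)]] by (intro R_mult)
      also have "(a / e (ord a)) * (e (ord a) / e (ord b)) * inverse (b / e (ord b)) = z"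
        using ab(1) ord_e(1)[OF la(2)] ord_e(1)[OF lb(2)] by simp
      finally show ?thesis .
    qed
  qed
  then show ?thesis by (rule infty.maximal[OF R])
qed

end

subsection \<open>Affine places\<close>

text \<open>Congruent elements define the same predicate, so Hilbert choice picks the same
  representative for them.\<close>

lemma (in field_over) transversal_subset:
  assumes W: "V.subspace W" and Z: "finite Z" "Z \<subseteq> U" and cover: "\<And>z. z \<in> U \<Longrightarrow> \<exists>t\<in>Z. z - t \<in> W"
  shows "\<exists>T\<subseteq>Z. transversal W U T"
proof -
  define r where "r z = (SOME t. t \<in> Z \<and> z - t \<in> W)" for z
  have r: "r z \<in> Z \<and> z - r z \<in> W" if "z \<in> U" for z
    unfolding r_def by (rule someI_ex) (use cover[OF that] in blast)
  have r_cong: "r z = r w" if "z - w \<in> W" for z w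
  proof -
    have "z - t \<in> W \<longleftrightarrow> w - t \<in> W" for t
    proof
      assume "z - t \<in> W"
      from V.subspace_diff[OF W this that] show "w - t \<in> W"
        by simp
    next
      assume "w - t \<in> W"
      from V.subspace_add[OF W this that] show "z - t \<in> W"
        by simp
    qed
    then show ?thesis unfolding r_def by simp
  qed
  have "transversal W U (r ` Z)"
    unfolding transversal_def
  proof (intro conjI ballI ex_ex1I)
    fix z assume z: "z \<in> U"
    have "r z = r (r z)" by (rule r_cong) (use r[OF z] in blast)
    then have "r z \<in> r ` Z" using r[OF z] by (metis imageI)
    then show "\<exists>t. t \<in> r ` Z \<and> z - t \<in> W" using r[OF z] by blast
  next
    fix z t t' assume z: "z \<in> U" and *: "t \<in> r ` Z \<and> z - t \<in> W" "t' \<in> r ` Z \<and> z - t' \<in> W"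
    have fix_r: "t = r z" if t: "t \<in> r ` Z" "z - t \<in> W" for t
    proof -
      obtain s where s: "s \<in> Z" "t = r s"
        using t by blast
      have "t = r t" unfolding s(2) by (rule r_cong) (use r[of s] s Z in blast)
      also have "\<dots> = r z" using r_cong[OF t(2)] by simp
      finally show ?thesis .
    qed
    show "t = t'" using fix_r[of t] fix_r[of t'] * by simp
  next
    show "r ` Z \<subseteq> U" "finite (r ` Z)" using Z r by auto
  qed
  moreover have "r ` Z \<subseteq> Z" using Z r by auto
  ultimately show ?thesis by blast
qed

context curve
begin

section \<open>Frobenius and division modulo x^Q - x\<close>

definition q :: nat where
  "q = CARD('k)"

lemma q_exp: "q = 2 ^ (4 * n)" and q_pow_exp: "q ^ N = 2 ^ (4 * n * N)"
  by (simp_all add: q_def card_k_exp power_mult)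

lemma q_p_exp: "q ^ N = p ^ (4 * N)"
  by (simp add: q_def card_k power_mult)

lemma q_ge_2: "q \<ge> 2"
  using card_k_gt_1 by (simp add: q_def)

text \<open>Splits two factors \<open>a\<close> off a^(q^(2M)): then a^k serves as an inverse in
  residue fields, and a^2 in an ideal forces the whole power into it.\<close>

lemma frobenius_exp:
  assumes "M \<ge> 1"
  shows "\<exists>k. q ^ (2 * M) = Suc (Suc k)"
proof -
  have "q ^ 1 \<le> q ^ (2 * M)" using q_ge_2 assms by (intro power_increasing) auto
  then have "q ^ (2 * M) = Suc (Suc (q ^ (2 * M) - 2))" using q_ge_2 by simp
  then show ?thesis ..
qed

text \<open>The product of all x - c with \<open>c\<close> in the field with q^N elements.\<close>

definition h :: "nat \<Rightarrow> 'l" where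
  "h N = x ^ q ^ N - x"

lemma h_A: "h N \<in> A"
  unfolding h_def by (intro A_diff coord.R_power x_A)

lemma h_ord:
  assumes "N \<ge> 1"
  shows "h N \<noteq> 0" and "ord (h N) = p * q ^ N"
proof -
  have e: "e (p * q ^ N) = x ^ q ^ N" "p * q ^ N \<in> H"
    using wt_H[of 0 "q ^ N"] p_ge_2 by simp_all
  have "q ^ 1 \<le> q ^ N" using assms q_ge_2 by (intro power_increasing) auto
  then have "p < p * q ^ N" using q_ge_2 p_ge_2 by simp
  then have "x \<in> B (p * q ^ N)" by (simp add: B_iff x_A x_nonzero ord_x)
  then have "h N - \<iota> 1 * e (p * q ^ N) \<in> B (p * q ^ N)"
    using B_neg by (simp add: h_def e \<iota>_1)
  then show "h N \<noteq> 0" "ord (h N) = p * q ^ N"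
    using ord_eqI[of 1 "h N" "p * q ^ N"] e by simp_all
qed

definition h_ideal :: "nat \<Rightarrow> 'l set" where
  "h_ideal N = {h N * c | c. c \<in> A}"

lemma h_idealI: "c \<in> A \<Longrightarrow> h N * c \<in> h_ideal N"
  by (auto simp: h_ideal_def)

lemma h_ideal_A: "a \<in> h_ideal N \<Longrightarrow> a \<in> A"
  by (auto simp: h_ideal_def intro: A_mult h_A)

lemma h_ideal_add: "a \<in> h_ideal N \<Longrightarrow> b \<in> h_ideal N \<Longrightarrow> a + b \<in> h_ideal N"
  unfolding h_ideal_def by clarify (metis coord.R_add distrib_left)

lemma h_ideal_minus: "a \<in> h_ideal N \<Longrightarrow> - a \<in> h_ideal N"
  unfolding h_ideal_def by clarify (metis coord.R_minus mult_minus_right)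

lemma h_ideal_diff: "a \<in> h_ideal N \<Longrightarrow> b \<in> h_ideal N \<Longrightarrow> a - b \<in> h_ideal N"
  using h_ideal_add[OF _ h_ideal_minus] by simp

lemma h_ideal_mult: "a \<in> h_ideal N \<Longrightarrow> b \<in> A \<Longrightarrow> a * b \<in> h_ideal N"
  unfolding h_ideal_def by clarify (metis A_mult mult.assoc)

lemma diff_power2: "(a - b) ^ (2 ^ m) = a ^ (2 ^ m) - (b::'l) ^ (2 ^ m)"
  by (simp add: char2_diff[OF two] char2_add_power[OF two])

text \<open>A power of \<open>q\<close> acts as a ring homomorphism fixing the constants, so a
  congruence for it need be checked on \<open>x\<close> and \<open>y\<close> only.\<close>

lemma frobenius_fixed_subring:
  assumes "K = q ^ M"
  shows "subring_over \<iota> UNIV {a \<in> A. a ^ K - a \<in> h_ideal N}"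
proof
  have K: "K = 2 ^ (4 * n * M)" using assms q_pow_exp by simp
  have "\<iota> c ^ K = \<iota> c" for c
    using finite_field_power_card_power[of c M] by (simp add: assms q_def flip: \<iota>_power)
  moreover have "0 \<in> h_ideal N" using h_idealI[OF A_0] by simp
  ultimately show "range \<iota> \<subseteq> {a \<in> A. a ^ K - a \<in> h_ideal N}"
    using A_\<iota> by auto
  fix a b assume ab: "a \<in> {a \<in> A. a ^ K - a \<in> h_ideal N}" "b \<in> {a \<in> A. a ^ K - a \<in> h_ideal N}"
  have "(a - b) ^ K - (a - b) = (a ^ K - a) - (b ^ K - b)" by (simp add: K diff_power2)
  also have "\<dots> \<in> h_ideal N" using h_ideal_diff ab by blast
  finally show "a - b \<in> {a \<in> A. a ^ K - a \<in> h_ideal N}" using ab A_diff by blast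
  have "(a * b) ^ K - a * b = (b ^ K - b) * a ^ K + (a ^ K - a) * b"
    by (simp add: power_mult_distrib algebra_simps)
  also have "\<dots> \<in> h_ideal N"
    using ab by (intro h_ideal_add h_ideal_mult coord.R_power) auto
  finally show "a * b \<in> {a \<in> A. a ^ K - a \<in> h_ideal N}" using ab A_mult by blast
qed (use embedding in auto)

text \<open>Modulo \<open>h N = x\<^sup>Q - x\<close> with \<open>Q = q\<^sup>N\<close> every element of \<open>A\<close> is a fixed point of the \<open>Q\<^sup>2\<close>-th power map:
  \<open>y\<^sup>Q = y + T\<close> for a polynomial \<open>T\<close> in \<open>x\<close>, so \<open>y\<^bsup>Q\<^sup>2\<^esup> = y + 2T\<close>.\<close>

lemma frobenius_mod_h:
  assumes "a \<in> A"
  shows "a ^ q ^ (2 * N) - a \<in> h_ideal N"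
proof -
  define S1 where "S1 = {a \<in> A. a ^ q ^ N - a \<in> h_ideal N}"
  define S2 where "S2 = {a \<in> A. a ^ q ^ (2 * N) - a \<in> h_ideal N}"
  interpret S1: subring_over \<iota> UNIV S1
    unfolding S1_def by (rule frobenius_fixed_subring[OF refl])
  interpret S2: subring_over \<iota> UNIV S2
    unfolding S2_def by (rule frobenius_fixed_subring[OF refl])
  have x1: "x \<in> S1" using h_idealI[OF A_1, of N] x_A by (simp add: S1_def h_def)
  have QQ: "z ^ q ^ (2 * N) = (z ^ q ^ N) ^ q ^ N" for z :: 'l
    by (simp add: mult_2 power_add power_mult)
  have add_pow: "(z + w) ^ q ^ N = z ^ q ^ N + w ^ q ^ N" for z w :: 'l
    unfolding q_pow_exp by (rule char2_add_power[OF two])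
  have x2: "x \<in> S2"
  proof -
    have "x ^ q ^ (2 * N) - x = h N ^ q ^ N + h N"
      unfolding QQ by (simp add: h_def add_pow q_pow_exp diff_power2)
    also have "\<dots> = h N * (h N ^ (q ^ N - 1) + 1)"
      using q_ge_2 by (simp add: distrib_left flip: power_Suc)
    finally show ?thesis
      using h_idealI[of "h N ^ (q ^ N - 1) + 1" N] x_A h_A by (simp add: S2_def coord.R_add coord.R_power A_1)
  qed
  define g where "g = x ^ (p + 1) + \<iota> a0 * x\<^sup>2"
  \<comment> \<open>As q^N = p^(4N), \<open>T\<close> collects the 4N corrections in iterating y^p =
    y + g.\<close>
  define T where "T = (\<Sum>i<4 * N. g ^ p ^ i)"
  have g1: "g \<in> S1" unfolding g_def by (intro S1.R_add S1.R_mult S1.R_power x1 S1.R_\<iota>)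
  have T1: "T \<in> S1" unfolding T_def by (intro S1.R_sum S1.R_power g1)
  have "y ^ p = g - y" using curve_eq by (simp add: g_def eq_diff_eq)
  then have yg: "y ^ p = y + g" by (simp add: char2_diff[OF two] add.commute)
  have "y ^ p ^ j = y + (\<Sum>i<j. g ^ p ^ i)" for j
  proof (induction j)
    case (Suc j)
    have "y ^ p ^ Suc j = (y ^ p) ^ p ^ j" by (simp add: power_mult)
    also have "\<dots> = y ^ p ^ j + g ^ p ^ j"
      unfolding yg using char2_add_power[OF two, of y g "n * j"] by (simp add: p power_mult)
    finally show ?case using Suc by (simp add: add.assoc)
  qed simp
  then have yQ: "y ^ q ^ N = y + T" by (simp add: q_p_exp T_def)
  have "y ^ q ^ (2 * N) - y = T + T ^ q ^ N" unfolding QQ yQ add_pow by simp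
  also have "\<dots> = T ^ q ^ N - T" by (simp add: char2_diff[OF two] add.commute)
  finally have y2: "y \<in> S2" using T1 y_A by (simp add: S1_def S2_def)
  have "a \<in> S2" using assms S2.R_eval2[OF x2 y2] by (auto simp: A_def ev_def)
  then show ?thesis by (simp add: S2_def)
qed

text \<open>Division with remainder by pole order. A term of weight \<open>m\<close> is cancelled by
  a multiple of a * e(m - ord a), which is available once m - ord a is at least p^2, past all gaps.
  The remainders lie in a finite space, so A / a A is finite.\<close>

lemma reduce_mod:
  assumes a: "a \<in> A" "a \<noteq> 0" and "z \<in> A"
  shows "\<exists>b\<in>A. z - a * b \<in> B (ord a + p\<^sup>2)"
proof -
  obtain m where "z \<in> B m"
    using assms(3) by (auto simp: A_B)
  then show ?thesis
  proof (induction m arbitrary: z)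
    case 0
    then have "z - a * 0 \<in> B (ord a + p\<^sup>2)"
      using B_zero by (simp add: B_0)
    then show ?case using A_0 by blast
  next
    case (Suc m)
    show ?case
    proof (cases "Suc m \<le> ord a + p\<^sup>2")
      case True
      then have "z - a * 0 \<in> B (ord a + p\<^sup>2)" using B_mono'[OF Suc.prems] by simp
      then show ?thesis using A_0 by blast
    next
      case False
      define s where "s = m - ord a"
      have s: "m = ord a + s" "s \<in> H" using False H_large by (auto simp: s_def)
      have es: "e s \<in> A" "e s \<noteq> 0" "ord (e s) = s"
        using ord_eqI[of 1 "e s" s] s B_zero by (simp_all add: \<iota>_1)
      obtain c where c: "z - \<iota> c * e m \<in> B m"
        using B_Suc[OF Suc.prems] by blast
      have "ord (a * e s) = m" using ord_mult[OF a es(1,2)] es(3) s(1) by simp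
      then obtain d where d: "d \<noteq> 0" "a * e s - \<iota> d * e m \<in> B m"
        using ord_lead[of "a * e s"] a es A_mult by (metis mult_eq_0_iff)
      have "(z - \<iota> c * e m) - \<iota> (c / d) * (a * e s - \<iota> d * e m) \<in> B m"
        by (intro B_diff B_scale c d)
      also have "(z - \<iota> c * e m) - \<iota> (c / d) * (a * e s - \<iota> d * e m) = z - a * (\<iota> (c / d) * e s)"
      proof -
        have "\<iota> (c / d) * \<iota> d = \<iota> c" using d(1) by (simp flip: \<iota>_mult)
        then show ?thesis by (simp add: right_diff_distrib mult.left_commute[of a] flip: mult.assoc)
      qed
      finally obtain b where b: "b \<in> A" "z - a * (\<iota> (c / d) * e s) - a * b \<in> B (ord a + p\<^sup>2)"
        using Suc.IH by blast
      moreover have "z - a * (\<iota> (c / d) * e s) - a * b = z - a * (\<iota> (c / d) * e s + b)"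
        by (simp add: distrib_left)
      moreover have "\<iota> (c / d) * e s + b \<in> A" by (intro coord.R_add A_mult A_\<iota> es b)
      ultimately show ?thesis by metis
    qed
  qed
qed

text \<open>Since \<open>A / a A\<close> is finite, \<open>a\<close> divides some \<open>x\<^sup>j - x\<^sup>i = x\<^sup>i (x\<^sup>r - 1)\<^bsup>2^v\<^esup>\<close> with \<open>r\<close> odd, and \<open>x\<^sup>r - 1\<close>
  divides \<open>x\<^bsup>q^N-1\<^esup> - 1\<close> for \<open>N = \<phi>(r)\<close>.\<close>

lemma divides_h_power:
  assumes a: "a \<in> A" "a \<noteq> 0"
  shows "\<exists>N M. \<exists>b\<in>A. N \<ge> 1 \<and> a * b = h N ^ M"
proof -
  have "\<exists>b. b \<in> A \<and> x ^ i - a * b \<in> B (ord a + p\<^sup>2)" for i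
    using reduce_mod[OF a, of "x ^ i"] coord.R_power[OF x_A] by blast
  then obtain b where b: "\<And>i. b i \<in> A" "\<And>i. x ^ i - a * b i \<in> B (ord a + p\<^sup>2)"
    by metis
  \<comment> \<open>Infinitely many exponents but finitely many remainders: two powers of
    \<open>x\<close> agree modulo \<open>a\<close>.\<close>
  have "finite (range (\<lambda>i. x ^ i - a * b i))"
    using b(2) by (intro finite_subset[OF _ finite_B]) blast
  then have "\<not> inj (\<lambda>i. x ^ i - a * b i)"
    using finite_imageD infinite_UNIV_nat by blast
  then obtain i' j' where ij': "i' \<noteq> j'" "x ^ i' - a * b i' = x ^ j' - a * b j'"
    by (auto simp: inj_def)
  then obtain i j where ij: "i < j" "x ^ i - a * b i = x ^ j - a * b j" by (metis linorder_neqE_nat)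
  define b1 where "b1 = b j - b i"
  have b1: "b1 \<in> A" "a * b1 = x ^ j - x ^ i"
    using b ij(2) by (auto simp: b1_def right_diff_distrib algebra_simps intro: A_diff)
  define v where "v = multiplicity 2 (j - i)"
  obtain r where vr: "j - i = 2 ^ v * r" "odd r"
    unfolding v_def by (rule multiplicity_decompose'[of "j - i" 2]) (use ij(1) in auto)
  have r: "r > 0" using vr(2) by (cases r) auto
  have "coprime q r" using vr(2) by (simp add: q_exp)
  define N where "N = totient r"
  have N: "N \<ge> 1" using r by (simp add: N_def Suc_le_eq)
  have "[q ^ N = 1] (mod r)"
    unfolding N_def using \<open>coprime q r\<close> by (rule euler_theorem)
  then have "r dvd q ^ N - 1" using q_ge_2 by (simp add: cong_altdef_nat)
  then obtain t where t: "q ^ N - 1 = r * t" by blast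
  define s where "s = x ^ r - 1"
  define c where "c = (\<Sum>k<t. (x ^ r) ^ k)"
  have sA: "s \<in> A" and cA: "c \<in> A"
    unfolding s_def c_def by (intro A_diff A_1 coord.R_power coord.R_sum x_A)+
  have "s * c = (x ^ r) ^ t - 1" unfolding s_def c_def by (rule power_diff_1_eq[symmetric])
  then have "x * (s * c) = x ^ Suc (q ^ N - 1) - x"
    unfolding power_Suc t power_mult by (simp add: right_diff_distrib)
  moreover have "Suc (q ^ N - 1) = q ^ N" using q_ge_2 by simp
  ultimately have h: "h N = x * (s * c)" by (simp only: h_def)
  have "x ^ j - x ^ i = x ^ i * (x ^ (j - i) - 1)"
    using ij(1) by (simp add: right_diff_distrib flip: power_add)
  also have "x ^ (j - i) - 1 = s ^ 2 ^ v"
    using diff_power2[of "x ^ r" 1 v] by (simp add: s_def vr(1) mult.commute[of _ r] power_mult)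
  finally have ab1: "a * b1 = x ^ i * s ^ 2 ^ v" using b1 by simp
  \<comment> \<open>Large enough for the power of \<open>h N\<close> to absorb both x^i and
    s^(2^v).\<close>
  define M where "M = max i (2 ^ v)"
  have "h N ^ M = x ^ M * s ^ M * c ^ M" by (simp add: h power_mult_distrib mult.assoc)
  also have "x ^ M = x ^ i * x ^ (M - i)" by (simp add: M_def flip: power_add)
  also have "s ^ M = s ^ 2 ^ v * s ^ (M - 2 ^ v)" by (simp add: M_def flip: power_add)
  also have "x ^ i * x ^ (M - i) * (s ^ 2 ^ v * s ^ (M - 2 ^ v)) * c ^ M
      = a * (b1 * x ^ (M - i) * s ^ (M - 2 ^ v) * c ^ M)"
    unfolding mult.assoc[symmetric] ab1 by (simp add: ac_simps)
  finally have "a * (b1 * x ^ (M - i) * s ^ (M - 2 ^ v) * c ^ M) = h N ^ M" by simp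
  moreover have "b1 * x ^ (M - i) * s ^ (M - 2 ^ v) * c ^ M \<in> A"
    by (intro A_mult coord.R_power b1 sA cA x_A)
  ultimately show ?thesis using N by blast
qed

text \<open>The field with q^N elements sits inside the one with q^N' elements. Inductively, the
  next difference is w^(q^N) + \<open>h N\<close>, where \<open>w\<close> is the previous
  one.\<close>

lemma h_dvd: "N dvd N' \<Longrightarrow> h N' \<in> h_ideal N"
proof -
  have "x ^ q ^ (N * t) - x \<in> h_ideal N" for t
  proof (induction t)
    case 0
    then show ?case using h_idealI[OF A_0] by simp
  next
    case (Suc t)
    define w where "w = x ^ q ^ (N * t) - x"
    have "x ^ q ^ (N * Suc t) = (x ^ q ^ (N * t)) ^ q ^ N"
      by (simp add: power_add mult.commute flip: power_mult)
    also have "x ^ q ^ (N * t) = w + x" by (simp add: w_def)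
    also have "(w + x) ^ q ^ N = w ^ q ^ N + x ^ q ^ N"
      unfolding q_pow_exp by (rule char2_add_power[OF two])
    also have "w ^ q ^ N = w * w ^ (q ^ N - 1)" using q_ge_2 by (simp flip: power_Suc)
    finally have "x ^ q ^ (N * Suc t) - x = w * w ^ (q ^ N - 1) + h N * 1" by (simp add: h_def)
    moreover have "w \<in> h_ideal N" using Suc by (simp add: w_def)
    ultimately show ?case
      by (simp only:) (intro h_ideal_add h_ideal_mult h_idealI A_1 coord.R_power h_ideal_A)
  qed
  then show "N dvd N' \<Longrightarrow> h N' \<in> h_ideal N" by (auto simp: h_def)
qed

end

text \<open>The local ring at such a prime is shown to be discrete with uniformizer
  \<open>h N\<close>, the Frobenius congruence standing in for a Jacobian criterion.\<close>

locale affine_prime = curve n p k_type \<iota> x y a0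
  for n p and k_type :: "'k::{field,finite} itself" and \<iota> :: "'k \<Rightarrow> 'l::field" and x y a0 +
  fixes I :: "'l set" and N :: nat
  assumes I_A: "I \<subseteq> A" and I_diff: "a \<in> I \<Longrightarrow> b \<in> I \<Longrightarrow> a - b \<in> I"
    and I_mult: "a \<in> I \<Longrightarrow> b \<in> A \<Longrightarrow> a * b \<in> I" and one_notin_I: "1 \<notin> I"
    and I_prime: "a \<in> A \<Longrightarrow> b \<in> A \<Longrightarrow> a * b \<in> I \<Longrightarrow> a \<in> I \<or> b \<in> I"
    and h_I: "h N \<in> I" and N: "N \<ge> 1"
begin

lemma notin_I_mult: "a \<in> A - I \<Longrightarrow> b \<in> A - I \<Longrightarrow> a * b \<in> A - I"
  using A_mult I_prime by blast

lemma zero_I: "0 \<in> I"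
  using I_diff[OF h_I h_I] by simp

lemma notin_I_nonzero: "s \<in> A - I \<Longrightarrow> s \<noteq> 0"
  using zero_I by blast

lemma one_AI: "1 \<in> A - I"
  using A_1 one_notin_I by blast

lemma notin_I_power: "s \<in> A - I \<Longrightarrow> s ^ m \<in> A - I"
  by (induction m) (auto simp: one_AI[simplified] notin_I_mult[simplified])

lemma I_minus: "a \<in> I \<Longrightarrow> - a \<in> I"
  using I_diff[OF zero_I] by simp

lemma I_add: "a \<in> I \<Longrightarrow> b \<in> I \<Longrightarrow> a + b \<in> I"
  using I_diff[OF _ I_minus, of a b] by simp

lemma I_sum: "(\<And>i. i \<in> S \<Longrightarrow> f i \<in> I) \<Longrightarrow> sum f S \<in> I"
  by (induction S rule: infinite_finite_induct) (auto intro: zero_I I_add)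

lemma notin_I_prod: "(\<And>i. i \<in> S \<Longrightarrow> f i \<in> A - I) \<Longrightarrow> prod f S \<in> A - I"
  by (induction S rule: infinite_finite_induct) (simp_all add: one_AI[simplified] notin_I_mult[simplified])

lemma h_ideal_I: "a \<in> h_ideal N \<Longrightarrow> a \<in> I"
  using I_mult[OF h_I] by (auto simp: h_ideal_def)

text \<open>With K = q^(2M), the cofactor s = 1 - a^(K-1) is 1 modulo \<open>I\<close>, and a s =
  -(a^K - a) is a multiple of \<open>h M\<close>. The index \<open>M\<close> may differ from
  \<open>N\<close>, which \<open>bounded_order\<close> exploits.\<close>

lemma h_generates_locally:
  assumes a: "a \<in> I" and M: "M \<ge> 1"
  shows "\<exists>s\<in>A - I. a * s \<in> h_ideal M"
proof -
  obtain k where k: "q ^ (2 * M) = Suc (Suc k)"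
    using frobenius_exp[OF M] by blast
  have aA: "a \<in> A" using a I_A by blast
  have "a * a ^ k \<in> I" by (intro I_mult a coord.R_power aA)
  then have "1 - a * a ^ k \<notin> I"
    using I_add[of "1 - a * a ^ k" "a * a ^ k"] one_notin_I by auto
  moreover have "1 - a * a ^ k \<in> A" by (intro A_diff A_1 A_mult coord.R_power aA)
  moreover have "a * (1 - a * a ^ k) = - (a ^ q ^ (2 * M) - a)" by (simp add: k right_diff_distrib)
  then have "a * (1 - a * a ^ k) \<in> h_ideal M"
    using h_ideal_minus[OF frobenius_mod_h[OF aA, of M]] by (simp only:)
  ultimately show ?thesis by blast
qed

text \<open>Some power of \<open>h N1\<close> is a multiple of \<open>a\<close>, but
  \<open>N1\<close> is unrelated to \<open>N\<close>. Both \<open>h N\<close> and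
  \<open>h N1\<close> divide \<open>h (N * N1)\<close>; as the latter generates locally, its
  cofactor over \<open>h N\<close> lies outside \<open>I\<close> and can go into
  \<open>s\<close>.\<close>

lemma bounded_order:
  assumes a: "a \<in> A" "a \<noteq> 0"
  shows "\<exists>M. \<exists>b\<in>A. \<exists>s\<in>A - I. a * b = h N ^ M * s"
proof -
  obtain N1 M b0 where 1: "N1 \<ge> 1" "b0 \<in> A" "a * b0 = h N1 ^ M"
    using divides_h_power[OF a] by blast
  obtain c1 where c1: "c1 \<in> A" "h (N * N1) = h N1 * c1"
    using h_dvd[of N1 "N * N1"] by (auto simp: h_ideal_def)
  obtain c where c: "c \<in> A" "h (N * N1) = h N * c"
    using h_dvd[of N "N * N1"] by (auto simp: h_ideal_def)
  obtain s d where s: "s \<in> A - I" "d \<in> A" "h N * s = h (N * N1) * d"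
    using h_generates_locally[OF h_I, of "N * N1"] N 1(1) by (auto simp: h_ideal_def)
  have "h N * s = h N * (c * d)" using s(3) by (simp add: c(2) mult.assoc)
  then have "s = c * d" using h_ord(1)[OF N] by simp
  then have "c \<notin> I" using I_mult[OF _ s(2)] s(1) by blast
  then have "c ^ M \<in> A - I" using c(1) by (intro notin_I_power) blast
  moreover have "a * (b0 * c1 ^ M) = h N ^ M * c ^ M"
    by (simp add: 1(3) power_mult_distrib flip: mult.assoc c1(2) c(2))
      (simp flip: power_mult_distrib add: c1(2)[symmetric] c(2)[symmetric])
  ultimately show ?thesis using A_mult[OF 1(2) coord.R_power[OF c1(1)]] by blast
qed

text \<open>Take the largest \<open>m\<close> for which the \<open>m\<close>-th power of
  \<open>h N\<close> divides some s a with \<open>s\<close> outside \<open>I\<close>;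
  \<open>bounded_order\<close> bounds it. Were the cofactor in \<open>I\<close>, local generation
  would split off another \<open>h N\<close>.\<close>

lemma local_decomp:
  assumes a: "a \<in> A" "a \<noteq> 0"
  shows "\<exists>m. \<exists>b\<in>A - I. \<exists>s\<in>A - I. s * a = h N ^ m * b"
proof -
  define S where "S = {m. \<exists>b\<in>A. \<exists>s\<in>A - I. s * a = h N ^ m * b}"
  obtain M b1 s1 where M: "b1 \<in> A" "s1 \<in> A - I" "a * b1 = h N ^ M * s1"
    using bounded_order[OF a] by blast
  have bound: "m \<le> M" if "m \<in> S" for m
  proof (rule ccontr)
    assume "\<not> m \<le> M"
    then obtain k where k: "m = M + Suc k" by (metis add_Suc_right less_imp_Suc_add not_le)
    obtain b s where bs: "b \<in> A" "s \<in> A - I" "s * a = h N ^ m * b"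
      using \<open>m \<in> S\<close> by (auto simp: S_def)
    have "h N ^ M * (s * s1) = s * (a * b1)" by (simp add: M(3) ac_simps)
    also have "\<dots> = h N ^ m * b * b1" using bs(3) by (simp flip: mult.assoc)
    also have "\<dots> = h N ^ M * (h N * (h N ^ k * b * b1))" by (simp add: k power_add ac_simps)
    finally have "s * s1 = h N * (h N ^ k * b * b1)" using h_ord(1)[OF N] by simp
    moreover have "h N * (h N ^ k * b * b1) \<in> I"
      by (intro I_mult h_I A_mult coord.R_power h_A bs M)
    ultimately show False using notin_I_mult[OF bs(2) M(2)] by simp
  qed
  have "1 * a = h N ^ 0 * a" by simp
  then have "0 \<in> S" unfolding S_def using a(1) one_AI by blast
  moreover have "finite S" using bound by (meson finite_nat_set_iff_bounded_le)
  ultimately have "Max S \<in> S" and max: "\<And>m. m \<in> S \<Longrightarrow> m \<le> Max S"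
    by (auto intro: Max_in)
  then obtain b s where bs: "b \<in> A" "s \<in> A - I" "s * a = h N ^ Max S * b"
    by (auto simp: S_def)
  have "b \<notin> I"
  proof
    assume "b \<in> I"
    then obtain s' d where s': "s' \<in> A - I" "d \<in> A" "b * s' = h N * d"
      using h_generates_locally[OF \<open>b \<in> I\<close> N] unfolding h_ideal_def by blast
    have "(s' * s) * a = h N ^ Max S * (b * s')" using bs(3) by (simp add: ac_simps)
    also have "\<dots> = h N ^ Suc (Max S) * d" by (simp add: s'(3) ac_simps)
    finally have "Suc (Max S) \<in> S"
      unfolding S_def using notin_I_mult[OF s'(1) bs(2)] s'(2) by blast
    then show False using max by fastforce
  qed
  then show ?thesis using bs by blast
qed

section \<open>The local ring at a prime over \<open>h N\<close>\<close>

definition R :: "'l set" where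
  "R = {a / s | a s. a \<in> A \<and> s \<in> A - I}"

lemma R_iff:
  assumes "a \<in> A" and "s \<in> A - I"
  shows "a / s \<in> R" using assms by (auto simp: R_def)

lemma A_R: "a \<in> A \<Longrightarrow> a \<in> R"
  using R_iff[OF _ one_AI, of a] by simp

lemma inverse_R: "s \<in> A - I \<Longrightarrow> inverse s \<in> R"
  using R_iff[OF A_1, of s] by (simp add: inverse_eq_divide)

lemma inverse_in_R_iff:
  assumes "a \<in> A" and "a \<noteq> 0"
  shows "inverse a \<in> R \<longleftrightarrow> a \<notin> I"
proof
  assume "inverse a \<in> R"
  then obtain b s where bs: "inverse a = b / s" "b \<in> A" "s \<in> A - I" by (auto simp: R_def)
  then have "s = a * b" using assms(2) notin_I_nonzero[OF bs(3)] by (simp add: field_simps)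
  then show "a \<notin> I" using bs I_mult by blast
qed (use assms in \<open>simp add: inverse_R\<close>)

sublocale loc: discrete_place \<iota> F R "h N"
proof -
  interpret subring_over \<iota> F R
  proof
    show "range \<iota> \<subseteq> R" using A_R A_\<iota> by blast
    show "R \<subseteq> F" unfolding R_def F_eq using notin_I_nonzero by blast
    fix z w assume "z \<in> R" "w \<in> R"
    then obtain a s b t where *: "z = a / s" "a \<in> A" "s \<in> A - I" "w = b / t" "b \<in> A" "t \<in> A - I"
      by (auto simp: R_def)
    have "s \<noteq> 0" "t \<noteq> 0" using * notin_I_nonzero by blast+
    then have "z - w = (a * t - b * s) / (s * t)" "z * w = (a * b) / (s * t)"
      using * by (simp_all add: diff_frac_eq mult.commute)
    moreover have "a * t - b * s \<in> A" "a * b \<in> A" "s * t \<in> A - I"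
      using * by (auto intro!: A_diff A_mult notin_I_mult[simplified])
    ultimately show "z - w \<in> R" "z * w \<in> R" using R_iff by metis+
  qed
  have unit: "a / s \<in> units" if "a \<in> A - I" "s \<in> A - I" for a s
    using that R_iff[of a s] R_iff[of s a] notin_I_nonzero[of a] notin_I_nonzero[of s]
    by (simp add: units_def)
  show "discrete_place \<iota> F R (h N)"
  proof
    show "h N \<in> R" by (rule A_R[OF h_A])
    show "h N \<noteq> 0" by (rule h_ord(1)[OF N])
    show "inverse (h N) \<notin> R" using inverse_in_R_iff[OF h_A h_ord(1)[OF N]] h_I by blast
  next
    fix z assume z: "z \<in> F" "z \<noteq> 0"
    then obtain a b where ab: "z = a / b" "a \<in> A" "b \<in> A" "a \<noteq> 0" "b \<noteq> 0"
      by (rule nonzero_decomp)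
    obtain m u s where 1: "u \<in> A - I" "s \<in> A - I" "s * a = h N ^ m * u"
      using local_decomp[OF ab(2,4)] by blast
    obtain m' u' s' where 2: "u' \<in> A - I" "s' \<in> A - I" "s' * b = h N ^ m' * u'"
      using local_decomp[OF ab(3,5)] by blast
    note nz = notin_I_nonzero[OF 1(1)] notin_I_nonzero[OF 1(2)] notin_I_nonzero[OF 2(1)]
      notin_I_nonzero[OF 2(2)] h_ord(1)[OF N]
    have a: "a = h N ^ m * u / s" and b: "b = h N ^ m' * u' / s'"
      using 1(3) 2(3) nz by (simp_all add: field_simps)
    have "z = (u * s') / (s * u') * h N powi (int m - int m')"
      unfolding ab(1) a b using nz by (simp add: power_int_diff ac_simps)
    moreover have "(u * s') / (s * u') \<in> units" using 1 2 by (intro unit notin_I_mult)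
    ultimately show "\<exists>m::int. \<exists>u\<in>units. z = u * h N powi m" by blast
  qed
qed

lemma max_ideal_iff:
  assumes "a \<in> A" and "s \<in> A - I"
  shows "a / s \<in> max_ideal R \<longleftrightarrow> a \<in> I"
proof (cases "a = 0")
  case True
  then show ?thesis using zero_I loc.R_0 by (simp add: max_ideal_def)
next
  case False
  have s: "s \<noteq> 0"
    using notin_I_nonzero[OF assms(2)] .
  have "inverse (a / s) \<in> R \<longleftrightarrow> inverse a \<in> R"
  proof
    assume "inverse (a / s) \<in> R"
    then have "inverse (a / s) * inverse s \<in> R"
      using inverse_R[OF assms(2)] by (rule loc.R_mult)
    then show "inverse a \<in> R" using s by (simp add: field_simps)
  next
    assume "inverse a \<in> R"
    then have "inverse a * s \<in> R" using A_R assms(2) by (intro loc.R_mult) auto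
    then show "inverse (a / s) \<in> R" by (simp add: field_simps)
  qed
  then show ?thesis
    using False R_iff[OF assms] inverse_in_R_iff[OF assms(1) False] s by (simp add: max_ideal_def)
qed

lemma A_max_ideal: "a \<in> A \<Longrightarrow> a \<in> max_ideal R \<longleftrightarrow> a \<in> I"
  using max_ideal_iff[OF _ one_AI, of a] by simp

text \<open>In \<open>A / I\<close> the inverse of \<open>s\<close> is a power of \<open>s\<close>.\<close>

lemma A_covers_residues:
  assumes "z \<in> R"
  shows "\<exists>a\<in>A. z - a \<in> max_ideal R"
proof -
  obtain a s where as: "z = a / s" "a \<in> A" "s \<in> A - I"
    using assms by (auto simp: R_def)
  obtain k where k: "q ^ (2 * N) = Suc (Suc k)"
    using frobenius_exp[OF N] by blast
  have "s * (s * s ^ k - 1) \<in> I"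
    using h_ideal_I[OF frobenius_mod_h[of s N]] as by (simp add: k right_diff_distrib)
  then have "s * s ^ k - 1 \<in> I"
    using I_prime[of s "s * s ^ k - 1"] as by (auto intro: A_diff A_mult A_1 coord.R_power)
  then have "- (s * s ^ k - 1) * a \<in> I" by (intro I_mult I_minus as)
  then have "(- (s * s ^ k - 1) * a) / s \<in> max_ideal R"
    using as I_A by (subst max_ideal_iff) auto
  moreover have "(- (s * s ^ k - 1) * a) / s = z - a * s ^ k"
    using notin_I_nonzero[OF as(3)] as(1) by (simp add: field_simps)
  moreover have "a * s ^ k \<in> A" using as by (auto intro: A_mult coord.R_power)
  ultimately show ?thesis by metis
qed

text \<open>Residues come from \<open>A\<close>, and modulo \<open>h N\<close> every element of
  \<open>A\<close> is congruent to one of a finite space.\<close>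

lemma ex_transversal_A: "\<exists>T\<subseteq>A. transversal (max_ideal R) R T"
proof -
  let ?Z = "B (ord (h N) + p\<^sup>2)"
  have "\<exists>t\<in>?Z. z - t \<in> max_ideal R" if z: "z \<in> R" for z
  proof -
    obtain a where a: "a \<in> A" "z - a \<in> max_ideal R"
      using A_covers_residues[OF z] by blast
    obtain b where b: "b \<in> A" "a - h N * b \<in> ?Z"
      using reduce_mod[OF h_A h_ord(1)[OF N] a(1)] by blast
    have "h N * b \<in> max_ideal R"
      using A_max_ideal[of "h N * b"] I_mult[OF h_I b(1)] I_A by blast
    from V.subspace_add[OF loc.subspace_max_ideal a(2) this]
    have "z - (a - h N * b) \<in> max_ideal R" by (simp add: algebra_simps)
    then show ?thesis using b(2) by blast
  qed
  moreover have "?Z \<subseteq> R" using B_A A_R by blast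
  ultimately obtain T where "T \<subseteq> ?Z" "transversal (max_ideal R) R T"
    using transversal_subset[OF loc.subspace_max_ideal finite_B, of "ord (h N) + p\<^sup>2" R] by metis
  then show ?thesis using B_A by blast
qed

end

context curve
begin

text \<open>An element of \<open>F\<close> outside \<open>R\<close> has its denominator in the
  maximal ideal, and this denominator divides a power of some \<open>h N\<close>. The local ring at
  the resulting prime is contained in \<open>R\<close>, and discrete places are maximal.\<close>

lemma affine_place_prime:
  assumes R: "R \<in> places \<iota> F" and x: "x \<in> R"
  shows "A \<subseteq> R" and "\<exists>N\<ge>1. h N \<in> max_ideal R"
    and "N \<ge> 1 \<Longrightarrow> h N \<in> max_ideal R \<Longrightarrow> affine_prime n p \<iota> x y a0 (A \<inter> max_ideal R) N"
    and "N \<ge> 1 \<Longrightarrow> h N \<in> max_ideal R \<Longrightarrow> R = affine_prime.R \<iota> x y (A \<inter> max_ideal R)"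
proof -
  interpret place_over \<iota> F R
    by (rule place_over[OF R])
  have y: "y \<in> R"
  proof (rule ccontr)
    assume "y \<notin> R"
    then have iy: "inverse y \<in> max_ideal R" using inverse_max_ideal A_F[OF y_A] by blast
    \<comment> \<open>The curve equation divided by y^p; in the end every term has a factor
      1/y.\<close>
    have "1 = (y ^ p + y) * inverse y ^ p - inverse y ^ (p - 1)"
      using y_nonzero p_ge_2 by (simp add: distrib_right power_diff field_simps)
    also have "\<dots> = inverse y ^ p * (x ^ (p + 1) + \<iota> a0 * x\<^sup>2) - inverse y ^ (p - 1)"
      unfolding curve_eq by simp
    also have "\<dots> \<in> max_ideal R"
      using x p_ge_2
      by (intro max_ideal_diff max_ideal_mult max_ideal_power iy R_add R_mult R_power R_\<iota>) auto
    finally show False using one_notin_max_ideal by simp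
  qed
  show AR: "A \<subseteq> R" using R_eval2[OF x y] by (auto simp: A_def ev_def)
  obtain z where z: "z \<in> F" "z \<notin> R"
    using R by (auto simp: places_def)
  then have "z \<noteq> 0" using R_0 by auto
  then obtain a b where ab: "z = a / b" "a \<in> A" "b \<in> A" "a \<noteq> 0" "b \<noteq> 0"
    using nonzero_decomp z by metis
  have b: "b \<in> max_ideal R"
  proof (rule ccontr)
    assume "b \<notin> max_ideal R"
    then have "inverse b \<in> R" using AR ab by (auto simp: max_ideal_def)
    then have "a * inverse b \<in> R" using AR ab by (intro R_mult) auto
    then show False using z ab by (simp add: divide_inverse)
  qed
  obtain N0 M c where N: "N0 \<ge> 1" "c \<in> A" "b * c = h N0 ^ M"
    using divides_h_power[OF ab(3,5)] by blast
  then have "h N0 ^ M \<in> max_ideal R" using max_ideal_mult[OF b, of c] AR by auto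
  then have "h N0 \<in> max_ideal R" by (rule power_max_ideal_imp[OF A_F[OF h_A]])
  then show "\<exists>N\<ge>1. h N \<in> max_ideal R" using N(1) by blast
  assume hN: "N \<ge> 1" "h N \<in> max_ideal R"
  show P: "affine_prime n p \<iota> x y a0 (A \<inter> max_ideal R) N"
  proof unfold_locales
    fix a b assume "a \<in> A" "b \<in> A" "a * b \<in> A \<inter> max_ideal R"
    then show "a \<in> A \<inter> max_ideal R \<or> b \<in> A \<inter> max_ideal R"
      using max_ideal_prime AR by blast
  qed (use hN h_A one_notin_max_ideal AR in \<open>auto intro: max_ideal_diff max_ideal_mult A_diff A_mult\<close>)
  interpret P: affine_prime n p k_type \<iota> x y a0 "A \<inter> max_ideal R" N
    by (rule P)
  have "P.R \<subseteq> R"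
  proof
    fix z assume "z \<in> P.R"
    then obtain a s where as: "z = a / s" "a \<in> A" "s \<in> A - (A \<inter> max_ideal R)"
      by (auto simp: P.R_def)
    then have "inverse s \<in> R" using AR by (auto simp: max_ideal_def)
    then have "a * inverse s \<in> R" using as(2) AR by (intro R_mult) auto
    then show "z \<in> R" by (simp add: as(1) divide_inverse)
  qed
  then show "R = P.R" by (rule P.loc.maximal[OF R])
qed

end

subsection \<open>Integral closedness of the coordinate ring\<close>

context curve
begin

definition Aff :: "'l set set" where
  "Aff = {P \<in> places \<iota> F. x \<in> P}"

definition Zeros :: "nat \<Rightarrow> 'l set set" where
  "Zeros N = {P \<in> Aff. h N \<in> max_ideal P}"

lemma x_notin_Pinf: "x \<notin> Pinf"
proof
  assume "x \<in> Pinf"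
  then have "x / 1 \<in> Pinf" by simp
  then have "x \<in> B (Suc (ord 1))" by (simp only: Pinf_iff[OF x_A A_1 one_neq_zero])
  then show False using p_ge_2 by (simp add: B_iff[OF x_A x_nonzero] ord_x ord_1)
qed

lemma Pinf_notin_Aff: "Pinf \<notin> Aff"
  using x_notin_Pinf by (simp add: Aff_def)

lemma places_eq: "places \<iota> F = insert Pinf Aff"
proof (intro equalityI subsetI)
  fix P assume "P \<in> places \<iota> F"
  then show "P \<in> insert Pinf Aff"
    using infinite_place_unique[of P] by (cases "x \<in> P") (simp_all add: Aff_def)
next
  fix P assume "P \<in> insert Pinf Aff"
  then show "P \<in> places \<iota> F" using infty.is_place by (auto simp: Aff_def)
qed

lemma Aff_place: "P \<in> Aff \<Longrightarrow> P \<in> places \<iota> F"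
  by (simp add: Aff_def)

lemma A_sub_Aff: "P \<in> Aff \<Longrightarrow> A \<subseteq> P"
  using affine_place_prime(1) by (simp add: Aff_def)

lemma Aff_Zeros: "P \<in> Aff \<Longrightarrow> \<exists>N\<ge>1. P \<in> Zeros N"
  using affine_place_prime(2)[of P] by (auto simp: Aff_def Zeros_def)

lemma Zeros_prime:
  assumes "P \<in> Zeros N" and "N \<ge> 1"
  shows "affine_prime n p \<iota> x y a0 (A \<inter> max_ideal P) N"
    and "affine_prime.R \<iota> x y (A \<inter> max_ideal P) = P"
  using affine_place_prime(3,4)[of P N] assms by (auto simp: Aff_def Zeros_def)

lemma Zeros_discrete:
  assumes "P \<in> Zeros N" and "N \<ge> 1"
  shows "discrete_place \<iota> F P (h N)"
proof -
  interpret affine_prime n p k_type \<iota> x y a0 "A \<inter> max_ideal P" N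
    by (rule Zeros_prime[OF assms])
  show ?thesis
    using loc.discrete_place_axioms unfolding Zeros_prime(2)[OF assms] .
qed

lemma Zeros_transversal:
  assumes "P \<in> Zeros N" and "N \<ge> 1"
  shows "\<exists>T\<subseteq>A. transversal (max_ideal P) P T"
proof -
  interpret affine_prime n p k_type \<iota> x y a0 "A \<inter> max_ideal P" N
    by (rule Zeros_prime[OF assms])
  show ?thesis
    using ex_transversal_A unfolding Zeros_prime(2)[OF assms] .
qed

sublocale discrete_places \<iota> F
proof
  fix P assume P: "P \<in> places \<iota> F"
  show "\<exists>t. discrete_place \<iota> F P t"
    using P infty.discrete_place_axioms Aff_Zeros Zeros_discrete unfolding places_eq by blast
  show "\<exists>T. transversal (max_ideal P) P T"
    using P infty.transversal_\<iota>[OF Pinf_residue] Aff_Zeros Zeros_transversal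
    unfolding places_eq by blast
qed

lemma affine_prime_R_Aff:
  assumes "affine_prime n p \<iota> x y a0 I N"
  shows "affine_prime.R \<iota> x y I \<in> Aff"
proof -
  interpret affine_prime n p k_type \<iota> x y a0 I N
    by (rule assms)
  show ?thesis using loc.is_place A_R[OF x_A] by (simp add: Aff_def)
qed

text \<open>An ideal over \<open>h N\<close> that avoids \<open>a\<close> and meets the finite space
  \<open>B m\<close> in the most elements is maximal with this property, without Zorn. For
  \<open>b\<close>, \<open>c\<close> outside it, \<open>a\<close> lies in both enlarged ideals, so b
  c in \<open>J\<close> gives a^2 in \<open>J\<close>; then a = a^K - (a^K - a), with K = q^(2N), is
  in \<open>J\<close> too.\<close>

lemma ex_prime_avoiding:
  assumes N: "N \<ge> 1" and a: "a \<in> A" "a \<notin> h_ideal N"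
  shows "\<exists>I. affine_prime n p \<iota> x y a0 I N \<and> a \<notin> I"
proof -
  define m where "m = ord (h N) + p\<^sup>2"
  define ideals where "ideals = {J. J \<subseteq> A \<and> (\<forall>b\<in>J. \<forall>c\<in>J. b - c \<in> J) \<and> (\<forall>b\<in>J. \<forall>c\<in>A. b * c \<in> J)
    \<and> h_ideal N \<subseteq> J \<and> a \<notin> J}"
  have "h_ideal N \<in> ideals"
    using a h_ideal_A h_ideal_diff h_ideal_mult by (auto simp: ideals_def)
  moreover have "card (J \<inter> B m) \<le> card (B m)" for J
    using finite_B by (intro card_mono) auto
  ultimately have "\<exists>J. J \<in> ideals \<and> (\<forall>J'. J' \<in> ideals \<longrightarrow> card (J' \<inter> B m) \<le> card (J \<inter> B m))"
    by (intro ex_has_greatest_nat[where b = "Suc (card (B m))"]) (auto simp: less_Suc_eq_le)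
  then obtain J where J: "J \<in> ideals" and max: "\<And>J'. J' \<in> ideals \<Longrightarrow> card (J' \<inter> B m) \<le> card (J \<inter> B m)"
    by blast
  have JA: "J \<subseteq> A" and J_diff: "b \<in> J \<Longrightarrow> c \<in> J \<Longrightarrow> b - c \<in> J"
    and J_mult: "b \<in> J \<Longrightarrow> c \<in> A \<Longrightarrow> b * c \<in> J" and hJ: "h_ideal N \<subseteq> J" and aJ: "a \<notin> J" for b c
    using J by (auto simp: ideals_def)
  have J_0: "0 \<in> J" using hJ h_idealI[OF A_0, of N] by auto
  have J_add: "b + c \<in> J" if "b \<in> J" "c \<in> J" for b c
    using J_diff[OF that(1) J_diff[OF J_0 that(2)]] by simp
  have extend: "\<exists>j\<in>J. \<exists>d\<in>A. a = j + b * d" if b: "b \<in> A" "b \<notin> J" for b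
  proof (rule ccontr)
    assume none: "\<not> ?thesis"
    define Jb where "Jb = {j + b * d | j d. j \<in> J \<and> d \<in> A}"
    have JJb: "J \<subseteq> Jb" unfolding Jb_def using A_0 by force
    have bJb: "j + b \<in> Jb" if "j \<in> J" for j unfolding Jb_def using A_1 that by force
    have "Jb \<in> ideals"
      unfolding ideals_def
    proof (intro CollectI conjI ballI)
      show "Jb \<subseteq> A" unfolding Jb_def using JA b by (auto intro: coord.R_add A_mult)
      fix u assume "u \<in> Jb"
      then obtain j d where u: "u = j + b * d" "j \<in> J" "d \<in> A" by (auto simp: Jb_def)
      show "u - v \<in> Jb" if "v \<in> Jb" for v
      proof -
        obtain j' d' where v: "v = j' + b * d'" "j' \<in> J" "d' \<in> A"
          using \<open>v \<in> Jb\<close> by (auto simp: Jb_def)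
        have "u - v = (j - j') + b * (d - d')" by (simp add: u v algebra_simps)
        then show ?thesis unfolding Jb_def using J_diff[OF u(2) v(2)] A_diff[OF u(3) v(3)] by blast
      qed
      show "u * c \<in> Jb" if "c \<in> A" for c
      proof -
        have "u * c = j * c + b * (d * c)" by (simp add: u algebra_simps)
        then show ?thesis unfolding Jb_def using J_mult[OF u(2) that] A_mult[OF u(3) that] by blast
      qed
    next
      show "h_ideal N \<subseteq> Jb" using hJ JJb by blast
      show "a \<notin> Jb" using none by (auto simp: Jb_def)
    qed
    then have le: "card (Jb \<inter> B m) \<le> card (J \<inter> B m)" by (rule max)
    \<comment> \<open>A representative of \<open>b\<close> in \<open>B m\<close> makes the
      enlargement visible to the count.\<close>
    obtain c where c: "c \<in> A" "b - h N * c \<in> B m"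
      using reduce_mod[OF h_A h_ord(1)[OF N] b(1)] unfolding m_def by blast
    have hc: "h N * c \<in> J" using hJ h_idealI[OF c(1)] by blast
    have "b - h N * c \<in> Jb" using bJb[OF J_diff[OF J_0 hc]] by simp
    moreover have "b - h N * c \<notin> J" using J_add[OF _ hc, of "b - h N * c"] b(2) by auto
    ultimately have "J \<inter> B m \<subset> Jb \<inter> B m" using JJb c(2) by blast
    then have "card (J \<inter> B m) < card (Jb \<inter> B m)"
      using finite_B by (intro psubset_card_mono) auto
    then show False using le by simp
  qed
  have "affine_prime n p \<iota> x y a0 J N"
  proof unfold_locales
    show "1 \<notin> J" using J_mult[of 1 a] a(1) aJ by auto
    show "h N \<in> J" using hJ h_idealI[OF A_1, of N] by auto
    fix b c assume bc: "b \<in> A" "c \<in> A" "b * c \<in> J"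
    show "b \<in> J \<or> c \<in> J"
    proof (rule ccontr)
      assume "\<not> ?thesis"
      then obtain j d j' d' where 1: "j \<in> J" "d \<in> A" "a = j + b * d" and 2: "j' \<in> J" "d' \<in> A" "a = j' + c * d'"
        using extend[OF bc(1)] extend[OF bc(2)] by blast
      have "a * a = (j + b * d) * (j' + c * d')" using 1(3) 2(3) by simp
      also have "\<dots> = j * (j' + c * d') + (j' * (b * d) + (b * c) * (d * d'))"
        by (simp add: algebra_simps)
      also have "\<dots> \<in> J"
        unfolding 2(3)[symmetric]
        by (rule J_add[OF J_mult[OF 1(1) a(1)] J_add[OF J_mult[OF 2(1) A_mult[OF bc(1) 1(2)]]
              J_mult[OF bc(3) A_mult[OF 1(2) 2(2)]]]])
      finally have sq: "a * a \<in> J" .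
      obtain k where "q ^ (2 * N) = Suc (Suc k)"
        using frobenius_exp[OF N] by blast
      then have "a ^ q ^ (2 * N) = (a * a) * a ^ k" by (simp add: mult.assoc)
      then have "a ^ q ^ (2 * N) \<in> J" using J_mult[OF sq coord.R_power[OF a(1)]] by simp
      moreover have "a ^ q ^ (2 * N) - a \<in> J" using hJ frobenius_mod_h[OF a(1)] by blast
      ultimately have "a ^ q ^ (2 * N) - (a ^ q ^ (2 * N) - a) \<in> J" by (rule J_diff)
      then show False using aJ by simp
    qed
  qed (use JA J_diff J_mult N in auto)
  then show ?thesis using aJ by blast
qed

text \<open>Write \<open>z\<close> over a power of \<open>h N\<close> and cancel one factor at a
  time: the numerator lies in every prime over \<open>h N\<close>, hence is a multiple of
  \<open>h N\<close> by \<open>ex_prime_avoiding\<close>.\<close>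

lemma in_A_if_all_affine:
  assumes z: "z \<in> F" and Aff: "\<And>P. P \<in> Aff \<Longrightarrow> z \<in> P"
  shows "z \<in> A"
proof (cases "z = 0")
  case False
  obtain a b where ab: "z = a / b" "a \<in> A" "b \<in> A" "a \<noteq> 0" "b \<noteq> 0"
    by (rule nonzero_decomp[OF z False])
  obtain N M c where N: "N \<ge> 1" "c \<in> A" "b * c = h N ^ M"
    using divides_h_power[OF ab(3,5)] by blast
  note hN = h_ord(1)[OF N(1)]
  have "c \<noteq> 0" using N(3) hN by auto
  then have "z = (a * c) / h N ^ M" using ab by (simp flip: N(3))
  moreover have "d / h N ^ M \<in> A" if "d \<in> A" "\<And>P. P \<in> Aff \<Longrightarrow> d / h N ^ M \<in> P" for d
    using that
  proof (induction M arbitrary: d)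
    case (Suc M)
    show ?case
    proof (cases "d \<in> h_ideal N")
      case True
      then obtain d' where "d' \<in> A" "d = h N * d'" by (auto simp: h_ideal_def)
      then show ?thesis using Suc.IH[of d'] Suc.prems(2) hN by simp
    next
      case False
      obtain I where I: "affine_prime n p \<iota> x y a0 I N" "d \<notin> I"
        using ex_prime_avoiding[OF N(1) Suc.prems(1) False] by blast
      interpret affine_prime n p k_type \<iota> x y a0 I N
        by (rule I(1))
      have "d / h N ^ Suc M \<in> R" by (rule Suc.prems(2)[OF affine_prime_R_Aff[OF I(1)]])
      then have "h N * ((d / h N ^ Suc M) * h N ^ M) \<in> max_ideal R"
        unfolding loc.max_ideal_eq using loc.R_mult[OF _ loc.R_power[OF loc.t_R]] by blast
      moreover have "h N * ((d / h N ^ Suc M) * h N ^ M) = d" using hN by simp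
      ultimately show ?thesis using A_max_ideal[OF Suc.prems(1)] I(2) by simp
    qed
  qed simp
  ultimately show ?thesis using A_mult[OF ab(2) N(2)] Aff by simp
qed (simp add: A_0)

text \<open>An algebraic element lies in every place, since valuation rings are integrally closed.
  Without affine poles it is in \<open>A\<close>, and without a pole at infinity it is in
  \<open>B 1\<close>, the constants.\<close>

lemma full_constant_field: "full_constant_field \<iota> F"
  unfolding full_constant_field_def
proof (intro ballI impI)
  fix z assume z: "z \<in> F" and "\<exists>g::'k poly. g \<noteq> 0 \<and> poly (map_poly \<iota> g) z = 0"
  then obtain g :: "'k poly" where g: "g \<noteq> 0" "poly (map_poly \<iota> g) z = 0" by blast
  have all: "z \<in> P" if P: "P \<in> places \<iota> F" for P
  proof -
    interpret place_over \<iota> F P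
      by (rule place_over[OF P])
    have lead: "lead_coeff (map_poly \<iota> g) = \<iota> (lead_coeff g)"
      by (intro lead_coeff_map_poly_nz) (auto simp: \<iota>_eq_0_iff \<iota>_0 g)
    show ?thesis
    proof (rule integral_in_R[OF z _ _ _ g(2)])
      show "map_poly \<iota> g \<noteq> 0"
        using lead g(1) \<iota>_eq_0_iff by (metis coeff_0 leading_coeff_0_iff)
      show "coeff (map_poly \<iota> g) i \<in> P" for i
        by (simp add: coeff_map_poly \<iota>_0 R_\<iota>)
      show "inverse (lead_coeff (map_poly \<iota> g)) \<in> P"
        unfolding lead by (simp add: R_\<iota> flip: \<iota>_inverse)
    qed
  qed
  have zA: "z \<in> A" by (rule in_A_if_all_affine[OF z all]) (rule Aff_place)
  have "z \<in> Pinf" using all infty.is_place by blast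
  then have "z \<in> B 1" using A_pole_order[OF zA, of 0] by simp
  then show "z \<in> range \<iota>" by (rule B_1)
qed

subsection \<open>The genus\<close>

text \<open>All zeros of \<open>h N\<close> get the same coefficient: \<open>h N\<close> is a
  uniformizer at each, so its \<open>M\<close>-th power clears exactly these poles.\<close>

definition zero_divisor :: "nat \<Rightarrow> nat \<Rightarrow> nat \<Rightarrow> 'l set \<Rightarrow> int" where
  "zero_divisor N M m P = (if P = Pinf then int m else if P \<in> Zeros N then int M else 0)"

lemma h_Pinf:
  assumes N: "N \<ge> 1"
  defines "w \<equiv> h N * (x / y) powi int (ord (h N))"
  shows "w \<in> Pinf" and "inverse w \<in> Pinf" and "w \<noteq> 0"
proof -
  note hN = h_ord(1)[OF N]
  show "w \<noteq> 0" using hN x_nonzero y_nonzero by (simp add: w_def)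
  show "w \<in> Pinf" unfolding w_def A_pole_order[OF h_A] by (rule ord_B[OF h_A])
  define i where "i = ord (h N)"
  have i: "x ^ i * h N \<in> A" "x ^ i * h N \<noteq> 0" "ord (x ^ i * h N) = (p + 1) * i"
    using hN x_A x_nonzero h_A by (simp_all add: A_mult coord.R_power ord_mult ord_power ord_x i_def)
  have "y ^ i / (x ^ i * h N) \<in> Pinf"
    using i y_A y_nonzero by (subst Pinf_iff) (auto simp: B_iff coord.R_power ord_power ord_y)
  then show "inverse w \<in> Pinf" by (simp add: w_def i_def power_divide field_simps)
qed

text \<open>Multiplication trades poles at the zeros of \<open>h N\<close> for a pole at infinity;
  at other affine places \<open>h N\<close> is a unit. That the product lies in \<open>A\<close> is
  integral closedness.\<close>

lemma L_zero_divisor: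
  assumes N: "N \<ge> 1"
  shows "z \<in> L (zero_divisor N M m) \<longleftrightarrow> h N ^ M * z \<in> B (Suc (m + M * ord (h N)))"
proof (cases "z = 0")
  case True
  then show ?thesis using V.subspace_0[OF subspace_L] B_zero by simp
next
  case z0: False
  note hN = h_ord(1)[OF N]
  define u where "u = h N * (x / y) powi int (ord (h N))"
  note u = h_Pinf[OF N, folded u_def]
  define w where "w = h N ^ M * z"
  have zw: "z = w * inverse (h N) ^ M" using hN by (simp add: w_def field_simps)
  have w0: "w \<noteq> 0" using z0 hN by (simp add: w_def)
  have xy: "x / y \<noteq> 0" using x_nonzero y_nonzero by simp
  have inf: "z * (x / y) powi int m * u ^ M = w * (x / y) powi int (m + M * ord (h N))"
  proof -
    have "u ^ M = h N ^ M * (x / y) ^ (M * ord (h N))"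
      by (simp add: u_def power_mult_distrib mult.commute[of M] power_mult)
    then show ?thesis unfolding power_int_of_nat power_add by (simp add: w_def ac_simps)
  qed
  have Aff_z: "z \<in> F \<Longrightarrow> (valuation P z \<ge> - zero_divisor N M m P) \<longleftrightarrow> w \<in> P" if P: "P \<in> Aff" for P
  proof (cases "P \<in> Zeros N")
    case True
    assume "z \<in> F"
    then show ?thesis
      using discrete_place.valuation_ge_iff[OF Zeros_discrete[OF True N] _ z0, of "- int M"]
        True P Pinf_notin_Aff by (auto simp: zero_divisor_def w_def mult.commute)
  next
    case False
    assume zF: "z \<in> F"
    interpret subring_over \<iota> F P
      by (rule place_subring[OF Aff_place[OF P]])
    have h: "h N \<in> P" "inverse (h N) \<in> P"
      using False P hN h_A A_sub_Aff[OF P] by (auto simp: Zeros_def max_ideal_def)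
    have "valuation P z \<ge> 0 \<longleftrightarrow> z \<in> P"
      using discrete_place.valuation_ge_iff[OF discrete[OF Aff_place[OF P]] zF z0, of 0] by simp
    moreover have "z \<in> P \<longleftrightarrow> w \<in> P"
      using R_mult[OF R_power[OF h(1), of M], of z] R_mult[OF _ R_power[OF h(2), of M], of w]
      by (auto simp flip: zw w_def)
    ultimately show ?thesis using False P Pinf_notin_Aff by (auto simp: zero_divisor_def)
  qed
  have inf_z: "z \<in> F \<Longrightarrow> (valuation Pinf z \<ge> - zero_divisor N M m Pinf) \<longleftrightarrow> z * (x / y) powi int m \<in> Pinf"
    using infty.valuation_ge_iff[OF _ z0, of "- int m"] by (simp add: zero_divisor_def)
  have inf_w: "z * (x / y) powi int m \<in> Pinf \<longleftrightarrow> w * (x / y) powi int (m + M * ord (h N)) \<in> Pinf"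
  proof
    assume "z * (x / y) powi int m \<in> Pinf"
    then show "w * (x / y) powi int (m + M * ord (h N)) \<in> Pinf"
      unfolding inf[symmetric] by (rule infty.R_mult[OF _ infty.R_power[OF u(1)]])
  next
    assume "w * (x / y) powi int (m + M * ord (h N)) \<in> Pinf"
    then have "(z * (x / y) powi int m * u ^ M) * inverse u ^ M \<in> Pinf"
      unfolding inf[symmetric] by (rule infty.R_mult[OF _ infty.R_power[OF u(2)]])
    then show "z * (x / y) powi int m \<in> Pinf" using u(3) by (simp add: field_simps)
  qed
  have zF: "z \<in> F" if "w \<in> F"
  proof -
    have "inverse (h N) ^ i \<in> F" for i
      by (induction i) (auto intro: F_mult F_inverse A_F A_1 h_A simp del: power_inverse)
    then show ?thesis unfolding zw by (rule F_mult[OF that])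
  qed
  have wF: "w \<in> F" if "z \<in> F"
    unfolding w_def by (rule F_mult[OF A_F[OF coord.R_power[OF h_A]] that])
  show ?thesis
  proof
    assume z: "z \<in> L (zero_divisor N M m)"
    then have zF: "z \<in> F" and val: "\<And>P. P \<in> places \<iota> F \<Longrightarrow> valuation P z \<ge> - zero_divisor N M m P"
      using z0 by (auto simp: riemann_roch_space_def)
    have wA: "w \<in> A"
    proof (rule in_A_if_all_affine[OF wF[OF zF]])
      fix P assume P: "P \<in> Aff"
      show "w \<in> P" using Aff_z[OF P zF] val[OF Aff_place[OF P]] by blast
    qed
    have "w * (x / y) powi int (m + M * ord (h N)) \<in> Pinf"
      using val[OF infty.is_place] inf_z[OF zF] inf_w by blast
    then have "w \<in> B (Suc (m + M * ord (h N)))" by (simp only: A_pole_order[OF wA])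
    then show "h N ^ M * z \<in> B (Suc (m + M * ord (h N)))" by (simp only: w_def)
  next
    assume "h N ^ M * z \<in> B (Suc (m + M * ord (h N)))"
    then have wB: "w \<in> B (Suc (m + M * ord (h N)))" by (simp only: w_def)
    then have wA: "w \<in> A" using B_A by blast
    have zF: "z \<in> F" by (rule zF[OF A_F[OF wA]])
    have "valuation P z \<ge> - zero_divisor N M m P" if "P \<in> places \<iota> F" for P
    proof (cases "P = Pinf")
      case True
      have "z * (x / y) powi int m \<in> Pinf" using wB A_pole_order[OF wA] inf_w by blast
      then show ?thesis using inf_z[OF zF] True by blast
    next
      case False
      then have "P \<in> Aff" using that places_eq by blast
      then show ?thesis using Aff_z[OF _ zF] A_sub_Aff wA by blast
    qed
    then show "z \<in> L (zero_divisor N M m)" using zF by (auto simp: riemann_roch_space_def)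
  qed
qed

lemma ell_zero_divisor:
  assumes N: "N \<ge> 1" and m: "m \<ge> p\<^sup>2"
  shows "finite (L (zero_divisor N M m))"
    and "ell \<iota> F (zero_divisor N M m) + genus = m + M * ord (h N) + 1"
proof -
  note hN = h_ord(1)[OF N]
  let ?L = "L (zero_divisor N M m)" and ?B = "B (Suc (m + M * ord (h N)))"
  have "bij_betw (\<lambda>z. h N ^ M * z) ?L ?B"
    by (rule bij_betwI[where g = "\<lambda>w. w / h N ^ M"]) (use hN in \<open>auto simp: L_zero_divisor[OF N]\<close>)
  then have fin: "finite ?L" and card: "card ?L = card ?B"
    using finite_B bij_betw_finite bij_betw_same_card by blast+
  show "finite ?L" by (rule fin)
  have "CARD('k) ^ V.dim ?L = CARD('k) ^ V.dim ?B"
    using card card_subspace[OF subspace_L fin] card_subspace[OF subspace_B finite_B] by simp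
  then have "V.dim ?L = V.dim ?B" using card_k_gt_1 by (simp add: power_inject_exp)
  then show "ell \<iota> F (zero_divisor N M m) + genus = m + M * ord (h N) + 1"
    unfolding ell_def using dim_B_large[of "Suc (m + M * ord (h N))"] m by simp
qed

text \<open>Degree 0 would leave a single residue class, making 1 congruent to 0.\<close>

lemma place_degree_pos:
  assumes P: "P \<in> places \<iota> F"
  shows "place_degree \<iota> P \<ge> 1"
proof (rule ccontr)
  assume deg: "\<not> ?thesis"
  interpret discrete_place \<iota> F P "unif P"
    by (rule discrete[OF P])
  obtain T where T: "transversal (max_ideal P) P T"
    using ex_transversal[OF P] by blast
  have "card T = 1" using place_degree[OF P T] deg by simp
  then obtain t where t: "T = {t}" by (rule card_1_singletonE)
  have "0 - t \<in> max_ideal P" "1 - t \<in> max_ideal P"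
    using T R_0 R_1 unfolding transversal_def t by blast+
  from V.subspace_diff[OF subspace_max_ideal this(2,1)] have "1 \<in> max_ideal P"
    by simp
  then show False by (simp add: max_ideal_def R_1)
qed

text \<open>Chinese remainder theorem, in the form of an inequality: the residues at the zeros of \<open>h N\<close> inject
  into \<open>A / h A\<close>, which has \<open>q\<^bsup>ord (h N)\<^esup>\<close> elements.\<close>

lemma sum_degree_zeros_le:
  assumes N: "N \<ge> 1" and S: "finite S" "S \<subseteq> Zeros N"
  shows "(\<Sum>P\<in>S. place_degree \<iota> P) \<le> ord (h N)"
proof -
  note hN = h_ord(1)[OF N]
  \<comment> \<open>Multiplication by \<open>h N\<close> maps B(p^2) into B(m); past the gaps their
    dimensions differ by exactly \<open>ord (h N)\<close>.\<close>
  define m where "m = ord (h N) + p\<^sup>2"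
  let ?I = "\<lambda>P. A \<inter> max_ideal P"
  have prime: "affine_prime n p \<iota> x y a0 (?I P) N" and P_eq: "affine_prime.R \<iota> x y (?I P) = P"
    and place: "P \<in> places \<iota> F" if "P \<in> S" for P
    using Zeros_prime[OF _ N] S(2) that by (auto simp: Zeros_def Aff_def)
  \<comment> \<open>An inclusion of primes reverses to one of local rings, which maximality turns
    into equality.\<close>
  have "\<exists>s. s \<in> ?I Q \<and> s \<notin> ?I P" if PQ: "P \<in> S" "Q \<in> S" "P \<noteq> Q" for P Q
  proof (rule ccontr)
    assume "\<not> ?thesis"
    then have sub: "?I Q \<subseteq> ?I P" by blast
    interpret IP: affine_prime n p k_type \<iota> x y a0 "?I P" N
      by (rule prime[OF PQ(1)])
    interpret IQ: affine_prime n p k_type \<iota> x y a0 "?I Q" N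
      by (rule prime[OF PQ(2)])
    have "IP.R \<subseteq> IQ.R" unfolding IP.R_def IQ.R_def using sub by blast
    then have "IQ.R = IP.R" by (rule IP.loc.maximal[OF IQ.loc.is_place])
    then show False using P_eq PQ by metis
  qed
  then obtain s where s: "\<And>P Q. P \<in> S \<Longrightarrow> Q \<in> S \<Longrightarrow> P \<noteq> Q \<Longrightarrow> s P Q \<in> ?I Q \<and> s P Q \<notin> ?I P"
    by metis
  \<comment> \<open>Vanishes at the other points but not at \<open>P\<close>. It need not be 1 at
    \<open>P\<close>, which injectivity tolerates.\<close>
  define f where "f P = (\<Prod>Q\<in>S - {P}. s P Q)" for P
  have f_notin: "f P \<in> A - ?I P" if P: "P \<in> S" for P
  proof -
    interpret IP: affine_prime n p k_type \<iota> x y a0 "?I P" N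
      by (rule prime[OF P])
    show ?thesis unfolding f_def using s[OF P] by (intro IP.notin_I_prod) blast
  qed
  have f_in: "f P \<in> ?I Q" if PQ: "P \<in> S" "Q \<in> S" "P \<noteq> Q" for P Q
  proof -
    interpret IQ: affine_prime n p k_type \<iota> x y a0 "?I Q" N
      by (rule prime[OF PQ(2)])
    have "f P = s P Q * (\<Prod>R\<in>S - {P} - {Q}. s P R)"
      unfolding f_def using S(1) PQ by (intro prod.remove) auto
    moreover have "(\<Prod>R\<in>S - {P} - {Q}. s P R) \<in> A"
      using s[OF PQ(1)] by (intro coord.R_prod) blast
    ultimately show ?thesis using IQ.I_mult s[OF PQ] by simp
  qed
  have "\<exists>T. T \<subseteq> A \<and> transversal (max_ideal P) P T" if "P \<in> S" for P
    using Zeros_transversal[OF _ N] S(2) that by blast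
  then obtain T where T: "\<And>P. P \<in> S \<Longrightarrow> T P \<subseteq> A" "\<And>P. P \<in> S \<Longrightarrow> transversal (max_ideal P) P (T P)"
    by metis
  have "\<exists>r. r \<in> B m \<and> a - r \<in> h_ideal N" if "a \<in> A" for a
  proof -
    obtain b where "b \<in> A" "a - h N * b \<in> B m"
      using reduce_mod[OF h_A hN \<open>a \<in> A\<close>] unfolding m_def by blast
    then show ?thesis by (intro exI[of _ "a - h N * b"]) (simp add: h_idealI)
  qed
  then obtain r where r: "\<And>a. a \<in> A \<Longrightarrow> r a \<in> B m \<and> a - r a \<in> h_ideal N"
    by metis
  define \<Sigma>f where "\<Sigma>f c = (\<Sum>P\<in>S. f P * c P)" for c
  \<comment> \<open>The first component carries the residues, the second the multiples of
    \<open>h N\<close>. The map need not be linear, as \<open>r\<close> is a choice; cardinalities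
    are compared.\<close>
  define \<Phi> where "\<Phi> = (\<lambda>(c, b). r (\<Sigma>f c) + h N * b)"
  let ?C = "PiE S T"
  have \<Sigma>f_A: "\<Sigma>f c \<in> A" if "c \<in> ?C" for c
    unfolding \<Sigma>f_def using that f_notin T(1) by (intro coord.R_sum A_mult) (auto simp: PiE_iff)
  have into: "\<Phi> ` (?C \<times> B (p\<^sup>2)) \<subseteq> B m"
  proof
    fix z assume "z \<in> \<Phi> ` (?C \<times> B (p\<^sup>2))"
    then obtain c b where cb: "c \<in> ?C" "b \<in> B (p\<^sup>2)" "z = r (\<Sigma>f c) + h N * b"
      by (auto simp: \<Phi>_def)
    have "b * h N \<in> B (p\<^sup>2 + ord (h N))" by (rule B_mult[OF cb(2) ord_B[OF h_A]])
    then have "h N * b \<in> B m" by (simp add: m_def ac_simps)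
    then show "z \<in> B m"
      unfolding cb(3) using r[OF \<Sigma>f_A[OF cb(1)]] by (intro B_add) auto
  qed
  have inj: "inj_on \<Phi> (?C \<times> B (p\<^sup>2))"
  proof (rule inj_onI, clarify)
    fix c b c' b'
    assume c: "c \<in> ?C" and c': "c' \<in> ?C" and b: "b \<in> B (p\<^sup>2)" "b' \<in> B (p\<^sup>2)" and "\<Phi> (c, b) = \<Phi> (c', b')"
    then have eq: "r (\<Sigma>f c) + h N * b = r (\<Sigma>f c') + h N * b'"
      by (simp add: \<Phi>_def)
    have bA: "b \<in> A" "b' \<in> A" using b B_A by blast+
    have "(\<Sigma>f c - r (\<Sigma>f c)) - (\<Sigma>f c' - r (\<Sigma>f c')) + (h N * b' - h N * b) \<in> h_ideal N"
      using r[OF \<Sigma>f_A[OF c]] r[OF \<Sigma>f_A[OF c']]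
      by (intro h_ideal_add h_ideal_diff[of "\<Sigma>f c - r (\<Sigma>f c)"] h_ideal_diff[of "h N * b'"] h_idealI bA) auto
    moreover have "(\<Sigma>f c - r (\<Sigma>f c)) - (\<Sigma>f c' - r (\<Sigma>f c')) + (h N * b' - h N * b) = \<Sigma>f c - \<Sigma>f c'"
    proof -
      have "(u - v) - (u' - v') + (w' - w) = u - u'" if "v + w = v' + w'" for u v u' v' w w' :: 'l
        using that by (simp add: algebra_simps)
      from this[OF eq] show ?thesis .
    qed
    ultimately have diff: "\<Sigma>f c - \<Sigma>f c' \<in> h_ideal N" by simp
    have "c P = c' P" if P: "P \<in> S" for P
    proof -
      interpret IP: affine_prime n p k_type \<iota> x y a0 "?I P" N
        by (rule prime[OF P])
      interpret dP: discrete_place \<iota> F P "unif P"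
        by (rule discrete[OF place[OF P]])
      have cA: "c Q - c' Q \<in> A" if "Q \<in> S" for Q
        using c c' T(1) that by (auto simp: PiE_iff intro!: A_diff)
      have "\<Sigma>f c - \<Sigma>f c' = (\<Sum>Q\<in>S. f Q * (c Q - c' Q))"
        by (simp add: \<Sigma>f_def sum_subtractf right_diff_distrib)
      also have "\<dots> = f P * (c P - c' P) + (\<Sum>Q\<in>S - {P}. f Q * (c Q - c' Q))"
        using S(1) P by (rule sum.remove)
      finally have "f P * (c P - c' P) = (\<Sigma>f c - \<Sigma>f c') - (\<Sum>Q\<in>S - {P}. f Q * (c Q - c' Q))"
        by simp
      moreover have "\<Sigma>f c - \<Sigma>f c' \<in> ?I P" by (rule IP.h_ideal_I[OF diff])
      moreover have "(\<Sum>Q\<in>S - {P}. f Q * (c Q - c' Q)) \<in> ?I P"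
        using P by (intro IP.I_sum IP.I_mult f_in cA) auto
      ultimately have "f P * (c P - c' P) \<in> ?I P" using IP.I_diff by metis
      then have "c P - c' P \<in> ?I P"
        using IP.I_prime[of "f P" "c P - c' P"] f_notin[OF P] cA[OF P] by blast
      then have "c P - c' P \<in> max_ideal P" by blast
      moreover have "c P - c P \<in> max_ideal P"
        using V.subspace_0[OF dP.subspace_max_ideal] by simp
      moreover have "c P \<in> T P" "c' P \<in> T P" "T P \<subseteq> P"
        using c c' P T(2)[OF P] by (auto simp: PiE_iff transversal_def)
      ultimately show ?thesis using T(2)[OF P] unfolding transversal_def by blast
    qed
    then have cc: "c = c'" using c c' by (intro PiE_ext[of c S T]) auto
    moreover have "b = b'" using eq hN by (simp add: cc)
    ultimately show "c = c' \<and> b = b'" by simp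
  qed
  have "card (?C \<times> B (p\<^sup>2)) \<le> card (B m)"
    by (rule card_inj_on_le[OF inj into finite_B])
  moreover have "card ?C = CARD('k) ^ (\<Sum>P\<in>S. place_degree \<iota> P)"
  proof -
    have "card (T P) = CARD('k) ^ place_degree \<iota> P" if "P \<in> S" for P
      by (rule place_degree[OF place[OF that] T(2)[OF that]])
    then show ?thesis using S(1) by (simp add: card_PiE power_sum)
  qed
  ultimately have "CARD('k) ^ ((\<Sum>P\<in>S. place_degree \<iota> P) + V.dim (B (p\<^sup>2))) \<le> CARD('k) ^ V.dim (B m)"
    by (simp add: card_cartesian_product card_subspace[OF subspace_B finite_B] power_add)
  then have "(\<Sum>P\<in>S. place_degree \<iota> P) + V.dim (B (p\<^sup>2)) \<le> V.dim (B m)"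
    using card_k_gt_1 by simp
  then show ?thesis using dim_B_large[of "p\<^sup>2"] dim_B_large[of m] by (simp add: m_def)
qed

lemma finite_Zeros:
  assumes N: "N \<ge> 1"
  shows "finite (Zeros N)"
proof (rule conjunct1[OF finite_if_finite_subsets_card_bdd])
  show "card S \<le> ord (h N)" if S: "finite S" "S \<subseteq> Zeros N" for S
  proof -
    have "card S = (\<Sum>P\<in>S. 1)" by simp
    also have "\<dots> \<le> (\<Sum>P\<in>S. place_degree \<iota> P)"
      using S(2) by (intro sum_mono place_degree_pos) (auto simp: Zeros_def Aff_def)
    also have "\<dots> \<le> ord (h N)" by (rule sum_degree_zeros_le[OF N S])
    finally show ?thesis .
  qed
qed

lemma zero_divisor:
  assumes N: "N \<ge> 1"
  shows "zero_divisor N M m \<in> divisors \<iota> F"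
    and "divisor_degree \<iota> (zero_divisor N M m) = int m + int M * int (\<Sum>P\<in>Zeros N. place_degree \<iota> P)"
proof -
  have supp: "{P. zero_divisor N M m P \<noteq> 0} \<subseteq> insert Pinf (Zeros N)"
    by (auto simp: zero_divisor_def)
  have fin: "finite (insert Pinf (Zeros N))" using finite_Zeros[OF N] by simp
  have sub: "insert Pinf (Zeros N) \<subseteq> places \<iota> F"
    using infty.is_place by (auto simp: Zeros_def Aff_def)
  show "zero_divisor N M m \<in> divisors \<iota> F"
    unfolding divisors_def using finite_subset[OF supp fin] supp sub by blast
  have notin: "Pinf \<notin> Zeros N" using Pinf_notin_Aff by (simp add: Zeros_def)
  have "divisor_degree \<iota> (zero_divisor N M m)
      = (\<Sum>P\<in>insert Pinf (Zeros N). zero_divisor N M m P * int (place_degree \<iota> P))"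
    by (rule divisor_degree_eq[OF fin supp])
  also have "\<dots> = int m + (\<Sum>P\<in>Zeros N. zero_divisor N M m P * int (place_degree \<iota> P))"
    using finite_Zeros[OF N] notin by (simp add: Pinf_degree zero_divisor_def)
  also have "(\<Sum>P\<in>Zeros N. zero_divisor N M m P * int (place_degree \<iota> P))
      = (\<Sum>P\<in>Zeros N. int M * int (place_degree \<iota> P))"
    using notin by (intro sum.cong) (auto simp: zero_divisor_def)
  finally show "divisor_degree \<iota> (zero_divisor N M m) = int m + int M * int (\<Sum>P\<in>Zeros N. place_degree \<iota> P)"
    by (simp add: sum_distrib_left)
qed

text \<open>The maximum is attained at p^2 times infinity; for the upper bound every divisor is
  enlarged to a \<open>zero_divisor\<close>.\<close>

lemma has_genus: "has_genus \<iota> F genus"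
  unfolding has_genus_def
proof
  show "\<exists>D\<in>divisors \<iota> F. divisor_degree \<iota> D - int (ell \<iota> F D) + 1 = int genus"
  proof
    define m where "m = p\<^sup>2"
    show "zero_divisor 1 0 m \<in> divisors \<iota> F" by (rule zero_divisor(1)) simp
    have "ell \<iota> F (zero_divisor 1 0 m) + genus = m + 1"
      using ell_zero_divisor(2)[of 1 m 0] by (simp add: m_def)
    then show "divisor_degree \<iota> (zero_divisor 1 0 m) - int (ell \<iota> F (zero_divisor 1 0 m)) + 1 = int genus"
      using zero_divisor(2)[of 1 0 m] by simp
  qed
next
  show "\<forall>D\<in>divisors \<iota> F. divisor_degree \<iota> D - int (ell \<iota> F D) + 1 \<le> int genus"
  proof
    fix D assume D: "D \<in> divisors \<iota> F"
    define S where "S = {P. D P \<noteq> 0}"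
    have S: "finite S" "S \<subseteq> places \<iota> F" using D by (auto simp: S_def divisors_def)
    have "\<exists>N. N \<ge> 1 \<and> P \<in> Zeros N" if "P \<in> S \<inter> Aff" for P
      using Aff_Zeros that by blast
    then obtain f where f: "\<And>P. P \<in> S \<inter> Aff \<Longrightarrow> f P \<ge> 1 \<and> P \<in> Zeros (f P)"
      by metis
    \<comment> \<open>The product makes \<open>h N\<close> a multiple of each
      \<open>h (f P)\<close>, so a single \<open>h N\<close> vanishes at all affine points of the
      support.\<close>
    define N where "N = (\<Prod>P\<in>S \<inter> Aff. f P)"
    have N: "N \<ge> 1" unfolding N_def using f by (intro prod_ge_1) auto
    have in_Zeros: "P \<in> Zeros N" if P: "P \<in> S \<inter> Aff" for P
    proof -
      interpret discrete_place \<iota> F P "unif P"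
        by (rule discrete) (use P Aff_place in blast)
      have "f P dvd N" unfolding N_def using S(1) P by (intro dvd_prodI) auto
      then have "h N \<in> h_ideal (f P)" by (rule h_dvd)
      then obtain c where "c \<in> A" "h N = h (f P) * c" by (auto simp: h_ideal_def)
      then show ?thesis using f[OF P] max_ideal_mult A_sub_Aff by (auto simp: Zeros_def)
    qed
    define M where "M = nat (\<Sum>P\<in>S. \<bar>D P\<bar>)"
    \<comment> \<open>\<open>M\<close> dominates the coefficient at infinity, and p^2 takes the
      bound past the gaps.\<close>
    define m where "m = M + p\<^sup>2"
    have D_le: "D P \<le> int M" for P
    proof (cases "P \<in> S")
      case True
      have "D P \<le> \<bar>D P\<bar>" by simp
      also have "\<dots> \<le> (\<Sum>P\<in>S. \<bar>D P\<bar>)"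
        using S(1) True by (intro member_le_sum) auto
      finally show ?thesis by (simp add: M_def)
    qed (simp add: S_def)
    have le: "D P \<le> zero_divisor N M m P" for P
    proof (cases "P \<in> S \<and> P \<noteq> Pinf")
      case True
      then have "P \<in> Zeros N" using in_Zeros S(2) places_eq by blast
      then show ?thesis using True D_le by (simp add: zero_divisor_def)
    next
      case False
      then show ?thesis
        using D_le[of P] by (auto simp: zero_divisor_def S_def m_def intro: add_increasing2)
    qed
    have pm: "p\<^sup>2 \<le> m" by (simp add: m_def)
    have "divisor_degree \<iota> D - int (ell \<iota> F D)
        \<le> divisor_degree \<iota> (zero_divisor N M m) - int (ell \<iota> F (zero_divisor N M m))"
      by (rule degree_minus_ell_mono[OF D zero_divisor(1)[OF N] le ell_zero_divisor(1)[OF N pm]])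
    moreover have "M * (\<Sum>P\<in>Zeros N. place_degree \<iota> P) \<le> M * ord (h N)"
      by (intro mult_le_mono2 sum_degree_zeros_le[OF N] finite_Zeros[OF N]) simp
    then have "int M * int (\<Sum>P\<in>Zeros N. place_degree \<iota> P) \<le> int (M * ord (h N))"
      unfolding of_nat_mult[symmetric] of_nat_le_iff .
    ultimately show "divisor_degree \<iota> D - int (ell \<iota> F D) + 1 \<le> int genus"
      using ell_zero_divisor(2)[OF N pm, of M] unfolding zero_divisor(2)[OF N] by linarith
  qed
qed

end

subsection \<open>Rational points\<close>

context curve
begin

definition val :: "'k \<times> 'k \<Rightarrow> 'k poly poly \<Rightarrow> 'k" where
  "val P g = eval2 (\<lambda>c. c) g (fst P) (snd P)"

lemma val_add: "val P (f + g) = val P f + val P g"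
  and val_mult: "val P (f * g) = val P f * val P g"
  and val_monom: "val P (monom (monom c i) j) = c * fst P ^ i * snd P ^ j"
proof -
  have "field_embedding (\<lambda>c::'k. c)" by (simp add: field_embedding_def)
  then show "val P (f + g) = val P f + val P g" "val P (f * g) = val P f * val P g"
    "val P (monom (monom c i) j) = c * fst P ^ i * snd P ^ j"
    by (simp_all add: val_def eval2_add eval2_mult eval2_monom)
qed

lemma val_diff: "val P (f - g) = val P f - val P g"
  using val_add[of P "f - g" g] by (simp add: eq_diff_eq)

lemma val_C_poly: "val P (C_poly p (S_poly p a0)) = 0 \<longleftrightarrow> P \<in> affine_points p a0"
proof -
  have "val P (C_poly p (S_poly p a0)) =
      snd P ^ p + snd P - (fst P ^ (p + 1) + a0 * (fst P)\<^sup>2)"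
    unfolding C_poly_monom val_add val_diff val_monom by simp
  then show ?thesis by (cases P) (simp add: affine_points_def)
qed

text \<open>Evaluation descends to \<open>A\<close> because the curve equation vanishes at the
  point.\<close>

lemma val_cong:
  assumes "P \<in> affine_points p a0" and "ev f = ev g"
  shows "val P f = val P g"
proof -
  have "ev (f - g) = 0" using assms(2) by (simp add: ev_diff)
  then obtain k where "f - g = C_poly p (S_poly p a0) * k" by (auto simp: ev_eq_0_iff)
  then have "val P (f - g) = 0" using assms(1) val_C_poly[of P] by (simp add: val_mult)
  then show ?thesis by (simp add: val_diff)
qed

definition point_ideal :: "'k \<times> 'k \<Rightarrow> 'l set" where
  "point_ideal P = {ev g | g. val P g = 0}"

lemma point_ideal_iff:
  assumes "P \<in> affine_points p a0"
  shows "ev g \<in> point_ideal P \<longleftrightarrow> val P g = 0"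
proof
  assume "ev g \<in> point_ideal P"
  then obtain f where "ev g = ev f" "val P f = 0" by (auto simp: point_ideal_def)
  then show "val P g = 0" using val_cong[OF assms, of g f] by simp
qed (auto simp: point_ideal_def)

lemma h_ev: "h N = ev (monom (monom 1 (q ^ N)) 0 - monom (monom 1 1) 0)"
  unfolding ev_diff ev_monom by (simp add: h_def \<iota>_1)

text \<open>The ideal is the kernel of an evaluation into a field. Index 1 suffices because
  coordinates in \<open>k\<close> are fixed by the \<open>q\<close>-th power map.\<close>

lemma point_ideal_prime:
  assumes P: "P \<in> affine_points p a0"
  shows "affine_prime n p \<iota> x y a0 (point_ideal P) 1"
proof unfold_locales
  show "point_ideal P \<subseteq> A" by (auto simp: point_ideal_def A_def)
  show "a - b \<in> point_ideal P" if ab: "a \<in> point_ideal P" "b \<in> point_ideal P" for a b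
  proof -
    obtain f g where "a = ev f" "b = ev g" "val P f = 0" "val P g = 0"
      using ab by (auto simp: point_ideal_def)
    then have "a - b = ev (f - g)" "val P (f - g) = 0" by (simp_all add: ev_diff val_diff)
    then show ?thesis unfolding point_ideal_def by blast
  qed
  show "a * b \<in> point_ideal P" if ab: "a \<in> point_ideal P" "b \<in> A" for a b
  proof -
    obtain f g where "a = ev f" "b = ev g" "val P f = 0"
      using ab by (auto simp: point_ideal_def A_def)
    then have "a * b = ev (f * g)" "val P (f * g) = 0" by (simp_all add: ev_mult val_mult)
    then show ?thesis unfolding point_ideal_def by blast
  qed
  have "ev (monom (monom 1 0) 0) = 1" "val P (monom (monom 1 0) 0) = 1"
    unfolding ev_monom val_monom by (simp_all add: \<iota>_1)
  then show "1 \<notin> point_ideal P" using point_ideal_iff[OF P, of "monom (monom 1 0) 0"] by simp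
  show "a \<in> point_ideal P \<or> b \<in> point_ideal P" if "a \<in> A" "b \<in> A" "a * b \<in> point_ideal P" for a b
  proof -
    obtain f g where "a = ev f" "b = ev g"
      using \<open>a \<in> A\<close> \<open>b \<in> A\<close> by (auto simp: A_def)
    then show ?thesis using that(3) by (simp add: point_ideal_iff[OF P] val_mult flip: ev_mult)
  qed
  have "val P (monom (monom 1 (q ^ 1)) 0 - monom (monom 1 1) 0) = 0"
    unfolding val_diff val_monom by (simp add: q_def finite_field_power_card)
  then show "h 1 \<in> point_ideal P"
    unfolding h_ev point_ideal_iff[OF P] .
qed simp

definition point_place :: "'k \<times> 'k \<Rightarrow> 'l set" where
  "point_place P = affine_prime.R \<iota> x y (point_ideal P)"

lemma point_place:
  assumes P: "P \<in> affine_points p a0"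
  shows "point_place P \<in> Aff" and "place_degree \<iota> (point_place P) = 1"
    and "x - \<iota> (fst P) \<in> max_ideal (point_place P)" and "y - \<iota> (snd P) \<in> max_ideal (point_place P)"
proof -
  interpret I: affine_prime n p k_type \<iota> x y a0 "point_ideal P" 1
    by (rule point_ideal_prime[OF P])
  have eq: "point_place P = I.R" by (simp add: point_place_def)
  show "point_place P \<in> Aff"
    unfolding eq by (rule affine_prime_R_Aff[OF point_ideal_prime[OF P]])
  have residue: "ev g - \<iota> (val P g) \<in> max_ideal I.R" for g
  proof -
    have "val P (g - monom (monom (val P g) 0) 0) = 0" unfolding val_diff val_monom by simp
    then have "ev (g - monom (monom (val P g) 0) 0) \<in> point_ideal P"
      by (simp only: point_ideal_iff[OF P])
    moreover have "ev (g - monom (monom (val P g) 0) 0) = ev g - \<iota> (val P g)"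
      unfolding ev_diff ev_monom by simp
    moreover have "ev g - \<iota> (val P g) \<in> A" by (intro A_diff A_\<iota>) (simp add: A_def)
    ultimately show ?thesis using I.A_max_ideal by simp
  qed
  show "x - \<iota> (fst P) \<in> max_ideal (point_place P)" "y - \<iota> (snd P) \<in> max_ideal (point_place P)"
    using residue[of "monom (monom 1 1) 0"] residue[of "monom (monom 1 0) 1"]
    unfolding eq ev_monom val_monom by (simp_all add: \<iota>_1)
  show "place_degree \<iota> (point_place P) = 1"
    unfolding eq
  proof (rule I.loc.place_degree_1)
    fix z assume "z \<in> I.R"
    then obtain a where a: "a \<in> A" "z - a \<in> max_ideal I.R"
      using I.A_covers_residues by blast
    then obtain g where "a = ev g" by (auto simp: A_def)
    then have "(z - a) + (a - \<iota> (val P g)) \<in> max_ideal I.R"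
      using a(2) residue[of g] by (intro V.subspace_add[OF I.loc.subspace_max_ideal]) auto
    then show "\<exists>c. z - \<iota> c \<in> max_ideal I.R" by auto
  qed
qed

text \<open>There are as many residue classes as constants, and distinct constants are incongruent,
  so the constants exhaust the classes.\<close>

lemma degree_1_residue:
  assumes R: "R \<in> places \<iota> F" and deg: "place_degree \<iota> R = 1" and z: "z \<in> R"
  shows "\<exists>c. z - \<iota> c \<in> max_ideal R"
proof -
  interpret place_over \<iota> F R
    by (rule place_over[OF R])
  obtain T where T: "transversal (max_ideal R) R T"
    using ex_transversal[OF R] by blast
  define f where "f c = (THE t. t \<in> T \<and> \<iota> c - t \<in> max_ideal R)" for c
  have f: "f c \<in> T \<and> \<iota> c - f c \<in> max_ideal R" for c
    unfolding f_def by (rule theI') (use T R_\<iota> in \<open>auto simp: transversal_def\<close>)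
  have "c = d" if "f c = f d" for c d
  proof (rule residue_unique)
    show "f d - \<iota> c \<in> max_ideal R" "f d - \<iota> d \<in> max_ideal R"
      using f[of c] f[of d] that max_ideal_minus[of "\<iota> _ - f d"] by auto
  qed
  then have inj: "inj f" by (auto intro: injI)
  have "card T = CARD('k)" using place_degree[OF R T] deg by simp
  moreover have "range f \<subseteq> T" "finite T" using f T by (auto simp: transversal_def)
  ultimately have "range f = T" using inj by (intro card_subset_eq) (simp_all add: card_image)
  moreover obtain t where t: "t \<in> T" "z - t \<in> max_ideal R"
    using T z unfolding transversal_def by blast
  ultimately obtain c where c: "t = f c" by blast
  have "(z - t) - (\<iota> c - f c) \<in> max_ideal R"
    using max_ideal_diff[OF t(2)] f[of c] by blast
  then show ?thesis by (auto simp: c)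
qed

text \<open>The residues of \<open>x\<close> and \<open>y\<close> are the coordinates of the point;
  place and point then define the same prime of \<open>A\<close>.\<close>

lemma rational_affine_place:
  assumes R: "R \<in> Aff" and deg: "place_degree \<iota> R = 1"
  shows "\<exists>P\<in>affine_points p a0. R = point_place P"
proof -
  have place: "R \<in> places \<iota> F" by (rule Aff_place[OF R])
  interpret place_over \<iota> F R
    by (rule place_over[OF place])
  have AR: "A \<subseteq> R" by (rule A_sub_Aff[OF R])
  obtain \<alpha> where \<alpha>: "x - \<iota> \<alpha> \<in> max_ideal R"
    using degree_1_residue[OF place deg] x_A AR by blast
  obtain \<beta> where \<beta>: "y - \<iota> \<beta> \<in> max_ideal R"
    using degree_1_residue[OF place deg] y_A AR by blast
  define P where "P = (\<alpha>, \<beta>)"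
  have residue: "ev g - \<iota> (val P g) \<in> max_ideal R" for g
    unfolding ev_def val_def P_def using residue_eval2[OF \<alpha> \<beta>] by simp
  have zero_iff: "ev g \<in> max_ideal R \<longleftrightarrow> val P g = 0" for g
  proof
    assume "ev g \<in> max_ideal R"
    then show "val P g = 0" using residue_unique[OF residue[of g], of 0] by (simp add: \<iota>_0)
  next
    assume "val P g = 0"
    then show "ev g \<in> max_ideal R" using residue[of g] by (simp add: \<iota>_0)
  qed
  have "ev (C_poly p (S_poly p a0)) = 0" by (simp add: ev_eq_0_iff)
  then have P: "P \<in> affine_points p a0"
    using zero_iff[of "C_poly p (S_poly p a0)"] val_C_poly[of P] zero_max_ideal by simp
  have "A \<inter> max_ideal R = point_ideal P" using zero_iff by (auto simp: A_def point_ideal_def)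
  moreover obtain N where "N \<ge> 1" "h N \<in> max_ideal R"
    using affine_place_prime(2)[OF place] R by (auto simp: Aff_def)
  ultimately have "R = point_place P"
    using affine_place_prime(4)[OF place] R by (auto simp: Aff_def point_place_def)
  then show ?thesis using P by blast
qed

lemma rational_points_eq: "rational_points \<iota> F = insert Pinf (point_place ` affine_points p a0)"
proof (intro equalityI subsetI)
  fix R assume "R \<in> rational_points \<iota> F"
  then have R: "R \<in> insert Pinf Aff" "place_degree \<iota> R = 1"
    by (simp_all add: rational_points_def places_eq)
  then show "R \<in> insert Pinf (point_place ` affine_points p a0)"
    using rational_affine_place by blast
next
  fix R assume "R \<in> insert Pinf (point_place ` affine_points p a0)"
  then show "R \<in> rational_points \<iota> F"
    using point_place(1,2) Pinf_degree by (auto simp: rational_points_def places_eq)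
qed

text \<open>The coordinates are recovered from the place as the residues of \<open>x\<close> and
  \<open>y\<close>, and infinity is not affine.\<close>

lemma card_rational_points: "card (rational_points \<iota> F) = card (affine_points p a0) + 1"
proof -
  have "inj_on point_place (affine_points p a0)"
  proof (rule inj_onI)
    fix P Q assume P: "P \<in> affine_points p a0" and Q: "Q \<in> affine_points p a0"
      and eq: "point_place P = point_place Q"
    interpret place_over \<iota> F "point_place P"
      by (rule place_over[OF Aff_place[OF point_place(1)[OF P]]])
    show "P = Q"
      using residue_unique[OF point_place(3)[OF P] point_place(3)[OF Q, folded eq]]
        residue_unique[OF point_place(4)[OF P] point_place(4)[OF Q, folded eq]] by (rule prod_eqI)
  qed
  moreover have "Pinf \<noteq> point_place P" if "P \<in> affine_points p a0" for P
    using point_place(1)[OF that] Pinf_notin_Aff by metis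
  then have "Pinf \<notin> point_place ` affine_points p a0" by blast
  ultimately show ?thesis unfolding rational_points_eq by (simp add: card_image)
qed

lemma maximal:
  assumes a0: "a0 ^ p = a0" "(\<Sum>i<n. a0 ^ 2 ^ i) = 1"
  shows "maximal_model p \<iota> F"
proof -
  have "card (rational_points \<iota> F) = p ^ 3 * (2 * p - 1) + 1"
    using card_rational_points card_affine_points[OF a0] by simp
  also have "p ^ 3 * (2 * p - 1) = p ^ 4 + (p * (p - 1)) * p\<^sup>2"
  proof -
    obtain r where "p = Suc r"
      using p_ge_2 by (cases p) auto
    then show ?thesis by (simp add: power2_eq_square power3_eq_cube power4_eq_xxxx algebra_simps)
  qed
  also have "p ^ 4 + (p * (p - 1)) * p\<^sup>2 + 1 = p ^ 4 + 1 + 2 * genus * p\<^sup>2"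
    using two_genus by simp
  finally have "card (rational_points \<iota> F) = p ^ 4 + 1 + 2 * genus * p\<^sup>2" .
  moreover have "finite (rational_points \<iota> F)" unfolding rational_points_eq by simp
  ultimately show ?thesis
    unfolding maximal_model_def using card_k full_constant_field has_genus by blast
qed

end

theorem corollary6p3:
  fixes p n :: nat and a0 :: "'k::{field,finite}"
  assumes "n \<ge> 1" and "p = 2 ^ n" and "CARD('k) = p ^ 4"
    and "a0 \<in> subfield_of_card (p ^ 2)"
    and "a0 \<in> subfield_of_card p"
    and "finite_field_trace 2 n a0 = 1"
  shows "smooth_compactification_maximal TYPE('l::field) p (C_poly p (S_poly p a0))"
  unfolding smooth_compactification_maximal_def
proof (intro conjI allI impI)
  have "p \<ge> 2" using assms(1,2) self_le_power[of 2 n] by simp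
  then show "geometrically_irreducible (C_poly p (S_poly p a0))"
    by (rule geometrically_irreducible_C_poly)
next
  fix \<iota> :: "'k \<Rightarrow> 'l" and x y
  assume "field_embedding \<iota> \<and> generic_point \<iota> (C_poly p (S_poly p a0)) x y"
  then interpret curve n p "TYPE('k)" \<iota> x y a0 using assms(1-3) by unfold_locales auto
  show "maximal_model p \<iota> (function_field \<iota> x y)"
    using assms(5,6) by (intro maximal) (simp_all add: subfield_of_card_def finite_field_trace_def)
qed

end
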